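(* Let $c_1,c_2\geq 1$ be integers with $c_2\leq c_1\leq 2c_2$. Let $G\cong \mathbb{Z}^{(k)}\oplus \mathbb{Z}_{n_1}\oplus \mathbb{Z}_{n_2}\oplus\cdots\oplus\mathbb{Z}_{n_t}$ be a finitely generated abelian group, where $k,t\ge 0$ are integers, $n_1,\dots,n_t$ are positive integers, and $n_{i+1}\mid n_i$ for all $1\leq i\leq t-1$. For $i\ge 0$ put $b_i=\chi_{c_1+1}(i)\chi_{c_2+1}(i)$ if $c_1>c_2$, and $b_i=\chi_2(\chi_{c_1+1}(i))$ if $c_1=c_2$. Then $$[\mathfrak{N}_{c_1},\mathfrak{N}_{c_2}]M(G)\cong \mathbb{Z}^{(b_{k})}\oplus \mathbb{Z}_{n_1}^{(b_{k+1}-b_k)}\oplus \mathbb{Z}_{n_2}^{(b_{k+2}-b_{k+1})}\oplus\cdots\oplus\mathbb{Z}_{n_t}^{(b_{k+t}-b_{k+t-1})}.$$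
   Context: For a group $X$ and integer $n\ge0$, $X^{(n)}$ denotes the direct sum of $n$ copies of $X$; $\mathbb{Z}_n$ is the cyclic group of order $n$. $\gamma_n(F)$ is the $n$-th term of the lower central series of $F$ (with $\gamma_1(F)=F$). $[\mathfrak{N}_{c_1},\mathfrak{N}_{c_2}]$ is the outer commutator variety defined by the single word $[[x_1,\dots,x_{c_1+1}],[y_1,\dots,y_{c_2+1}]]$ (left-normed commutators in distinct variables), so its verbal subgroup in $F$ is $[\gamma_{c_1+1}(F),\gamma_{c_2+1}(F)]$. Baer invariant: for a variety $\mathfrak{V}$ with set of words $V$ and a group $G\cong F/R$ with $F$ free, $\mathfrak{V}M(G)=\dfrac{R\cap V(F)}{[RV^*F]}$, where $V(F)$ is the verbal subgroup and $[RV^*F]$ is the subgroup generated by all $v(f_1,\ldots,f_{i-1},f_ir,f_{i+1},\ldots,f_n)\,v(f_1,\ldots,f_n)^{-1}$ with $r\in R$, $v\in V$, $f_j\in F$, $1\le i\le n$; up to isomorphism it does not depend on the free presentation. For $\mathfrak V=[\mathfrak{N}_{c_1},\mathfrak{N}_{c_2}]$, $$[\mathfrak{N}_{c_1},\mathfrak{N}_{c_2}]M(G)\cong \frac{R\cap [\gamma_{c_1+1}(F),\gamma_{c_2+1}(F)]}{[R,\,_{c_1}F,\gamma_{c_2+1}(F)]\,[R,\,_{c_2}F,\gamma_{c_1+1}(F)]},$$ where $[R,\,_1F]=[R,F]$, $[R,\,_cF]=[[R,\,_{c-1}F],F]$, and $[R,\,_cF,K]=[[R,\,_cF],K]$. $\chi_n(d)$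 is the number of basic commutators of weight $n$ on $d$ generators, $\chi_n(d)=\frac1n\sum_{m\mid n}\mu(m)d^{n/m}$, with $\mu$ the Möbius function (in particular $\chi_n(0)=0$). *)

theory Defs
  imports "HOL-Algebra.Product_Groups" "HOL-Computational_Algebra.Squarefree"
begin

section \<open>Group words and free groups\<close>

text \<open>A letter \<open>(x, True)\<close> stands for \<open>x\<close>, a letter \<open>(x, False)\<close> for the inverse of \<open>x\<close>.
  Words need not be reduced.\<close>

type_synonym 'x word = "('x \<times> bool) list"

definition inv_letter :: "'x \<times> bool \<Rightarrow> 'x \<times> bool" where
  "inv_letter a = (fst a, \<not> snd a)"

definition inv_word :: "'x word \<Rightarrow> 'x word" where
  "inv_word w = rev (map inv_letter w)"

definition eval_word :: "('a, 'm) monoid_scheme \<Rightarrow> ('x \<Rightarrow> 'a) \<Rightarrow> 'x word \<Rightarrow> 'a" where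
  "eval_word G f w =
     foldr (\<lambda>(x, e) g. (if e then f x else inv\<^bsub>G\<^esub> (f x)) \<otimes>\<^bsub>G\<^esub> g) w \<one>\<^bsub>G\<^esub>"

fun reduced :: "'x word \<Rightarrow> bool" where
  "reduced (a # b # w) \<longleftrightarrow> b \<noteq> inv_letter a \<and> reduced (b # w)"
| "reduced w \<longleftrightarrow> True"

fun cancel_cons :: "'x \<times> bool \<Rightarrow> 'x word \<Rightarrow> 'x word" where
  "cancel_cons a [] = [a]"
| "cancel_cons a (b # w) = (if b = inv_letter a then w else a # b # w)"

definition reduce :: "'x word \<Rightarrow> 'x word" where
  "reduce w = foldr cancel_cons w []"

definition free_group :: "'x set \<Rightarrow> 'x word monoid" where
  "free_group X =
     \<lparr>carrier = {w. reduced w \<and> fst ` set w \<subseteq> X},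
      monoid.mult = (\<lambda>u v. reduce (u @ v)),
      one = []\<rparr>"

text \<open>\<open>F\<close> is free on \<open>X\<close> if the homomorphism from the group of reduced words over \<open>X\<close> that
  extends the inclusion of \<open>X\<close> into \<open>F\<close> is an isomorphism.\<close>

definition free_on :: "('a, 'm) monoid_scheme \<Rightarrow> 'a set \<Rightarrow> bool" where
  "free_on F X \<longleftrightarrow>
     group F \<and> X \<subseteq> carrier F \<and> eval_word F (\<lambda>x. x) \<in> iso (free_group X) F"

definition is_free_group :: "('a, 'm) monoid_scheme \<Rightarrow> bool" where
  "is_free_group F \<longleftrightarrow> (\<exists>X. free_on F X)"

definition free_presentation ::
    "('f, 'm) monoid_scheme \<Rightarrow> 'f set \<Rightarrow> ('g, 'k) monoid_scheme \<Rightarrow> bool" where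
  "free_presentation F R G \<longleftrightarrow> is_free_group F \<and> R \<lhd> F \<and> F Mod R \<cong> G"

lemma inv_letter_inv_letter [simp]: "inv_letter (inv_letter a) = a"
  by (simp add: inv_letter_def)

lemma fst_inv_letter [simp]: "fst (inv_letter a) = fst a"
  by (simp add: inv_letter_def)

lemma inv_letter_neq [simp]: "inv_letter a \<noteq> a" "a \<noteq> inv_letter a"
  by (cases a; simp add: inv_letter_def)+

lemma reduced_Cons: "reduced (a # w) \<Longrightarrow> reduced w"
  by (cases w) auto

lemma reduced_cancel_cons: "reduced w \<Longrightarrow> reduced (cancel_cons a w)"
  by (cases w) (auto dest: reduced_Cons)

lemma cancel_cons_reduced: "reduced (a # w) \<Longrightarrow> cancel_cons a w = a # w"
  by (cases w) auto

lemma cancel_cons_inv: "reduced w \<Longrightarrow> cancel_cons a (cancel_cons (inv_letter a) w) = w"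
  by (cases w) (auto simp: cancel_cons_reduced)

lemma fst_set_cancel_cons: "fst ` set (cancel_cons a w) \<subseteq> insert (fst a) (fst ` set w)"
  by (cases w) auto

lemma reduced_foldr: "reduced v \<Longrightarrow> reduced (foldr cancel_cons u v)"
  by (induction u) (auto intro: reduced_cancel_cons)

lemma reduced_reduce [simp]: "reduced (reduce w)"
  by (simp add: reduce_def reduced_foldr)

lemma reduce_reduced: "reduced w \<Longrightarrow> reduce w = w"
proof (induction w)
  case (Cons a w)
  then have "reduce w = w"
    using reduced_Cons by blast
  then show ?case
    using cancel_cons_reduced[OF Cons.prems] by (simp add: reduce_def)
qed (simp add: reduce_def)

lemma fst_set_reduce: "fst ` set (reduce w) \<subseteq> fst ` set w"
proof (induction w)
  case (Cons a w)
  have "reduce (a # w) = cancel_cons a (reduce w)"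
    by (simp add: reduce_def)
  then show ?case
    using Cons fst_set_cancel_cons[of a "reduce w"] by (simp, blast)
qed (simp add: reduce_def)

lemma foldr_cancel_cons:
  "reduced u \<Longrightarrow> reduced v \<Longrightarrow>
   foldr cancel_cons (cancel_cons a u) v = cancel_cons a (foldr cancel_cons u v)"
proof (cases u)
  case (Cons b u')
  assume "reduced v"
  then show ?thesis
    using Cons cancel_cons_inv[of "foldr cancel_cons u' v" a] reduced_foldr[of v u'] by simp
qed auto

lemma foldr_reduce: "reduced v \<Longrightarrow> foldr cancel_cons (reduce u) v = foldr cancel_cons u v"
proof (induction u)
  case (Cons a u)
  have "reduce (a # u) = cancel_cons a (reduce u)"
    by (simp add: reduce_def)
  then show ?case
    using Cons foldr_cancel_cons[of "reduce u" v a] by simp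
qed (simp add: reduce_def)

lemma reduce_append_left: "reduce (reduce u @ v) = reduce (u @ v)"
  using foldr_reduce[OF reduced_reduce, of u v] by (simp add: reduce_def)

lemma reduce_append_right: "reduce (u @ reduce v) = reduce (u @ v)"
  using reduce_reduced[OF reduced_reduce, of v] by (simp add: reduce_def)

lemma reduce_inv_word: "reduce (inv_word w @ w) = []"
proof (induction w)
  case (Cons a w)
  have "reduce (inv_word (a # w) @ a # w)
      = reduce (inv_word w @ reduce ([inv_letter a, a] @ w))"
    by (simp add: inv_word_def reduce_append_right)
  also have "reduce ([inv_letter a, a] @ w) = reduce w"
    using cancel_cons_inv[of "reduce w" "inv_letter a"] reduced_reduce[of w]
    by (simp add: reduce_def)
  finally show ?case
    using Cons by (simp add: reduce_append_right)
qed (simp add: inv_word_def reduce_def)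

lemma group_free_group: "group (free_group X)"
proof (rule groupI)
  fix u v assume uv: "u \<in> carrier (free_group X)" "v \<in> carrier (free_group X)"
  then have "fst ` set (u @ v) \<subseteq> X"
    by (auto simp: free_group_def)
  then have "fst ` set (reduce (u @ v)) \<subseteq> X"
    using fst_set_reduce by fast
  then show "u \<otimes>\<^bsub>free_group X\<^esub> v \<in> carrier (free_group X)"
    by (simp add: free_group_def)
next
  fix u assume u: "u \<in> carrier (free_group X)"
  have "fst ` set (inv_word u) = fst ` set u"
    by (simp add: inv_word_def image_image)
  then have "fst ` set (reduce (inv_word u)) \<subseteq> X"
    using u fst_set_reduce[of "inv_word u"] by (simp add: free_group_def order_trans)
  then have "reduce (inv_word u) \<in> carrier (free_group X)"
    by (simp add: free_group_def)
  moreover have "reduce (inv_word u) \<otimes>\<^bsub>free_group X\<^esub> u = \<one>\<^bsub>free_group X\<^esub>"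
    by (simp add: free_group_def reduce_append_left reduce_inv_word)
  ultimately show "\<exists>v\<in>carrier (free_group X). v \<otimes>\<^bsub>free_group X\<^esub> u = \<one>\<^bsub>free_group X\<^esub>"
    by blast
qed (simp_all add: free_group_def reduce_append_left reduce_append_right reduce_reduced)

lemma reduce_map:
  assumes "\<And>a. g (inv_letter a) = inv_letter (g a)" "inj_on g A" "set w \<subseteq> A"
      "inv_letter ` A \<subseteq> A"
  shows "reduce (map g w) = map g (reduce w) \<and> set (reduce w) \<subseteq> A"
  using assms(3)
proof (induction w)
  case (Cons a w)
  have 1: "reduce (a # w) = cancel_cons a (reduce w)"
    "reduce (g a # map g w) = cancel_cons (g a) (reduce (map g w))"
    by (simp_all add: reduce_def)
  have "cancel_cons (g a) (map g (reduce w)) = map g (cancel_cons a (reduce w))"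
    using Cons assms(1,2,4)
    by (cases "reduce w") (auto simp: inj_on_def simp flip: assms(1))
  moreover have "set (cancel_cons a (reduce w)) \<subseteq> A"
    using Cons by (cases "reduce w") auto
  ultimately show ?case
    using 1 Cons by simp
qed (simp add: reduce_def)

lemma free_on_free_group: "free_on (free_group X) ((\<lambda>x. [(x, True)]) ` X)"
proof -
  let ?F = "free_group X" and ?Y = "(\<lambda>x. [(x, True)]) ` X"
  let ?i = "\<lambda>x::'a. [(x, True)]"
  interpret group ?F by (rule group_free_group)
  define g :: "('a word \<times> bool) \<Rightarrow> 'a \<times> bool" where "g = (\<lambda>(y, e). (fst (hd y), e))"
  have gi: "g (inv_letter a) = inv_letter (g a)" for a
    by (cases a) (simp add: g_def inv_letter_def)
  have injg: "inj_on g (?Y \<times> UNIV)"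
    by (auto simp: inj_on_def g_def)
  have invA: "inv_letter ` (?Y \<times> UNIV) \<subseteq> ?Y \<times> UNIV"
    by (auto simp: inv_letter_def)
  have inv1: "inv\<^bsub>?F\<^esub> [(x, True)] = [(x, False)]" if "x \<in> X" for x
    by (rule inv_equality) (use that in \<open>auto simp: free_group_def reduce_def inv_letter_def\<close>)
  have ev: "eval_word ?F (\<lambda>x. x) w = reduce (map g w)" if "fst ` set w \<subseteq> ?Y" for w
    using that
  proof (induction w)
    case (Cons a w)
    obtain x e where a: "a = ([(x, True)], e)" "x \<in> X"
      using Cons.prems by (cases a) auto
    have "eval_word ?F (\<lambda>x. x) (a # w) = reduce ([(x, e)] @ eval_word ?F (\<lambda>x. x) w)"
      using a inv1 by (cases e) (simp_all add: eval_word_def, simp_all add: free_group_def)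
    also have "\<dots> = reduce (map g (a # w))"
      using Cons a reduce_append_right[of "[(x,e)]" "map g w"] by (simp add: g_def)
    finally show ?case .
  qed (simp add: eval_word_def free_group_def reduce_def)
  have ev': "eval_word ?F (\<lambda>x. x) w = map g w" if "w \<in> carrier (free_group ?Y)" for w
  proof -
    have "set w \<subseteq> ?Y \<times> UNIV"
      using that by (force simp: free_group_def)
    moreover have "reduced w"
      using that by (simp add: free_group_def)
    ultimately show ?thesis
      using ev[of w] reduce_map[of g, OF gi injg _ invA, of w] that
      by (simp add: reduce_reduced free_group_def)
  qed
  have hom: "eval_word ?F (\<lambda>x. x) \<in> hom (free_group ?Y) ?F"
  proof (rule homI)
    fix u assume u: "u \<in> carrier (free_group ?Y)"
    have "fst ` set (map g u) \<subseteq> X"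
      using u by (force simp: free_group_def g_def)
    then have "fst ` set (reduce (map g u)) \<subseteq> X"
      using fst_set_reduce[of "map g u"] by blast
    then show "eval_word ?F (\<lambda>x. x) u \<in> carrier ?F"
      using ev[of u] u by (simp add: free_group_def)
  next
    fix u v assume uv: "u \<in> carrier (free_group ?Y)" "v \<in> carrier (free_group ?Y)"
    then have "u \<otimes>\<^bsub>free_group ?Y\<^esub> v \<in> carrier (free_group ?Y)"
      using group_free_group group.is_monoid monoid.m_closed by metis
    moreover have "set (u @ v) \<subseteq> ?Y \<times> UNIV"
      using uv by (force simp: free_group_def)
    ultimately show "eval_word ?F (\<lambda>x. x) (u \<otimes>\<^bsub>free_group ?Y\<^esub> v)
        = eval_word ?F (\<lambda>x. x) u \<otimes>\<^bsub>?F\<^esub> eval_word ?F (\<lambda>x. x) v"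
      using ev' uv reduce_map[of g, OF gi injg _ invA, of "u @ v"]
      by (simp add: free_group_def)
  qed
  have bij: "bij_betw (eval_word ?F (\<lambda>x. x)) (carrier (free_group ?Y)) (carrier ?F)"
  proof (rule bij_betw_imageI)
    show "inj_on (eval_word ?F (\<lambda>x. x)) (carrier (free_group ?Y))"
    proof (rule inj_onI)
      fix u v assume uv: "u \<in> carrier (free_group ?Y)" "v \<in> carrier (free_group ?Y)"
        "eval_word ?F (\<lambda>x. x) u = eval_word ?F (\<lambda>x. x) v"
      have "set u \<union> set v \<subseteq> ?Y \<times> UNIV"
        using uv(1,2) by (force simp: free_group_def)
      then have "inj_on g (set u \<union> set v)"
        using injg inj_on_subset by blast
      then show "u = v"
        using uv ev' map_inj_on by metis
    qed
    show "eval_word ?F (\<lambda>x. x) ` carrier (free_group ?Y) = carrier ?F"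
    proof
      show "eval_word ?F (\<lambda>x. x) ` carrier (free_group ?Y) \<subseteq> carrier ?F"
        using hom by (auto simp: hom_def)
      show "carrier ?F \<subseteq> eval_word ?F (\<lambda>x. x) ` carrier (free_group ?Y)"
      proof
        fix w assume w: "w \<in> carrier ?F"
        let ?w = "map (\<lambda>(x, e). (?i x, e)) w"
        have "reduced w \<Longrightarrow> reduced ?w"
          by (induction w rule: reduced.induct) (auto simp: inv_letter_def)
        then have "?w \<in> carrier (free_group ?Y)"
          using w by (force simp: free_group_def)
        moreover have "map g ?w = w"
          by (induction w) (auto simp: g_def)
        ultimately show "w \<in> eval_word ?F (\<lambda>x. x) ` carrier (free_group ?Y)"
          using ev'[of ?w] by (intro image_eqI[where x = ?w]) simp_all
      qed
    qed
  qed
  show ?thesis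
    unfolding free_on_def
    using group_free_group hom bij by (auto simp: iso_def) (auto simp: free_group_def)
qed

section \<open>Verbal subgroups and Baer invariants\<close>

definition verbal_subgroup :: "nat word set \<Rightarrow> ('a, 'm) monoid_scheme \<Rightarrow> 'a set" where
  "verbal_subgroup V F =
     generate F {eval_word F f v | v f. v \<in> V \<and> f \<in> UNIV \<rightarrow> carrier F}"

text \<open>The subgroup written $[RV^*F]$.  The index \<open>i\<close> ranges over all variables; one that does
  not occur in \<open>v\<close> only contributes the identity.\<close>

definition star_subgroup ::
    "nat word set \<Rightarrow> ('a, 'm) monoid_scheme \<Rightarrow> 'a set \<Rightarrow> 'a set" where
  "star_subgroup V F R =
     generate F {eval_word F (f(i := f i \<otimes>\<^bsub>F\<^esub> r)) v \<otimes>\<^bsub>F\<^esub> inv\<^bsub>F\<^esub> (eval_word F f v)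
                 | v f i r. v \<in> V \<and> f \<in> UNIV \<rightarrow> carrier F \<and> r \<in> R}"

text \<open>The Baer invariant of \<open>F Mod R\<close>, computed from the free presentation \<open>(F, R)\<close>, with
  respect to the variety defined by the laws \<open>V\<close>.\<close>

definition baer_invariant ::
    "nat word set \<Rightarrow> ('a, 'm) monoid_scheme \<Rightarrow> 'a set \<Rightarrow> 'a set monoid" where
  "baer_invariant V F R =
     (F\<lparr>carrier := R \<inter> verbal_subgroup V F\<rparr>) Mod (star_subgroup V F R)"

section \<open>Outer commutator words\<close>

definition comm_word :: "'x word \<Rightarrow> 'x word \<Rightarrow> 'x word" where
  "comm_word u v = inv_word u @ inv_word v @ u @ v"

fun left_normed :: "'x list \<Rightarrow> 'x word" where
  "left_normed [] = []"
| "left_normed (x # xs) = foldl (\<lambda>u y. comm_word u [(y, True)]) [(x, True)] xs"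

text \<open>The variables are $x_{j+1} = j$ for $j \le c_1$ and $y_{j+1} = c_1 + 1 + j$ for
  $j \le c_2$.\<close>

definition outer_comm_word :: "nat \<Rightarrow> nat \<Rightarrow> nat word" where
  "outer_comm_word c1 c2 =
     comm_word (left_normed [0..<c1 + 1]) (left_normed [c1 + 1..<c1 + c2 + 2])"

section \<open>The number of basic commutators\<close>

definition moebius :: "nat \<Rightarrow> int" where
  "moebius m = (if squarefree m then (- 1) ^ card (prime_factors m) else 0)"

text \<open>Witt's formula for the number of basic commutators of weight \<open>n\<close> on \<open>d\<close> generators.
  For \<open>n > 0\<close> the division is exact and the quotient is nonnegative.\<close>

definition basic_comm_count :: "nat \<Rightarrow> nat \<Rightarrow> nat" (\<open>\<chi>\<close>) where
  "\<chi> n d = nat ((\<Sum>m | m dvd n. moebius m * int d ^ (n div m)) div int n)"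

section \<open>Direct sums of copies\<close>

definition copies :: "('a, 'm) monoid_scheme \<Rightarrow> nat \<Rightarrow> (nat \<Rightarrow> 'a) monoid" where
  "copies X m = sum_group {..<m} (\<lambda>_. X)"

end

theory Submission
  imports Defs "HOL-Algebra.FiniteProduct" "HOL-Library.List_Lexorder"
begin

text \<open>
  Write \<open>a = c1 + 1\<close>, \<open>b = c2 + 1\<close>, so that \<open>b \<le> a < 2 * b\<close>. Since \<open>F / R\<close> is abelian, \<open>R\<close> contains
  the verbal subgroup $V = [\gamma_a(F), \gamma_b(F)]$, and modulo the star subgroup \<open>S\<close> the commutator is
  bilinear on $\gamma_a(F)/[R,_{c_1}F] \times \gamma_b(F)/[R,_{c_2}F]$. Both factors are spanned by
  bracketed Lyndon words in lifts of the generators of \<open>G\<close>, so \<open>V / S\<close> is generated by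
  commutators of pairs of such brackets, and the order of a pair divides the order of its largest letter.

  That these are the only relations is seen as follows. In degrees \<open>b\<close> to \<open>2 * b - 1\<close> the Magnus
  expansion is additive on $\gamma_b(F)$. Hence the product of its degree \<open>a\<close> part with its degree \<open>b\<close> part
  is a 2-cocycle on $\gamma_b(F)$, a subgroup of a free group, so it is a coboundary. A
  trivialising cochain is additive on \<open>V\<close> and maps \<open>[u, v]\<close> to the antisymmetrised product of the
  expansions of \<open>u\<close> and \<open>v\<close>; on pairs of brackets it is unitriangular with respect to leading words.
  Witt's formula counts Lyndon words because a primitive word has exactly one Lyndon rotation.
\<close>

section \<open>Lyndon words\<close>

text \<open>The presentation is arbitrary: \<open>F\<close> may have infinite rank, and its free
  generators need not be adapted to the cyclic summands of \<open>G\<close>. The power series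
  therefore have one variable per summand of \<open>G\<close>, and a free generator x goes to 1 plus
  the linear form whose coefficients are the coordinates of x in \<open>G\<close>, read as integers.
  This map need not be injective. Its coefficient at a word w matters only modulo the gcd of the
  orders of the letters of w, the order of the tensor product of the corresponding cyclic groups.
  Letters are numbered with the infinite cyclic summands first (order 0), followed by n_1, n_2 and
  so on. By the divisibility chain the gcd is then the order of the largest letter. Enlarging the
  alphabet from k+i-1 to k+i letters adds exactly the pairs of order n_i, whence the differences of
  the b_i. The target is never mapped to directly: both groups are quotients of one group of integer
  functions, and the two kernels coincide.\<close>

lemma less_append_same [simp]: "(x @ y < x @ z) = (y < (z :: 'a :: linorder list))"
  by (induction x) auto

lemma less_append_right: "y \<noteq> [] \<Longrightarrow> x < x @ (y :: 'a :: linorder list)"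
  by (induction x) (auto simp: neq_Nil_conv)

text \<open>Unless \<open>x\<close> is a prefix of \<open>y\<close>, the first difference lies
  inside both words, so the continuations do not matter.\<close>

lemma append_less_append:
  fixes x y :: "'a :: linorder list"
  assumes "x < y" "\<And>s. y \<noteq> x @ s"
  shows "x @ z < y @ z'"
  using assms
proof (induction x arbitrary: y)
  case (Cons a x)
  then show ?case by (cases y) auto
next
  case Nil
  then show ?case by (metis append_Nil)
qed

lemma append_less_append_eq_length:
  fixes x y :: "'a :: linorder list"
  assumes "x < y" "length y \<le> length x"
  shows "x @ z < y @ z'"
  by (rule append_less_append) (use assms in auto)

definition lyndon :: "'a :: linorder list \<Rightarrow> bool" where
  "lyndon w \<longleftrightarrow> w \<noteq> [] \<and> (\<forall>u v. u \<noteq> [] \<longrightarrow> v \<noteq> [] \<longrightarrow> w = u @ v \<longrightarrow> w < v)"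

lemma lyndonD: "lyndon (u @ v) \<Longrightarrow> u \<noteq> [] \<Longrightarrow> v \<noteq> [] \<Longrightarrow> u @ v < v"
  by (auto simp: lyndon_def)

lemma lyndon_singleton [simp]: "lyndon [a]"
  by (auto simp: lyndon_def Cons_eq_append_conv)

text \<open>If \<open>u\<close> is a prefix of \<open>v\<close>, strip it and use that the Lyndon
  word \<open>v\<close> lies below its own suffix; otherwise the first difference of
  \<open>u\<close> and \<open>v\<close> decides.\<close>

lemma lyndon_append_less:
  assumes "lyndon v" "u < v" "u \<noteq> []"
  shows "u @ v < v"
proof (cases "\<exists>s. v = u @ s")
  case True
  then obtain s where s: "v = u @ s" by auto
  with assms have "s \<noteq> []" by auto
  then have "v < s" using assms s lyndonD by blast
  then show ?thesis by (subst (2) s) simp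
next
  case False
  then show ?thesis using append_less_append[of u v v "[]"] assms by auto
qed

lemma lyndon_append:
  assumes u: "lyndon u" and v: "lyndon v" and "u < v"
  shows "lyndon (u @ v)"
  unfolding lyndon_def
proof (intro conjI allI impI)
  show "u @ v \<noteq> []" using u by (simp add: lyndon_def)
  fix p s assume ps: "p \<noteq> []" "s \<noteq> []" "u @ v = p @ s"
  have uv: "u @ v < v" using assms by (intro lyndon_append_less) (auto simp: lyndon_def)
  from ps(3) consider q where "u = p @ q" "s = q @ v" | q where "p = u @ q" "v = q @ s"
    by (auto simp: append_eq_append_conv2)
  then show "u @ v < s"
  proof cases
    case 1
    show ?thesis
    proof (cases "q = []")
      case True
      then show ?thesis using 1 uv by simp
    next
      case False
      then have "u < q" using 1 u ps lyndonD by blast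
      then show ?thesis using append_less_append_eq_length[of u q v v] 1 by auto
    qed
  next
    case 2
    show ?thesis
    proof (cases "q = []")
      case True
      then show ?thesis using 2 uv by simp
    next
      case False
      then have "v < s" using 2 v ps lyndonD by blast
      then show ?thesis using uv by simp
    qed
  qed
qed

section \<open>The least proper suffix and the standard factorization\<close>

definition min_suffix :: "'a :: linorder list \<Rightarrow> 'a list" where
  "min_suffix w = Min ((\<lambda>i. drop i w) ` {1..<length w})"

definition lyndon_prefix :: "'a :: linorder list \<Rightarrow> 'a list" where
  "lyndon_prefix w = take (length w - length (min_suffix w)) w"

lemma min_suffix:
  assumes "2 \<le> length w"
  shows "w = lyndon_prefix w @ min_suffix w" "min_suffix w \<noteq> []" "lyndon_prefix w \<noteq> []"
    "\<And>p s. w = p @ s \<Longrightarrow> p \<noteq> [] \<Longrightarrow> s \<noteq> [] \<Longrightarrow> min_suffix w \<le> s"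
proof -
  let ?A = "(\<lambda>i. drop i w) ` {1..<length w}"
  have A: "finite ?A" "?A \<noteq> {}" using assms by auto
  have "min_suffix w \<in> ?A" unfolding min_suffix_def using A by (rule Min_in)
  then obtain i where i: "min_suffix w = drop i w" "1 \<le> i" "i < length w" by auto
  have p: "lyndon_prefix w = take i w" using i by (simp add: lyndon_prefix_def)
  show "w = lyndon_prefix w @ min_suffix w" "min_suffix w \<noteq> []" "lyndon_prefix w \<noteq> []"
    using i p by auto
  fix p s assume *: "w = p @ s" "p \<noteq> []" "s \<noteq> []"
  then have "s \<in> ?A" by (intro image_eqI[of _ _ "length p"]) (auto simp: Suc_le_eq)
  then show "min_suffix w \<le> s" unfolding min_suffix_def using A by simp
qed

lemma min_suffix_unique:
  assumes "w = u @ v" "u \<noteq> []" "v \<noteq> []"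
    and "\<And>p s. w = p @ s \<Longrightarrow> p \<noteq> [] \<Longrightarrow> s \<noteq> [] \<Longrightarrow> v \<le> s"
  shows "min_suffix w = v" "lyndon_prefix w = u"
proof -
  have l: "2 \<le> length w" using assms(1-3) by (cases u; cases v) auto
  show *: "min_suffix w = v"
    using min_suffix(4)[OF l assms(1-3)] assms(4)[OF min_suffix(1)[OF l] min_suffix(3)[OF l] min_suffix(2)[OF l]]
    by simp
  show "lyndon_prefix w = u" unfolding lyndon_prefix_def * using assms(1) by simp
qed

text \<open>A suffix of the least suffix is again a proper suffix of \<open>w\<close>, hence not
  smaller. A longer Lyndon proper suffix would lie below its own end, so this one is the longest, as
  in the standard factorization.\<close>

lemma lyndon_min_suffix:
  assumes "2 \<le> length w"
  shows "lyndon (min_suffix w)"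
  unfolding lyndon_def
proof (intro conjI allI impI)
  note m = min_suffix[OF assms]
  show "min_suffix w \<noteq> []" by (rule m)
  fix u v assume "u \<noteq> []" "v \<noteq> []" and uv: "min_suffix w = u @ v"
  then have "min_suffix w \<le> v"
    using m(1) by (intro m(4)[of "lyndon_prefix w @ u"]) auto
  moreover have "min_suffix w \<noteq> v" using uv \<open>u \<noteq> []\<close> by simp
  ultimately show "min_suffix w < v" by simp
qed

text \<open>Let s be a proper suffix of the left factor u with s < u, and let v be the right factor.
  If u = s q, then \<open>w\<close> < s v gives q v < v, against the minimality of v. Otherwise the
  first difference gives s v < u v = \<open>w\<close>, so \<open>w\<close> is not Lyndon.\<close>

lemma lyndon_lyndon_prefix:
  assumes "2 \<le> length w" "lyndon w"
  shows "lyndon (lyndon_prefix w)"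
  unfolding lyndon_def
proof (intro conjI allI impI)
  note m = min_suffix[OF assms(1)]
  let ?u = "lyndon_prefix w" and ?v = "min_suffix w"
  show "lyndon_prefix w \<noteq> []" by (rule m)
  fix p s assume p: "p \<noteq> []" "s \<noteq> []" and ps: "?u = p @ s"
  show "?u < s"
  proof (rule ccontr)
    assume "\<not> ?u < s"
    moreover have "s \<noteq> ?u" using ps p by auto
    ultimately have su: "s < ?u" by simp
    have w: "w = p @ (s @ ?v)" using m(1) ps by simp
    then have ws: "w < s @ ?v" using lyndonD[of p "s @ ?v"] assms(2) p by auto
    show False
    proof (cases "\<exists>q. ?u = s @ q")
      case True
      then obtain q where q: "?u = s @ q" by auto
      then have "q \<noteq> []" using ps p by auto
      have sq: "w = s @ (q @ ?v)" using m(1) q by simp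
      with ws have "q @ ?v < ?v" by (metis less_append_same)
      moreover have "?v \<le> q @ ?v" using m(4)[OF sq] p m(2) by simp
      ultimately show False by simp
    next
      case False
      then have "s @ ?v < ?u @ ?v" using append_less_append[OF su] by auto
      then show False using ws m(1) by simp
    qed
  qed
qed

lemma lyndon_prefix_less_min_suffix:
  assumes "2 \<le> length w" "lyndon w"
  shows "lyndon_prefix w < min_suffix w" "w < min_suffix w"
proof -
  note m = min_suffix[OF assms(1)]
  show *: "w < min_suffix w" using lyndonD[of "lyndon_prefix w" "min_suffix w"] m assms by auto
  have "lyndon_prefix w < w" by (subst (2) m(1), rule less_append_right, rule m(2))
  with * show "lyndon_prefix w < min_suffix w" by simp
qed

text \<open>A proper suffix of \<open>u @ v\<close> is a suffix of \<open>v\<close>, or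
  \<open>v\<close> preceded by a suffix of \<open>u\<close>. The last hypothesis keeps suffixes of
  the second kind from being smaller than \<open>v\<close>. This decides when a commutator of two
  brackets is itself a Lyndon bracket.\<close>

lemma standard_factorization_append:
  assumes u: "lyndon u" and v: "lyndon v" and "u < v"
    and "2 \<le> length u \<Longrightarrow> v \<le> min_suffix u"
  shows "min_suffix (u @ v) = v" "lyndon_prefix (u @ v) = u"
proof -
  have "v \<le> s" if ps: "u @ v = p @ s" "p \<noteq> []" "s \<noteq> []" for p s
  proof -
    from ps(1) consider q where "u = p @ q" "s = q @ v" | q where "p = u @ q" "v = q @ s"
      by (auto simp: append_eq_append_conv2)
    then show ?thesis
    proof cases
      case 1
      show ?thesis
      proof (cases "q = []")
        case False
        then have l: "2 \<le> length u" using 1 ps by (cases p; cases q) auto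
        have "v \<le> q" using assms(4)[OF l] min_suffix(4)[OF l 1(1) ps(2) False] by simp
        also have "q \<le> q @ v" using less_append_right[of v q] v by (auto simp: lyndon_def less_imp_le)
        finally show ?thesis using 1 by simp
      qed (use 1 in simp)
    next
      case 2
      show ?thesis
      proof (cases "q = []")
        case False
        then show ?thesis using 2 v ps lyndonD[of q s] by auto
      qed (use 2 in simp)
    qed
  qed
  then show "min_suffix (u @ v) = v" "lyndon_prefix (u @ v) = u"
    using min_suffix_unique[of "u @ v" u v] u v by (auto simp: lyndon_def)
qed

section \<open>Lyndon words as strict minima among their rotations\<close>

lemma lyndon_less_rotation:
  assumes "lyndon (u @ v)" "u \<noteq> []" "v \<noteq> []"
  shows "u @ v < v @ u"
  using lyndonD[OF assms] less_append_right[OF assms(2), of v] by simp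

text \<open>For the harder direction let w = u v with v < w. If v is not a prefix of w, the first
  difference gives v u < w. If w = v q, then w < v u gives q < u, so the rotation q v lies below u v
  = w.\<close>

lemma lyndon_iff_less_rotations:
  "lyndon w \<longleftrightarrow> w \<noteq> [] \<and> (\<forall>u v. u \<noteq> [] \<longrightarrow> v \<noteq> [] \<longrightarrow> w = u @ v \<longrightarrow> w < v @ u)"
proof
  assume r: "w \<noteq> [] \<and> (\<forall>u v. u \<noteq> [] \<longrightarrow> v \<noteq> [] \<longrightarrow> w = u @ v \<longrightarrow> w < v @ u)"
  show "lyndon w"
    unfolding lyndon_def
  proof (intro conjI allI impI)
    fix u v assume uv: "u \<noteq> []" "v \<noteq> []" "w = u @ v"
    show "w < v"
    proof (rule ccontr)
      assume "\<not> w < v"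
      moreover have "v \<noteq> w" using uv by auto
      ultimately have vw: "v < w" by simp
      have wr: "w < v @ u" using r uv by blast
      show False
      proof (cases "\<exists>q. w = v @ q")
        case True
        then obtain q where q: "w = v @ q" by auto
        have l: "length q = length u" using q uv by (metis add.commute add_left_cancel length_append)
        have "q < u" using wr q by simp
        then have "q @ v < u @ v" using append_less_append_eq_length[of q u v v] l by simp
        moreover have "w < q @ v" using r q uv l by (metis length_0_conv)
        ultimately show False using uv by simp
      next
        case False
        then have "v @ u < w @ []" using append_less_append[OF vw, of u "[]"] by blast
        then show False using wr by simp
      qed
    qed
  qed (use r in simp)
next
  assume "lyndon w"
  then show "w \<noteq> [] \<and> (\<forall>u v. u \<noteq> [] \<longrightarrow> v \<noteq> [] \<longrightarrow> w = u @ v \<longrightarrow> w < v @ u)"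
    using lyndon_less_rotation unfolding lyndon_def by blast
qed

lemma lyndon_iff_less_rotate:
  "lyndon w \<longleftrightarrow> w \<noteq> [] \<and> (\<forall>r. 0 < r \<longrightarrow> r < length w \<longrightarrow> w < rotate r w)"
proof -
  have "(\<forall>u v. u \<noteq> [] \<longrightarrow> v \<noteq> [] \<longrightarrow> w = u @ v \<longrightarrow> w < v @ u) \<longleftrightarrow>
      (\<forall>r. 0 < r \<longrightarrow> r < length w \<longrightarrow> w < rotate r w)" (is "?L \<longleftrightarrow> ?R")
  proof
    assume l: ?L
    show ?R
    proof (intro allI impI)
      fix r assume "0 < r" "r < length w"
      then show "w < rotate r w"
        using l[rule_format, of "take r w" "drop r w"] by (cases "w = []") (auto simp: rotate_drop_take)
    qed
  next
    assume r: ?R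
    show ?L
    proof (intro allI impI)
      fix u v assume "u \<noteq> []" "v \<noteq> []" "w = u @ v"
      then show "w < v @ u"
        using r[rule_format, of "length u"] by (simp add: rotate_append)
    qed
  qed
  then show ?thesis by (simp only: lyndon_iff_less_rotations)
qed

section \<open>Counting Lyndon words\<close>

definition words :: "nat \<Rightarrow> nat \<Rightarrow> nat list set" where
  "words n j = {w. set w \<subseteq> {..<j} \<and> length w = n}"

definition lyndon_words :: "nat \<Rightarrow> nat \<Rightarrow> nat list set" where
  "lyndon_words n j = {w \<in> words n j. lyndon w}"

definition primitive :: "'a list \<Rightarrow> bool" where
  "primitive w \<longleftrightarrow> w \<noteq> [] \<and> (\<forall>r. 0 < r \<longrightarrow> r < length w \<longrightarrow> rotate r w \<noteq> w)"

definition primitive_words :: "nat \<Rightarrow> nat \<Rightarrow> nat list set" where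
  "primitive_words n j = {w \<in> words n j. primitive w}"

lemma finite_words [simp]: "finite (words n j)"
  unfolding words_def by (rule finite_lists_length_eq) simp

lemma finite_lyndon_words [simp]: "finite (lyndon_words n j)"
  by (simp add: lyndon_words_def)

lemma finite_primitive_words [simp]: "finite (primitive_words n j)"
  by (simp add: primitive_words_def)

lemma card_words: "card (words n j) = j ^ n"
  unfolding words_def by (simp add: card_lists_length_eq)

lemma rotate_eq_iff: "rotate r u = rotate r v \<longleftrightarrow> u = v"
proof (induction r)
  case (Suc r)
  have "rotate1 x = rotate1 y \<Longrightarrow> x = y" for x y :: "'a list"
    by (cases x; cases y) (auto simp: append_eq_append_conv2)
  then show ?case using Suc by (metis rotate_Suc)
qed simp

lemma rotate_fixed_mult:
  assumes "rotate p w = w" shows "rotate (q * p) w = w"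
  by (induction q) (simp_all add: assms flip: rotate_rotate)

lemma primitiveD: "primitive w \<Longrightarrow> rotate r w = w \<Longrightarrow> length w dvd r"
proof (rule ccontr)
  assume *: "primitive w" "rotate r w = w" "\<not> length w dvd r"
  then have "rotate (r mod length w) w = w" using rotate_conv_mod[of r w] by simp
  moreover have "0 < r mod length w" "r mod length w < length w"
    using * by (auto simp: primitive_def mod_greater_zero_iff_not_dvd)
  ultimately show False using * by (auto simp: primitive_def)
qed

lemma primitive_rotate: "primitive w \<Longrightarrow> primitive (rotate r w)"
  unfolding primitive_def
  by (metis add.commute length_rotate rotate_eq_iff rotate_is_Nil_conv rotate_rotate)

lemma lyndon_imp_primitive: "lyndon w \<Longrightarrow> primitive w"
  unfolding primitive_def lyndon_iff_less_rotate by (metis less_irrefl)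

lemma rotate_in_words: "w \<in> words n j \<Longrightarrow> rotate r w \<in> words n j"
  by (simp add: words_def)

lemma rotate_inverse: "r \<le> length w \<Longrightarrow> rotate (length w - r) (rotate r w) = w"
  by (simp add: rotate_rotate rotate_id)

text \<open>Words with a common rotation are rotations of each other, and a Lyndon word lies below
  all its other rotations; two different words would each be smaller than the other.\<close>

lemma lyndon_rotate_eq:
  assumes "lyndon u" "lyndon v" "length u = length v" "rotate r u = rotate s v"
  shows "u = v"
proof (rule ccontr)
  assume "u \<noteq> v"
  have *: "x < y" if "lyndon x" "y = rotate t x" "x \<noteq> y" for x y :: "'a list" and t
  proof -
    have "y = rotate (t mod length x) x" using that rotate_conv_mod by blast
    moreover from this have "t mod length x \<noteq> 0" using that by (intro notI) simp
    moreover have "t mod length x < length x" using that by (simp add: lyndon_def)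
    ultimately show ?thesis using that(1) unfolding lyndon_iff_less_rotate by auto
  qed
  have rot: "\<exists>t. y = rotate t x" if e: "rotate r x = rotate s y" "length x = length y" "x \<noteq> []"
    for x y :: "'a list" and r s
  proof -
    have "rotate (length y - s mod length y) (rotate (s mod length y) y) = y"
      using that(2,3) by (intro rotate_inverse mod_le_divisor) (metis length_greater_0_conv)
    then have "y = rotate (length y - s mod length y + r) x"
      using rotate_conv_mod[of s y] e by (simp flip: rotate_rotate)
    then show ?thesis by blast
  qed
  have ne: "u \<noteq> []" "v \<noteq> []" using assms by (auto simp: lyndon_def)
  from rot[OF assms(4,3) ne(1)] obtain t where "v = rotate t u" ..
  then have "u < v" using *[OF assms(1)] \<open>u \<noteq> v\<close> by blast
  moreover from rot[OF assms(4)[symmetric] assms(3)[symmetric] ne(2)] obtain t' where "u = rotate t' v" ..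
  then have "v < u" using *[OF assms(2)] \<open>u \<noteq> v\<close> by metis
  ultimately show False by simp
qed

lemma card_primitive_words:
  assumes "0 < n"
  shows "card (primitive_words n j) = n * card (lyndon_words n j)"
proof -
  let ?f = "\<lambda>(r, l). rotate r l"
  have "bij_betw ?f ({..<n} \<times> lyndon_words n j) (primitive_words n j)"
  proof (rule bij_betw_imageI)
    show "inj_on ?f ({..<n} \<times> lyndon_words n j)"
    proof (rule inj_onI)
      fix p q assume pq: "p \<in> {..<n} \<times> lyndon_words n j" "q \<in> {..<n} \<times> lyndon_words n j" "?f p = ?f q"
      obtain r u s v where [simp]: "p = (r, u)" "q = (s, v)" by (cases p, cases q)
      have *: "r \<in> {..<n}" "s \<in> {..<n}" "u \<in> lyndon_words n j"
        "v \<in> lyndon_words n j" "rotate r u = rotate s v"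
        using pq by auto
      then have uv: "u = v" using lyndon_rotate_eq[of u v r s]
        by (auto simp: lyndon_words_def words_def)
      have "x = y" if "x \<le> y" "y < n" "rotate x u = rotate y u" for x y
      \<comment> \<open>Two equal rotations make \<open>u\<close> invariant under rotation by
        \<open>y - x\<close>, which primitivity forces to be a multiple of \<open>n\<close>.\<close>
      proof -
        have "rotate x (rotate (y - x) u) = rotate x u" using that by (simp add: rotate_rotate)
        then have "length u dvd y - x"
          using rotate_eq_iff primitiveD lyndon_imp_primitive * by (metis (no_types, lifting) lyndon_words_def mem_Collect_eq)
        moreover have "length u = n" using * by (simp add: lyndon_words_def words_def)
        ultimately show ?thesis using that by (metis diff_is_0_eq dvd_imp_le le_antisym less_imp_diff_less not_gr0 not_le)
      qed
      then have "r = s" using * uv by (metis lessThan_iff nle_le)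
      then show "p = q" using uv by simp
    qed
    show "?f ` ({..<n} \<times> lyndon_words n j) = primitive_words n j"
    proof (intro subset_antisym subsetI)
      fix w assume "w \<in> ?f ` ({..<n} \<times> lyndon_words n j)"
      then show "w \<in> primitive_words n j"
        by (auto simp: primitive_words_def lyndon_words_def rotate_in_words
            dest!: lyndon_imp_primitive intro!: primitive_rotate)
    next
      fix z assume z: "z \<in> primitive_words n j"
      then have lz: "length z = n" "z \<in> words n j" "primitive z"
        by (auto simp: primitive_words_def words_def)
      let ?A = "(\<lambda>t. rotate t z) ` {..<n}"
      have "Min ?A \<in> ?A" using assms by (intro Min_in) auto
      then obtain t where t: "t < n" "rotate t z = Min ?A" by (metis imageE lessThan_iff)
      have min: "rotate t z \<le> rotate s z" for s
      proof -
        have "rotate (s mod n) z \<in> ?A" using assms by auto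
        then have "Min ?A \<le> rotate (s mod n) z" by (intro Min_le) auto
        then show ?thesis using t rotate_conv_mod[of s z] lz by simp
      qed
      \<comment> \<open>The least rotation is strictly least, because every rotation of a primitive
        word is primitive and so differs from its own nontrivial rotations.\<close>
      have "lyndon (rotate t z)"
        unfolding lyndon_iff_less_rotate
      proof (intro conjI allI impI)
        show "rotate t z \<noteq> []" using lz by (auto simp: primitive_def)
        fix r assume "0 < r" "r < length (rotate t z)"
        then have "rotate r (rotate t z) \<noteq> rotate t z"
          using primitive_rotate[OF lz(3), of t] by (auto simp: primitive_def)
        moreover have "rotate t z \<le> rotate r (rotate t z)" using min[of "r + t"] by (simp add: rotate_rotate)
        ultimately show "rotate t z < rotate r (rotate t z)" by simp
      qed
      then have "rotate t z \<in> lyndon_words n j" using lz rotate_in_words by (simp add: lyndon_words_def)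
      moreover have "z = rotate ((n - t) mod n) (rotate t z)"
        using rotate_inverse[of t z] rotate_conv_mod[of "n - t" "rotate t z"] t(1) lz(1)
        by (metis length_rotate less_imp_le)
      ultimately show "z \<in> ?f ` ({..<n} \<times> lyndon_words n j)"
        using assms by (intro image_eqI[of _ _ "((n - t) mod n, rotate t z)"]) auto
    qed
  qed
  then show ?thesis using bij_betw_same_card by fastforce
qed

section \<open>Powers of words and rotation periods\<close>

definition list_power :: "nat \<Rightarrow> 'a list \<Rightarrow> 'a list" where
  "list_power k z = concat (replicate k z)"

lemma length_list_power [simp]: "length (list_power k z) = k * length z"
  by (induction k) (auto simp: list_power_def)

lemma list_power_Suc: "list_power (Suc k) z = z @ list_power k z"
  by (simp add: list_power_def)

lemma list_power_comm: "list_power k z @ z = z @ list_power k z"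
  by (induction k) (auto simp: list_power_def)

lemma set_list_power: "0 < k \<Longrightarrow> set (list_power k z) = set z"
  by (cases k) (auto simp: list_power_def)

text \<open>The commutation makes \<open>z\<close> a prefix of \<open>x\<close>; removing it leaves
  a shorter word that still commutes with \<open>z\<close>.\<close>

lemma commuting_list_power:
  "x @ z = z @ x \<Longrightarrow> length x = k * length z \<Longrightarrow> x = list_power k z"
proof (induction k arbitrary: x)
  case (Suc k)
  then have "length z \<le> length x" by simp
  then obtain y where y: "x = z @ y" using Suc.prems(1)
    by (metis append_eq_append_conv_if append_take_drop_id)
  then have "y @ z = z @ y" "length y = k * length z" using Suc.prems by auto
  then show ?case using Suc.IH y by (simp add: list_power_Suc)
qed (simp add: list_power_def)

definition rotation_period :: "'a list \<Rightarrow> nat" where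
  "rotation_period w = (LEAST p. 0 < p \<and> rotate p w = w)"

lemma rotation_period:
  assumes "w \<noteq> []"
  shows "0 < rotation_period w" "rotate (rotation_period w) w = w"
    "rotate p w = w \<Longrightarrow> rotation_period w dvd p"
proof -
  have ex: "0 < length w \<and> rotate (length w) w = w" using assms by simp
  show r: "0 < rotation_period w" "rotate (rotation_period w) w = w"
    unfolding rotation_period_def using LeastI[of "\<lambda>p. 0 < p \<and> rotate p w = w", OF ex] by auto
  assume p: "rotate p w = w"
  let ?r = "rotation_period w"
  have "rotate (p mod ?r + (p div ?r) * ?r) w = w" unfolding mod_div_mult_eq by (rule p)
  then have "rotate (p mod ?r) w = w"
    using rotate_fixed_mult[OF r(2)] by (metis rotate_rotate)
  moreover have "p mod ?r < ?r" using r by simp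
  ultimately have "p mod ?r = 0"
    using not_less_Least[of "p mod ?r" "\<lambda>p. 0 < p \<and> rotate p w = w"]
    by (metis gr0I rotation_period_def)
  then show "?r dvd p" by auto
qed

lemma rotation_period_list_power:
  assumes "primitive z" "0 < k"
  shows "rotation_period (list_power k z) = length z"
proof -
  let ?w = "list_power k z" 
  obtain k' where k: "k = Suc k'" using assms by (cases k) auto
  have z: "z \<noteq> []" using assms by (simp add: primitive_def)
  then have w: "?w \<noteq> []" by (simp add: k list_power_Suc)
  have "rotate (length z) ?w = ?w"
    by (simp add: k list_power_Suc rotate_append list_power_comm)
  then have d: "rotation_period ?w dvd length z" by (rule rotation_period(3)[OF w])
  let ?p = "rotation_period ?w"
  have "?p = length z"
  proof (rule ccontr)
    assume "?p \<noteq> length z"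
    then have p: "0 < ?p" "?p < length z"
      using d z rotation_period(1)[OF w] by (auto simp: dvd_imp_le le_neq_implies_less)
    \<comment> \<open>Comparing the first \<open>length z\<close> letters shows that rotation by the
      shorter period would already fix \<open>z\<close>.\<close>
    have "rotate ?p ?w = drop ?p z @ list_power k' z @ take ?p z"
      using p by (simp add: rotate_drop_take k list_power_Suc)
    then have "take (length z) (drop ?p z @ list_power k' z @ take ?p z) = z"
      using rotation_period(2)[OF w] by (simp add: k list_power_Suc)
    moreover have "take ?p (list_power k' z @ take ?p z) = take ?p z"
      using p by (cases k') (auto simp: list_power_def)
    ultimately have "rotate ?p z = z" using p by (simp add: rotate_drop_take)
    then show False using assms p by (simp add: primitive_def)
  qed
  then show ?thesis .
qed

text \<open>Sort the words of length \<open>n\<close> by rotation period \<open>m\<close>. Those of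
  period \<open>m\<close> are exactly the powers with exponent \<open>n div m\<close> of the
  primitive words of length \<open>m\<close>.\<close>

lemma sum_card_primitive_words:
  assumes "0 < n"
  shows "(\<Sum>m | m dvd n. card (primitive_words m j)) = j ^ n"
proof -
  let ?B = "\<lambda>m. {w \<in> words n j. rotation_period w = m}"
  have ne: "w \<noteq> []" if "w \<in> words n j" for w using that assms by (auto simp: words_def)
  have "bij_betw (list_power (n div m)) (primitive_words m j) (?B m)" if m: "m dvd n" for m
  proof (rule bij_betw_imageI)
    have m0: "0 < m" "0 < n div m" using assms m by (auto simp: dvd_div_eq_0_iff intro: Nat.gr0I)
    show "inj_on (list_power (n div m)) (primitive_words m j)"
    proof (rule inj_onI)
      fix x y assume "x \<in> primitive_words m j" "y \<in> primitive_words m j"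
        "list_power (n div m) x = list_power (n div m) y"
      then show "x = y" using m0 by (cases "n div m") (auto simp: list_power_Suc primitive_words_def words_def)
    qed
    show "list_power (n div m) ` primitive_words m j = ?B m"
    proof (intro subset_antisym subsetI)
      fix w assume "w \<in> list_power (n div m) ` primitive_words m j"
      then show "w \<in> ?B m" using m m0
        by (auto simp: primitive_words_def words_def set_list_power rotation_period_list_power)
    next
      fix w assume w: "w \<in> ?B m"
      then have lw: "length w = n" "w \<noteq> []" using ne by (auto simp: words_def)
      have rw: "rotate m w = w" using rotation_period(2)[OF lw(2)] w by simp
      let ?z = "take m w"
      have mn: "m \<le> n" using m assms by (simp add: dvd_imp_le)
      have lz: "length ?z = m" using lw mn by simp
      have "drop m w @ ?z = ?z @ drop m w"
      proof (cases "m = n")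
        case False
        then have "m mod length w = m" using mn lw by simp
        then show ?thesis using rw by (simp add: rotate_drop_take)
      qed (use lw in simp)
      moreover have "length (drop m w) = (n div m - 1) * length ?z"
        using m lw lz by (auto simp: diff_mult_distrib)
      ultimately have "drop m w = list_power (n div m - 1) ?z" by (rule commuting_list_power)
      then have wz: "w = list_power (n div m) ?z"
        using m0 list_power_Suc[of "n div m - 1" ?z] by (metis Suc_diff_1 append_take_drop_id)
      have "primitive ?z"
        unfolding primitive_def
      proof (intro conjI allI impI notI)
        show False if "?z = []" using that lz m0 by simp
        fix r assume r: "0 < r" "r < length ?z" "rotate r ?z = ?z"
        define p s where ps: "p = take r ?z" "s = drop r ?z"
        have z: "?z = p @ s" unfolding ps by (rule append_take_drop_id[symmetric])
        moreover have "rotate r ?z = s @ p" using r(2) by (simp add: ps rotate_drop_take)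
        ultimately have c: "s @ p = p @ s" "?z = p @ s" using r(3) by auto
        have cc: "list_power i (p @ s) @ p = p @ list_power i (p @ s)" for i
        proof (induction i)
          case 0
          show ?case by (simp add: list_power_def)
        next
          case (Suc i)
          have "list_power (Suc i) (p @ s) @ p = (p @ s) @ (p @ list_power i (p @ s))"
            by (simp add: list_power_Suc Suc)
          also have "\<dots> = p @ ((s @ p) @ list_power i (p @ s))" by simp
          also have "\<dots> = p @ list_power (Suc i) (p @ s)"
            by (simp only: c(1) list_power_Suc append.assoc)
          finally show ?case .
        qed
        \<comment> \<open>A rotation fixing the root fixes the whole power, so the period
          \<open>m\<close> of \<open>w\<close> would divide \<open>r < m\<close>.\<close>
        have "rotate r w = w"
        proof -
          obtain i where i: "n div m = Suc i" using m0 by (cases "n div m") auto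
          have lp: "length p = r" using r by (simp add: ps)
          have wi: "w = p @ (s @ list_power i (p @ s))" using wz i c(2) by (metis append.assoc list_power_Suc)
          have "rotate r w = (s @ list_power i (p @ s)) @ p"
            by (subst wi, subst lp[symmetric], rule rotate_append)
          also have "\<dots> = w" using cc[of i] c(1) wi by (metis append.assoc)
          finally show ?thesis .
        qed
        then have "m dvd r" using rotation_period(3)[OF lw(2)] w by simp
        then show False using r lz by (simp add: nat_dvd_not_less)
      qed
      then have "?z \<in> primitive_words m j"
        using w lz set_take_subset[of m w] by (auto simp: primitive_words_def words_def)
      then show "w \<in> list_power (n div m) ` primitive_words m j" using wz by blast
    qed
  qed
  then have "card (primitive_words m j) = card (?B m)" if "m dvd n" for m
    using that bij_betw_same_card by blast
  then have "(\<Sum>m | m dvd n. card (primitive_words m j)) = (\<Sum>m | m dvd n. card (?B m))"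
    by (intro sum.cong) auto
  also have "\<dots> = card (\<Union>m\<in>{m. m dvd n}. ?B m)"
    using assms by (intro card_UN_disjoint[symmetric]) (auto simp: finite_divisors_nat)
  also have "(\<Union>m\<in>{m. m dvd n}. ?B m) = words n j"
    using rotation_period(3)[OF ne, of _ n] by (auto simp: words_def rotate_id)
  finally show ?thesis by (simp add: card_words)
qed

text \<open>For a prime p dividing \<open>n\<close>, multiplication by p matches the squarefree
  divisors prime to p with the remaining squarefree ones and reverses the sign of
  \<open>moebius\<close>.\<close>

lemma sum_moebius_divisors:
  assumes "1 < n"
  shows "(\<Sum>m | m dvd n. moebius m) = 0"
proof -
  obtain p :: nat where p: "prime p" "p dvd n" using assms prime_factor_nat[of n] by auto
  let ?D = "{m. m dvd n \<and> squarefree m}"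
  let ?A = "{m \<in> ?D. \<not> p dvd m}" and ?B = "{m \<in> ?D. p dvd m}"
  have fin: "finite {m. m dvd n}" using assms by (simp add: finite_divisors_nat)
  have fD: "finite ?A" "finite ?B" by (auto intro: finite_subset[OF _ fin])
  have "bij_betw (\<lambda>m. p * m) ?A ?B"
  proof (rule bij_betw_imageI)
    show "inj_on (\<lambda>m. p * m) ?A" using p by (auto simp: inj_on_def prime_gt_0_nat)
    show "(\<lambda>m. p * m) ` ?A = ?B"
    proof (intro subset_antisym subsetI)
      fix x assume "x \<in> (\<lambda>m. p * m) ` ?A"
      then obtain m where m: "x = p * m" "m dvd n" "squarefree m" "\<not> p dvd m" by auto
      have cop: "coprime p m" using p m prime_imp_coprime by blast
      then have "squarefree x" using m p by (simp add: squarefree_mult_coprime squarefree_prime)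
      moreover have "x dvd n" using m p cop by (simp add: divides_mult)
      ultimately show "x \<in> ?B" using m by auto
    next
      fix x assume x: "x \<in> ?B"
      then obtain m where m: "x = p * m" by auto
      have "\<not> p dvd m"
      proof
        assume "p dvd m"
        then have "p\<^sup>2 dvd x" by (auto simp: m power2_eq_square)
        then show False using x p by (auto simp: squarefree_def)
      qed
      moreover have "squarefree m" "m dvd n" using x m squarefree_mono[of m x] by (auto dest: dvd_mult_right)
      ultimately show "x \<in> (\<lambda>m. p * m) ` ?A" using m by auto
    qed
  qed
  then have "(\<Sum>m\<in>?B. moebius m) = (\<Sum>m\<in>?A. moebius (p * m))"
    by (rule sum.reindex_bij_betw[symmetric])
  also have "\<dots> = (\<Sum>m\<in>?A. - moebius m)"
  proof (rule sum.cong[OF refl])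
    fix m assume m: "m \<in> ?A"
    then have m0: "m \<noteq> 0" using assms by (intro notI) auto
    have cop: "coprime p m" using p m prime_imp_coprime by blast
    then have sq: "squarefree (p * m)" using m p by (simp add: squarefree_mult_coprime squarefree_prime)
    have "prime_factors (p * m) = insert p (prime_factors m)"
      using p m0 by (simp add: prime_factors_product prime_prime_factors prime_gt_0_nat)
    moreover have "p \<notin> prime_factors m" using m by auto
    ultimately show "moebius (p * m) = - moebius m" using sq m by (simp add: moebius_def)
  qed
  finally have AB: "(\<Sum>m\<in>?B. moebius m) = - (\<Sum>m\<in>?A. moebius m)" by (simp add: sum_negf)
  have "(\<Sum>m | m dvd n. moebius m) = (\<Sum>m\<in>?D. moebius m)"
    using fin by (intro sum.mono_neutral_right) (auto simp: moebius_def)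
  also have "?D = ?A \<union> ?B" by auto
  also have "(\<Sum>m\<in>?A \<union> ?B. moebius m) = (\<Sum>m\<in>?A. moebius m) + (\<Sum>m\<in>?B. moebius m)"
    using fD by (intro sum.union_disjoint) auto
  finally show ?thesis using AB by simp
qed

lemma moebius_inversion:
  fixes f g :: "nat \<Rightarrow> int"
  assumes "\<And>n. 0 < n \<Longrightarrow> g n = (\<Sum>m | m dvd n. f m)" "0 < n"
  shows "(\<Sum>m | m dvd n. moebius m * g (n div m)) = f n"
proof -
  let ?D = "{m. m dvd n}"
  have fin: "finite ?D" using assms by (simp add: finite_divisors_nat)
  have D: "{k. k dvd n div m} = {k \<in> ?D. m * k dvd n}" if "m dvd n" for m
    using that assms(2) by (auto simp: dvd_div_iff_mult mult.commute)
  have "(\<Sum>m\<in>?D. moebius m * g (n div m)) = (\<Sum>m\<in>?D. \<Sum>k\<in>{k \<in> ?D. m * k dvd n}. moebius m * f k)"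
  proof (rule sum.cong[OF refl])
    fix m assume m: "m \<in> ?D"
    then have "0 < n div m" using assms(2) by (auto simp: dvd_div_eq_0_iff intro: Nat.gr0I)
    then show "moebius m * g (n div m) = (\<Sum>k\<in>{k \<in> ?D. m * k dvd n}. moebius m * f k)"
      using m assms(1)[of "n div m"] D[of m] by (simp add: sum_distrib_left)
  qed
  also have "\<dots> = (\<Sum>k\<in>?D. \<Sum>m\<in>{m \<in> ?D. m * k dvd n}. moebius m * f k)"
    by (rule sum.swap_restrict[OF fin fin])
  also have "\<dots> = (\<Sum>k\<in>?D. if k = n then f n else 0)"
  proof (rule sum.cong[OF refl])
    fix k assume k: "k \<in> ?D"
    have "{m \<in> ?D. m * k dvd n} = {m. m dvd n div k}"
      using D[of k] k by (auto simp: mult.commute)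
    then have e: "(\<Sum>m\<in>{m \<in> ?D. m * k dvd n}. moebius m * f k) = (\<Sum>m | m dvd n div k. moebius m) * f k"
      by (simp add: sum_distrib_right)
    show "(\<Sum>m\<in>{m \<in> ?D. m * k dvd n}. moebius m * f k) = (if k = n then f n else 0)"
    proof (cases "k = n")
      case True
      then show ?thesis using e assms(2) by (simp add: moebius_def)
    next
      case False
      then have "1 < n div k" using k assms(2)
        by (metis dvd_div_eq_0_iff dvd_mult_div_cancel less_one linorder_neqE_nat mem_Collect_eq mult.right_neutral not_less_zero)
      then show ?thesis using e sum_moebius_divisors False by simp
    qed
  qed
  also have "\<dots> = f n" using fin by simp
  finally show ?thesis .
qed

theorem card_lyndon_words:
  assumes "0 < n"
  shows "card (lyndon_words n j) = \<chi> n j"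
proof -
  have "(\<Sum>m | m dvd n. moebius m * int (j ^ (n div m))) = int (card (primitive_words n j))"
    by (rule moebius_inversion) (simp_all add: assms flip: sum_card_primitive_words)
  then have "(\<Sum>m | m dvd n. moebius m * int j ^ (n div m)) = int n * int (card (lyndon_words n j))"
    using card_primitive_words[OF assms] by simp
  then show ?thesis using assms by (simp add: basic_comm_count_def)
qed

section \<open>Commutators and central filtrations\<close>

context group
begin

definition comm :: "'a \<Rightarrow> 'a \<Rightarrow> 'a" where
  "comm x y = inv x \<otimes> inv y \<otimes> x \<otimes> y"

lemma inv_mult_cancel: "x \<in> carrier G \<Longrightarrow> y \<in> carrier G \<Longrightarrow> inv x \<otimes> (x \<otimes> y) = y"
  by (simp flip: m_assoc)

lemma mult_inv_cancel: "x \<in> carrier G \<Longrightarrow> y \<in> carrier G \<Longrightarrow> x \<otimes> (inv x \<otimes> y) = y"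
  by (simp flip: m_assoc)

text \<open>These rules associate to the right, push inverses to the letters and cancel neighbours,
  so identities that hold in free groups are proved by simplification.\<close>

lemmas word_simps = m_assoc inv_mult_group inv_mult_cancel mult_inv_cancel

lemma comm_closed [simp]: "x \<in> carrier G \<Longrightarrow> y \<in> carrier G \<Longrightarrow> comm x y \<in> carrier G"
  by (simp add: comm_def)

lemma comm_one [simp]: "x \<in> carrier G \<Longrightarrow> comm \<one> x = \<one>" "x \<in> carrier G \<Longrightarrow> comm x \<one> = \<one>"
  by (simp_all add: comm_def)

lemma comm_self [simp]: "x \<in> carrier G \<Longrightarrow> comm x x = \<one>"
  by (simp add: comm_def word_simps)

lemma inv_comm: "x \<in> carrier G \<Longrightarrow> y \<in> carrier G \<Longrightarrow> inv (comm x y) = comm y x"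
  by (simp add: comm_def word_simps)

lemma mult_eq_comm:
  "x \<in> carrier G \<Longrightarrow> y \<in> carrier G \<Longrightarrow> x \<otimes> y = y \<otimes> x \<otimes> comm x y"
  by (simp add: comm_def word_simps)

lemma comm_mult_left:
  "x \<in> carrier G \<Longrightarrow> y \<in> carrier G \<Longrightarrow> z \<in> carrier G \<Longrightarrow>
    comm (x \<otimes> y) z = inv y \<otimes> comm x z \<otimes> y \<otimes> comm y z"
  by (simp add: comm_def word_simps)

lemma comm_inv_left:
  "x \<in> carrier G \<Longrightarrow> z \<in> carrier G \<Longrightarrow> comm (inv x) z = x \<otimes> inv (comm x z) \<otimes> inv x"
  by (simp add: comm_def word_simps)

lemma conj_eq_comm:
  "x \<in> carrier G \<Longrightarrow> g \<in> carrier G \<Longrightarrow> g \<otimes> x \<otimes> inv g = x \<otimes> comm x (inv g)"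
  by (simp add: comm_def word_simps)

lemma conj_comm:
  "x \<in> carrier G \<Longrightarrow> y \<in> carrier G \<Longrightarrow> g \<in> carrier G \<Longrightarrow>
    g \<otimes> comm x y \<otimes> inv g = comm (g \<otimes> x \<otimes> inv g) (g \<otimes> y \<otimes> inv g)"
  by (simp add: comm_def word_simps)

lemma Hall_Witt:
  assumes "x \<in> carrier G" "y \<in> carrier G" "z \<in> carrier G"
  shows "(inv y \<otimes> comm (comm x (inv y)) z \<otimes> y) \<otimes> (inv z \<otimes> comm (comm y (inv z)) x \<otimes> z)
    \<otimes> (inv x \<otimes> comm (comm z (inv x)) y \<otimes> x) = \<one>"
  using assms by (simp add: comm_def word_simps)

lemma mult3_eq_one:
  assumes "a \<in> carrier G" "b \<in> carrier G" "c \<in> carrier G" "c \<otimes> a \<otimes> b = \<one>"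
  shows "c = inv b \<otimes> inv a"
  using assms inv_equality[of c "a \<otimes> b"] by (simp add: m_assoc inv_mult_group)

text \<open>By [xy,z] = [x,z]^y [y,z] and normality of \<open>N\<close>. It lets inclusions of
  commutators be checked on generators.\<close>

lemma subgroup_comm_left:
  assumes "N \<lhd> G" "subgroup H G" "z \<in> carrier G"
  shows "subgroup {x \<in> H. comm x z \<in> N} G" (is "subgroup ?S G")
proof -
  interpret N: normal N G by fact
  interpret H: subgroup H G by fact
  show ?thesis
  proof (rule subgroupI)
    show "?S \<noteq> {}" using assms(3) by (auto intro!: exI[of _ \<one>])
    fix x assume x: "x \<in> ?S"
    then have "comm (inv x) z \<in> N" using assms(3) by (simp add: comm_inv_left N.inv_op_closed2)
    then show "inv x \<in> ?S" using x by simp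
    fix y assume y: "y \<in> ?S"
    then have "comm (x \<otimes> y) z \<in> N" using x assms(3) by (simp add: comm_mult_left N.inv_op_closed1)
    then show "x \<otimes> y \<in> ?S" using x y by simp
  qed auto
qed

lemma comm_swap_mem:
  "subgroup N G \<Longrightarrow> x \<in> carrier G \<Longrightarrow> y \<in> carrier G \<Longrightarrow> comm x y \<in> N \<Longrightarrow> comm y x \<in> N"
  using inv_comm subgroup.m_inv_closed by metis

lemma comm_generate_left:
  assumes "N \<lhd> G" "A \<subseteq> carrier G" "z \<in> carrier G" "\<And>a. a \<in> A \<Longrightarrow> comm a z \<in> N" "x \<in> generate G A"
  shows "comm x z \<in> N"
proof -
  have "generate G A \<subseteq> {x \<in> carrier G. comm x z \<in> N}"
    by (rule generate_subgroup_incl) (use assms subgroup_comm_left subgroup_self in auto)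
  then show ?thesis using assms(5) by auto
qed

lemma comm_generate:
  assumes "N \<lhd> G" "A \<subseteq> carrier G" "B \<subseteq> carrier G" "\<And>a b. a \<in> A \<Longrightarrow> b \<in> B \<Longrightarrow> comm a b \<in> N"
    and x: "x \<in> generate G A" and y: "y \<in> generate G B"
  shows "comm x y \<in> N"
proof -
  have N: "subgroup N G" by (rule normal_imp_subgroup[OF assms(1)])
  have xc: "x \<in> carrier G" and yc: "y \<in> carrier G"
    using generate_in_carrier assms by auto
  have "comm b x \<in> N" if "b \<in> B" for b
    using that assms comm_generate_left[OF assms(1,2) _ _ x, of b] comm_swap_mem[OF N xc] by auto
  then have "comm y x \<in> N" using comm_generate_left[OF assms(1,3) xc _ y] by blast
  then show ?thesis by (rule comm_swap_mem[OF N yc xc])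
qed

lemma normal_carrier: "N \<lhd> G \<Longrightarrow> x \<in> N \<Longrightarrow> x \<in> carrier G"
  by (rule subsetD[OF subgroup.subset[OF normal_imp_subgroup]])

lemma normal_comm_left:
  assumes "N \<lhd> G" "x \<in> N" "y \<in> carrier G"
  shows "comm x y \<in> N" "comm y x \<in> N"
proof -
  interpret N: normal N G by fact
  have "comm x y = inv x \<otimes> (inv y \<otimes> x \<otimes> y)" using assms by (simp add: comm_def word_simps)
  then show *: "comm x y \<in> N" using assms by (simp add: N.inv_op_closed1)
  show "comm y x \<in> N" using comm_swap_mem[OF N.subgroup_axioms _ _ *] assms by simp
qed

definition comm_subgroup :: "'a set \<Rightarrow> 'a set \<Rightarrow> 'a set" where
  "comm_subgroup H K = generate G {comm x y | x y. x \<in> H \<and> y \<in> K}"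

lemma comm_subgroup_mem: "x \<in> H \<Longrightarrow> y \<in> K \<Longrightarrow> comm x y \<in> comm_subgroup H K"
  unfolding comm_subgroup_def by (rule generate.incl) auto

lemma normal_comm_subgroup:
  assumes "H \<lhd> G" "K \<lhd> G"
  shows "comm_subgroup H K \<lhd> G"
  unfolding comm_subgroup_def
proof (rule normal_generateI)
  show "{comm x y |x y. x \<in> H \<and> y \<in> K} \<subseteq> carrier G" using assms normal_carrier by auto
  fix h g assume h: "h \<in> {comm x y |x y. x \<in> H \<and> y \<in> K}" and g: "g \<in> carrier G"
  then obtain x y where "h = comm x y" "x \<in> H" "y \<in> K" by auto
  moreover have "x \<in> carrier G" "y \<in> carrier G"
    using calculation normal_carrier[OF assms(1)] normal_carrier[OF assms(2)] by auto
  ultimately have "g \<otimes> h \<otimes> inv g = comm (g \<otimes> x \<otimes> inv g) (g \<otimes> y \<otimes> inv g)"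
    using g by (simp add: conj_comm)
  moreover have "g \<otimes> x \<otimes> inv g \<in> H" "g \<otimes> y \<otimes> inv g \<in> K"
    using normal.inv_op_closed2[OF assms(1) g \<open>x \<in> H\<close>] normal.inv_op_closed2[OF assms(2) g \<open>y \<in> K\<close>]
    by auto
  ultimately show "g \<otimes> h \<otimes> inv g \<in> {comm x y |x y. x \<in> H \<and> y \<in> K}" by blast
qed

lemma comm_subgroup_subset:
  assumes "subgroup N G" "\<And>x y. x \<in> H \<Longrightarrow> y \<in> K \<Longrightarrow> comm x y \<in> N"
  shows "comm_subgroup H K \<subseteq> N"
  unfolding comm_subgroup_def by (rule generate_subgroup_incl) (use assms in auto)

text \<open>\<open>Hall_Witt\<close> with \<open>inv y\<close> in place of \<open>y\<close>: two of
  the three conjugated factors lie in \<open>N\<close>, hence so does the third. The inverses in the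
  hypotheses come from this substitution.\<close>

lemma Hall_Witt_mem:
  assumes N: "N \<lhd> G" and xyz: "x \<in> carrier G" "y \<in> carrier G" "z \<in> carrier G"
    and 1: "comm (comm (inv y) (inv z)) x \<in> N" and 2: "comm (comm z (inv x)) (inv y) \<in> N"
  shows "comm (comm x y) z \<in> N"
proof -
  interpret N: normal N G by fact
  let ?c = "y \<otimes> comm (comm x y) z \<otimes> inv y"
  let ?a = "inv z \<otimes> comm (comm (inv y) (inv z)) x \<otimes> z"
  let ?b = "inv x \<otimes> comm (comm z (inv x)) (inv y) \<otimes> x"
  have ab: "?a \<in> N" "?b \<in> N" using N.inv_op_closed1 1 2 xyz by auto
  have "?c \<otimes> ?a \<otimes> ?b = \<one>" using Hall_Witt[of x "inv y" z] xyz by simp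
  then have "?c = inv ?b \<otimes> inv ?a"
    by (intro mult3_eq_one) (use xyz in auto)
  then have "?c \<in> N" using ab by simp
  then have "inv y \<otimes> ?c \<otimes> y \<in> N" using xyz by (intro N.inv_op_closed1)
  then show ?thesis using xyz by (simp add: word_simps)
qed

lemma three_subgroups:
  assumes N: "N \<lhd> G" and X: "X \<lhd> G" and Y: "Y \<lhd> G" and Z: "Z \<lhd> G"
    and 1: "\<And>c x. c \<in> comm_subgroup Y Z \<Longrightarrow> x \<in> X \<Longrightarrow> comm c x \<in> N"
    and 2: "\<And>c y. c \<in> comm_subgroup Z X \<Longrightarrow> y \<in> Y \<Longrightarrow> comm c y \<in> N"
    and c: "c \<in> comm_subgroup X Y" and z: "z \<in> Z"
  shows "comm c z \<in> N"
proof -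
  have inv: "inv x \<in> X" if "x \<in> X" for x by (rule subgroup.m_inv_closed[OF normal_imp_subgroup[OF X] that])
  have invY: "inv x \<in> Y" if "x \<in> Y" for x by (rule subgroup.m_inv_closed[OF normal_imp_subgroup[OF Y] that])
  have invZ: "inv x \<in> Z" if "x \<in> Z" for x by (rule subgroup.m_inv_closed[OF normal_imp_subgroup[OF Z] that])
  have "comm (comm x y) z \<in> N" if xy: "x \<in> X" "y \<in> Y" for x y
  proof -
    have xyz: "x \<in> carrier G" "y \<in> carrier G" "z \<in> carrier G"
      using xy z normal_carrier[OF X] normal_carrier[OF Y] normal_carrier[OF Z] by auto
    show ?thesis
      by (rule Hall_Witt_mem[OF N xyz]) (use 1 2 comm_subgroup_mem inv invY invZ xy z in auto)
  qed
  then show ?thesis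
    using normal_carrier[OF X] normal_carrier[OF Y] normal_carrier[OF Z z]
    by (intro comm_generate_left[OF N _ _ _ c[unfolded comm_subgroup_def]]) auto
qed

text \<open>Modulo \<open>N\<close>, [x^m,z] equals [x,z]^m: in [x^(m+1),z] = [x^m,z]^x [x,z],
  conjugation by \<open>x\<close> changes the first factor only by an element of
  \<open>N\<close>.\<close>

lemma comm_pow_mem:
  assumes N: "N \<lhd> G" and x: "x \<in> carrier G" and z: "z \<in> carrier G"
    and c: "\<And>m::nat. comm (comm (x [^] m) z) x \<in> N" and e: "comm (x [^] (e::nat)) z \<in> N"
  shows "comm x z [^] e \<in> N"
proof -
  interpret N: normal N G by fact
  have "comm (x [^] m) z \<otimes> inv (comm x z [^] m) \<in> N" for m :: nat
  proof (induction m)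
    case 0
    then show ?case using z by simp
  next
    case (Suc m)
    define d c where dc: "d = comm x z" "c = comm (x [^] m) z"
    define p where p: "p = d [^] m"
    note pcd = dc p
    have car: "p \<in> carrier G" "c \<in> carrier G" "d \<in> carrier G" using x z by (simp_all add: pcd)
    have "comm (x [^] Suc m) z = inv x \<otimes> c \<otimes> x \<otimes> d"
      using x z by (simp add: pcd comm_mult_left)
    also have "inv x \<otimes> c \<otimes> x = c \<otimes> comm c x" using car x by (simp add: comm_def word_simps)
    finally have "comm (x [^] Suc m) z \<otimes> inv (comm x z [^] Suc m)
        = (c \<otimes> comm c x \<otimes> inv c) \<otimes> (c \<otimes> inv p)"
      using car x by (simp add: word_simps flip: dc p)
    moreover have "c \<otimes> comm c x \<otimes> inv c \<in> N" using assms(4)[of m] car by (simp add: pcd N.inv_op_closed2)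
    ultimately show ?case using Suc by (simp add: pcd)
  qed
  from this[of e] have "inv (comm (x [^] e) z \<otimes> inv (comm x z [^] e)) \<otimes> comm (x [^] e) z \<in> N"
    using e by blast
  then show ?thesis using x z by (simp add: word_simps)
qed

end

text \<open>\<open>A n\<close> models gamma_n and \<open>B n\<close> the subgroup [R,_(n-1) G]. The
  interlacing \<open>A (Suc n) \<subseteq> B n \<subseteq> A n\<close> makes the quotients of
  \<open>A n\<close> by \<open>B n\<close> a graded Lie ring under the commutator.\<close>

locale central_filtration = group G for G (structure) +
  fixes A B :: "nat \<Rightarrow> 'a set"
  assumes A_normal: "A n \<lhd> G" and B_normal: "B n \<lhd> G"
    and B_subset: "B n \<subseteq> A n" and A_Suc_subset: "A (Suc n) \<subseteq> B n"
    and A_one: "A (Suc 0) = carrier G"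
    and comm_A: "x \<in> A i \<Longrightarrow> y \<in> A j \<Longrightarrow> comm x y \<in> A (i + j)"
    and comm_B: "x \<in> A i \<Longrightarrow> y \<in> B j \<Longrightarrow> comm x y \<in> B (i + j)"
    and A_Suc: "0 < n \<Longrightarrow> A (Suc n) = comm_subgroup (A n) (carrier G)"
begin

lemma A_carrier: "x \<in> A n \<Longrightarrow> x \<in> carrier G"
  by (rule normal_carrier[OF A_normal])

lemma B_carrier: "x \<in> B n \<Longrightarrow> x \<in> carrier G"
  by (rule normal_carrier[OF B_normal])

lemma comm_B': "x \<in> B i \<Longrightarrow> y \<in> A j \<Longrightarrow> comm x y \<in> B (i + j)"
  using comm_B[of y j x i] comm_swap_mem[OF normal_imp_subgroup[OF B_normal]] A_carrier B_carrier
  by (metis add.commute)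

lemma comm_A_one: "x \<in> A n \<Longrightarrow> g \<in> carrier G \<Longrightarrow> comm x g \<in> B n"
  using comm_A[of x n g "Suc 0"] A_one A_Suc_subset by auto

text \<open>Commutators of \<open>A n\<close> with the whole group lie in \<open>A (Suc n)\<close>,
  hence in \<open>B n\<close>.\<close>

lemma normal_between:
  assumes K: "subgroup K G" and "B n \<subseteq> K" "K \<subseteq> A n"
  shows "K \<lhd> G"
proof (rule normal_invI[OF K])
  fix g x assume g: "g \<in> carrier G" and x: "x \<in> K"
  then have "comm x (inv g) \<in> K" using comm_A_one[of x n "inv g"] assms by auto
  moreover have "x \<in> carrier G" using x subgroup.subset[OF K] by auto
  ultimately show "g \<otimes> x \<otimes> inv g \<in> K"
    using g x conj_eq_comm[of x g] subgroup.m_closed[OF K x] by simp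
qed

text \<open>The Jacobi identity for single elements of the graded ring. The inverses and conjugates
  in the Hall-Witt identity are harmless, because \<open>K\<close> lies between \<open>B\<close> and
  \<open>A\<close> in the total degree.\<close>

lemma three_elements:
  assumes K: "subgroup K G" "B (i + j + k) \<subseteq> K" "K \<subseteq> A (i + j + k)"
    and x: "x \<in> A i" and y: "y \<in> A j" and z: "z \<in> A k"
    and yzx: "comm (comm y z) x \<in> K" and zxy: "comm (comm z x) y \<in> K"
  shows "comm (comm x y) z \<in> K"
proof -
  have Kn: "K \<lhd> G" using normal_between K by blast
  interpret K: normal K G by fact
  note car = A_carrier[OF x] A_carrier[OF y] A_carrier[OF z]
  \<comment> \<open>The elements of \<open>A l\<close> whose commutator with \<open>w\<close> lies
    in \<open>K\<close> form a subgroup containing \<open>B l\<close>, so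
    \<open>normal_between\<close> makes it normal.\<close>
  have conj: "comm (g \<otimes> u \<otimes> inv g) w \<in> K"
    if u: "u \<in> A l" "comm u w \<in> K" and w: "w \<in> A m" and g: "g \<in> carrier G" and lm: "l + m = i + j + k"
    for u w g l m
  proof -
    have "subgroup {u \<in> A l. comm u w \<in> K} G"
      using subgroup_comm_left[OF Kn normal_imp_subgroup[OF A_normal] A_carrier[OF w]] .
    moreover have "B l \<subseteq> {u \<in> A l. comm u w \<in> K}"
      using B_subset comm_B' w lm K(2) by fastforce
    ultimately have "{u \<in> A l. comm u w \<in> K} \<lhd> G" by (rule normal_between) auto
    then have "g \<otimes> u \<otimes> inv g \<in> {u \<in> A l. comm u w \<in> K}"
      using u normal.inv_op_closed2[OF _ g] by blast
    then show ?thesis by simp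
  qed
  have inv_l: "comm (inv u) w \<in> K" if "u \<in> carrier G" "w \<in> carrier G" "comm u w \<in> K" for u w
    using that comm_inv_left[of u w] K.inv_op_closed2 by simp
  have inv_r: "comm u (inv w) \<in> K" if "u \<in> carrier G" "w \<in> carrier G" "comm u w \<in> K" for u w
    by (rule comm_swap_mem[OF K(1) _ _ inv_l[OF _ _ comm_swap_mem[OF K(1)]]]) (use that in auto)
  have "comm (inv y) (inv z) = (z \<otimes> y) \<otimes> comm y z \<otimes> inv (z \<otimes> y)"
    using car by (simp add: comm_def word_simps)
  then have 1: "comm (comm (inv y) (inv z)) x \<in> K"
    using conj[of "comm y z" "j + k" x i "z \<otimes> y"] yzx car x comm_A[OF y z] by (simp add: add_ac)
  have zx: "comm (inv (comm z x)) y \<in> K" using inv_l[OF _ _ zxy] car by simp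
  have "comm z (inv x) = x \<otimes> inv (comm z x) \<otimes> inv x"
    using car by (simp add: comm_def word_simps)
  moreover have "inv (comm z x) \<in> A (k + i)"
    by (rule subgroup.m_inv_closed[OF normal_imp_subgroup[OF A_normal] comm_A[OF z x]])
  ultimately have 2: "comm (comm z (inv x)) (inv y) \<in> K"
    using conj[of "inv (comm z x)" "k + i" y j x] zx car y by (intro inv_r) (simp_all add: add_ac)
  show ?thesis by (rule Hall_Witt_mem[OF Kn car 1 2])
qed

end

section \<open>Bracketed Lyndon words as generators of the graded quotients\<close>

context group
begin

text \<open>On Lyndon words this is the standard bracketing, the group version of the Lyndon basis
  of the free Lie ring.\<close>

function lyndon_bracket :: "(nat \<Rightarrow> 'a) \<Rightarrow> nat list \<Rightarrow> 'a" where
  "lyndon_bracket y w =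
     (if length w \<le> 1 then y (hd w)
      else comm (lyndon_bracket y (lyndon_prefix w)) (lyndon_bracket y (min_suffix w)))"
  by auto
termination
proof (relation "measure (\<lambda>(y, w). length w)")
  fix w :: "nat list" assume "\<not> length w \<le> 1"
  then have w: "2 \<le> length w" by simp
  have "length w = length (lyndon_prefix w) + length (min_suffix w)"
    by (subst min_suffix(1)[OF w]) simp
  then show "((y, lyndon_prefix w), (y, w)) \<in> measure (\<lambda>(y, w). length w)"
    "((y, min_suffix w), (y, w)) \<in> measure (\<lambda>(y, w). length w)" for y :: "nat \<Rightarrow> 'a"
    using min_suffix(2,3)[OF w] by auto
qed auto

declare lyndon_bracket.simps [simp del]

lemma lyndon_bracket_singleton [simp]: "lyndon_bracket y [i] = y i"
  by (simp add: lyndon_bracket.simps)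

lemma lyndon_bracket_split:
  "2 \<le> length w \<Longrightarrow>
    lyndon_bracket y w = comm (lyndon_bracket y (lyndon_prefix w)) (lyndon_bracket y (min_suffix w))"
  by (subst lyndon_bracket.simps) simp

end

lemma lyndon_words_split:
  assumes w: "w \<in> lyndon_words n d" and n: "2 \<le> n"
  obtains i j where "lyndon_prefix w \<in> lyndon_words i d" "min_suffix w \<in> lyndon_words j d"
    "i + j = n" "0 < i" "0 < j" "lyndon_prefix w < min_suffix w" "w < min_suffix w"
proof -
  have l: "2 \<le> length w" "lyndon w" and s: "set w \<subseteq> {..<d}" and n': "length w = n"
    using assms by (auto simp: lyndon_words_def words_def)
  note m = min_suffix[OF l(1)]
  have sw: "set w = set (lyndon_prefix w) \<union> set (min_suffix w)" by (subst m(1)) simp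
  have lw: "n = length (lyndon_prefix w) + length (min_suffix w)" using n' by (subst (asm) m(1)) simp
  show thesis
    by (rule that[of "length (lyndon_prefix w)" "length (min_suffix w)"])
      (use l s sw lw m lyndon_lyndon_prefix lyndon_min_suffix lyndon_prefix_less_min_suffix
       in \<open>auto simp: lyndon_words_def words_def\<close>)
qed

lemma lyndon_words_induct [consumes 1, case_names letter split]:
  assumes "w \<in> lyndon_words n d"
    and letter: "\<And>i. i < d \<Longrightarrow> P 1 [i]"
    and split: "\<And>w i j. w \<in> lyndon_words (i + j) d \<Longrightarrow> 2 \<le> i + j \<Longrightarrow>
      lyndon_prefix w \<in> lyndon_words i d \<Longrightarrow> min_suffix w \<in> lyndon_words j d \<Longrightarrow>
      P i (lyndon_prefix w) \<Longrightarrow> P j (min_suffix w) \<Longrightarrow> P (i + j) w"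
  shows "P n w"
  using assms(1)
proof (induction n arbitrary: w rule: less_induct)
  case (less n)
  show ?case
  proof (cases "2 \<le> n")
    case True
    from lyndon_words_split[OF less.prems True] obtain i j where ij:
      "lyndon_prefix w \<in> lyndon_words i d" "min_suffix w \<in> lyndon_words j d" "i + j = n" "0 < i" "0 < j"
      by metis
    then have "P i (lyndon_prefix w)" "P j (min_suffix w)" using less.IH by auto
    then show ?thesis using split[of w i j] ij less.prems True by auto
  next
    case False
    have "w \<noteq> []" "length w = n" using less.prems by (auto simp: lyndon_words_def words_def lyndon_def)
    then obtain i where "w = [i]" "n = 1" using False by (cases w; cases "tl w") auto
    then show ?thesis using letter[of i] less.prems by (auto simp: lyndon_words_def words_def)
  qed
qed

lemma set_lyndon_split:
  "2 \<le> length w \<Longrightarrow> set w = set (lyndon_prefix w) \<union> set (min_suffix w)"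
  by (metis min_suffix(1) set_append)

locale filtration_generators = central_filtration +
  fixes y :: "nat \<Rightarrow> 'a" and d :: nat
  assumes y_carrier: "y i \<in> carrier G"
    and generate_y: "carrier G \<subseteq> generate G (y ` {..<d} \<union> B (Suc 0))"
begin

abbreviation "bracket \<equiv> lyndon_bracket y"

lemma bracket_mem: "w \<in> lyndon_words n d \<Longrightarrow> bracket w \<in> A n"
proof (induction rule: lyndon_words_induct)
  case (letter i)
  then show ?case using A_one y_carrier by simp
next
  case (split w i j)
  then have "2 \<le> length w" by (auto simp: lyndon_words_def words_def)
  then show ?case using split comm_A by (simp add: lyndon_bracket_split)
qed

lemma bracket_carrier: "w \<in> lyndon_words n d \<Longrightarrow> bracket w \<in> carrier G"
  using bracket_mem A_carrier by blast

text \<open>The span is taken modulo \<open>B n\<close>; the predicate \<open>P\<close> lets the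
  rewriting record that only words below a bound occur.\<close>

definition bracket_span :: "nat \<Rightarrow> (nat list \<Rightarrow> bool) \<Rightarrow> 'a set" where
  "bracket_span n P = generate G (bracket ` {w \<in> lyndon_words n d. P w} \<union> B n)"

lemma bracket_span_gens: "bracket ` {w \<in> lyndon_words n d. P w} \<union> B n \<subseteq> A n"
  using bracket_mem B_subset by auto

lemma bracket_span_subgroup: "subgroup (bracket_span n P) G"
  unfolding bracket_span_def
  by (rule generate_is_subgroup) (use bracket_span_gens[of n P] A_carrier in blast)

lemma B_subset_bracket_span: "B n \<subseteq> bracket_span n P"
  unfolding bracket_span_def by (auto intro: generate.incl)

lemma bracket_in_span: "w \<in> lyndon_words n d \<Longrightarrow> P w \<Longrightarrow> bracket w \<in> bracket_span n P"
  unfolding bracket_span_def by (auto intro: generate.incl)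

lemma bracket_span_subset: "bracket_span n P \<subseteq> A n"
  unfolding bracket_span_def
  by (rule generate_subgroup_incl[OF bracket_span_gens normal_imp_subgroup[OF A_normal]])

lemma bracket_span_normal: "bracket_span n P \<lhd> G"
  by (rule normal_between[OF bracket_span_subgroup B_subset_bracket_span bracket_span_subset])

lemma bracket_span_mono: "(\<And>w. P w \<Longrightarrow> Q w) \<Longrightarrow> bracket_span n P \<subseteq> bracket_span n Q"
  unfolding bracket_span_def by (rule mono_generate) auto

text \<open>The rewriting of \<open>[[u\<^sub>1, u\<^sub>2], v]\<close> with \<open>u\<^sub>2 < v\<close> by the Jacobi identity terminates
  because it only produces commutators of the same weight whose factors are smaller than \<open>v\<close>.\<close>

lemma comm_bracket_less:
  "u \<in> lyndon_words i d \<Longrightarrow> v \<in> lyndon_words j d \<Longrightarrow> u < v \<Longrightarrow>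
    comm (bracket u) (bracket v) \<in> bracket_span (i + j) (\<lambda>w. w < v)"
proof (induction "i + j" arbitrary: i j u v rule: less_induct)
  case outer: less
  let ?n = "i + j"
  \<comment> \<open>The lexicographic order on all words is not well founded. With alphabet and
    length bounded only finitely many words lie below \<open>v\<close>, and their number serves as
    the induction measure.\<close>
  define Z where "Z v = {w. set w \<subseteq> {..<d} \<and> length w \<le> ?n \<and> w < v}" for v :: "nat list"
  have finZ: "finite (Z v)" for v
    unfolding Z_def using finite_lists_length_le[of "{..<d}" ?n] by (rule rev_finite_subset) auto
  have "comm (bracket u) (bracket v) \<in> bracket_span ?n (\<lambda>w. w < v)"
    if "u \<in> lyndon_words i' d" "v \<in> lyndon_words j' d" "u < v" "i' + j' = ?n" for i' j' u v
    using that
  proof (induction "card (Z v)" arbitrary: i' j' u v rule: less_induct)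
    case less
    have u: "length u = i'" "lyndon u" "set u \<subseteq> {..<d}" and v: "length v = j'" "lyndon v" "set v \<subseteq> {..<d}"
      using less.prems by (auto simp: lyndon_words_def words_def)
    note uv = \<open>u < v\<close>
    let ?K = "bracket_span ?n (\<lambda>w. w < v)"
    show ?case
    proof (cases "2 \<le> length u \<and> \<not> v \<le> min_suffix u")
      case False
      \<comment> \<open>Here (u, v) is the standard factorization of the Lyndon word
        \<open>u @ v\<close>, so the commutator is itself a bracket.\<close>
      then have s: "min_suffix (u @ v) = v" "lyndon_prefix (u @ v) = u"
        using standard_factorization_append[OF u(2) v(2) uv] by auto
      have l: "2 \<le> length (u @ v)" using u(2) v(2) by (cases u; cases v) (auto simp: lyndon_def)
      have w: "u @ v \<in> lyndon_words ?n d"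
        using u v uv lyndon_append less.prems(4) by (auto simp: lyndon_words_def words_def)
      have "u @ v < v" using lyndon_append_less[OF v(2) uv] u(2) by (auto simp: lyndon_def)
      then show ?thesis
        using bracket_in_span[OF w, of "\<lambda>w. w < v"] lyndon_bracket_split[OF l] s by simp
    next
      case True
      then have l: "2 \<le> i'" and mv: "min_suffix u < v" using u by auto
      from lyndon_words_split[OF less.prems(1) l] obtain k l where kl:
        "lyndon_prefix u \<in> lyndon_words k d" "min_suffix u \<in> lyndon_words l d" "k + l = i'"
        "0 < k" "0 < l" "lyndon_prefix u < min_suffix u" by metis
      define p q where pq: "p = lyndon_prefix u" "q = min_suffix u"
      have p: "p \<in> lyndon_words k d" and q: "q \<in> lyndon_words l d" and "p < q" "q < v"
        using kl mv by (auto simp: pq)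
      then have "p < v" by simp
      have bu: "bracket u = comm (bracket p) (bracket q)"
        using True by (simp add: lyndon_bracket_split pq)
      note v' = less.prems(2)
      have small: "comm (bracket s) (bracket t) \<in> ?K"
        if st: "s \<in> lyndon_words a d" "t \<in> lyndon_words b d" "s < v" "t < v" "a + b = ?n" for s t a b
      proof -
        have *: "comm (bracket s) (bracket t) \<in> ?K"
          if st: "s \<in> lyndon_words a d" "t \<in> lyndon_words b d" "s < t" "t < v" "a + b = ?n" for s t a b
        proof -
          have "t \<in> Z v" using st by (auto simp: Z_def lyndon_words_def words_def)
          moreover have "t \<notin> Z t" by (simp add: Z_def)
          moreover have "Z t \<subseteq> Z v" using st(4) by (auto simp: Z_def)
          ultimately have "card (Z t) < card (Z v)" by (intro psubset_card_mono finZ) auto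
          then have "comm (bracket s) (bracket t) \<in> bracket_span ?n (\<lambda>w. w < t)"
            using less.hyps[of t s a b] st by blast
          then show ?thesis using bracket_span_mono[of "\<lambda>w. w < t" "\<lambda>w. w < v"] st(4) by (meson order.strict_trans subsetD)
        qed
        consider "s < t" | "t < s" | "s = t" by force
        then show ?thesis
        proof cases
          case 1
          then show ?thesis using * st by blast
        next
          case 2
          then have "comm (bracket t) (bracket s) \<in> ?K" using *[of t b s a] st by (simp add: add.commute)
          then show ?thesis
            by (rule comm_swap_mem[OF bracket_span_subgroup bracket_carrier[OF st(2)] bracket_carrier[OF st(1)]])
        next
          case 3
          then show ?thesis using bracket_carrier[OF st(1)] subgroup.one_closed[OF bracket_span_subgroup] by simp
        qed
      qed
      have inner: "comm c (bracket s) \<in> ?K"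
        if c: "c \<in> bracket_span a (\<lambda>w. w < v)" and s: "s \<in> lyndon_words b d" "s < v" "a + b = ?n" for c s a b
      proof (rule comm_generate_left[OF bracket_span_normal _ bracket_carrier[OF s(1)] _ c[unfolded bracket_span_def]])
        show "bracket ` {w \<in> lyndon_words a d. w < v} \<union> B a \<subseteq> carrier G"
          using bracket_carrier B_carrier by auto
        fix x assume "x \<in> bracket ` {w \<in> lyndon_words a d. w < v} \<union> B a"
        then show "comm x (bracket s) \<in> ?K"
        proof
          assume "x \<in> B a"
          then have "comm x (bracket s) \<in> B ?n" using comm_B' bracket_mem[OF s(1)] s(3) by metis
          then show ?thesis using B_subset_bracket_span by blast
        qed (use small s in auto)
      qed
      \<comment> \<open>The inner commutators of the Jacobi identity have smaller total weight, so
        the outer induction writes them in brackets of words below \<open>v\<close>;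
        \<open>inner\<close> then commutes these with the remaining factor.\<close>
      have "comm (bracket q) (bracket v) \<in> bracket_span (l + j') (\<lambda>w. w < v)"
        using outer.hyps[of l j' q v] q v' \<open>q < v\<close> kl(3,4) less.prems(4) by auto
      then have 1: "comm (comm (bracket q) (bracket v)) (bracket p) \<in> ?K"
        using inner[OF _ p \<open>p < v\<close>] kl(3) less.prems(4) by auto
      have "comm (bracket p) (bracket v) \<in> bracket_span (k + j') (\<lambda>w. w < v)"
        using outer.hyps[of k j' p v] p v' \<open>p < v\<close> kl(3,5) less.prems(4) by auto
      then have "comm (bracket v) (bracket p) \<in> bracket_span (k + j') (\<lambda>w. w < v)"
        by (rule comm_swap_mem[OF bracket_span_subgroup bracket_carrier[OF p] bracket_carrier[OF v']])
      then have 2: "comm (comm (bracket v) (bracket p)) (bracket q) \<in> ?K"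
        using inner[OF _ q \<open>q < v\<close>] kl(3) less.prems(4) by auto
      have n: "k + l + j' = ?n" using kl(3) less.prems(4) by simp
      show ?thesis
        unfolding bu
        by (rule three_elements[OF bracket_span_subgroup _ _ bracket_mem[OF p] bracket_mem[OF q] bracket_mem[OF v'] 1 2])
          (use n B_subset_bracket_span bracket_span_subset in auto)
    qed
  qed
  then show ?case using outer.prems by blast
qed

lemma comm_bracket_bracket:
  assumes u: "u \<in> lyndon_words i d" and v: "v \<in> lyndon_words j d"
  shows "comm (bracket u) (bracket v) \<in> bracket_span (i + j) (\<lambda>_. True)"
proof -
  have *: "comm (bracket u) (bracket v) \<in> bracket_span (i + j) (\<lambda>_. True)"
    if "u \<in> lyndon_words i d" "v \<in> lyndon_words j d" "u < v" for u v i j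
    using comm_bracket_less[OF that] bracket_span_mono[of "\<lambda>w. w < v" "\<lambda>_. True"] by blast
  consider "u < v" | "v < u" | "u = v" by force
  then show ?thesis
  proof cases
    case 1
    then show ?thesis using * assms by blast
  next
    case 2
    then have "comm (bracket v) (bracket u) \<in> bracket_span (i + j) (\<lambda>_. True)"
      using *[OF v u] by (simp add: add.commute)
    then show ?thesis
      by (rule comm_swap_mem[OF bracket_span_subgroup bracket_carrier[OF v] bracket_carrier[OF u]])
  next
    case 3
    then show ?thesis using bracket_carrier[OF u] subgroup.one_closed[OF bracket_span_subgroup] by simp
  qed
qed

text \<open>\<open>A (Suc n)\<close> is generated by commutators of \<open>A n\<close> with the
  group. On generators these are commutators of a bracket with a single letter, or they already lie
  in \<open>B\<close>.\<close>

lemma A_subset_bracket_span: "0 < n \<Longrightarrow> A n \<subseteq> bracket_span n (\<lambda>_. True)"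
proof (induction n)
  case (Suc n)
  have letters: "[i] \<in> lyndon_words (Suc 0) d" if "i < d" for i
    using that by (auto simp: lyndon_words_def words_def)
  have one: "carrier G \<subseteq> bracket_span (Suc 0) (\<lambda>_. True)"
  proof (rule order.trans[OF generate_y])
    have "y ` {..<d} \<subseteq> bracket ` {w \<in> lyndon_words (Suc 0) d. True}"
    proof
      fix x assume "x \<in> y ` {..<d}"
      then obtain i where "i < d" "x = bracket [i]" by auto
      then show "x \<in> bracket ` {w \<in> lyndon_words (Suc 0) d. True}" using letters by blast
    qed
    then show "generate G (y ` {..<d} \<union> B (Suc 0)) \<subseteq> bracket_span (Suc 0) (\<lambda>_. True)"
      unfolding bracket_span_def by (intro mono_generate) auto
  qed
  show ?case
  proof (cases n)
    case 0
    then show ?thesis using one A_one by simp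
  next
    case (Suc m)
    let ?K = "bracket_span (Suc n) (\<lambda>_. True)"
    have "comm x g \<in> ?K" if x: "x \<in> A n" and g: "g \<in> carrier G" for x g
    proof -
      have x: "x \<in> generate G (bracket ` {w \<in> lyndon_words n d. True} \<union> B n)"
        using Suc.IH Suc x by (auto simp: bracket_span_def)
      have g: "g \<in> generate G (y ` {..<d} \<union> B (Suc 0))" using generate_y g by auto
      show ?thesis
      proof (rule comm_generate[OF bracket_span_normal _ _ _ x g])
        show "bracket ` {w \<in> lyndon_words n d. True} \<union> B n \<subseteq> carrier G"
          using bracket_carrier B_carrier by auto
        show "y ` {..<d} \<union> B (Suc 0) \<subseteq> carrier G" using y_carrier B_carrier by auto
        fix a b assume a: "a \<in> bracket ` {w \<in> lyndon_words n d. True} \<union> B n"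
          and b: "b \<in> y ` {..<d} \<union> B (Suc 0)"
        have aA: "a \<in> A n" using a bracket_mem B_subset by auto
        have bA: "b \<in> A (Suc 0)" using b A_one y_carrier B_carrier by auto
        consider "a \<in> B n \<or> b \<in> B (Suc 0)" | w i where "w \<in> lyndon_words n d" "a = bracket w" "i < d" "b = y i"
          using a b by auto
        then show "comm a b \<in> ?K"
        proof cases
          case 1
          then have "comm a b \<in> B (n + Suc 0)" using comm_B[OF aA] comm_B'[OF _ bA] by blast
          then show ?thesis using B_subset_bracket_span by auto
        next
          case (2 w i)
          then show ?thesis using comm_bracket_bracket[OF 2(1) letters[OF 2(3)]] by simp
        qed
      qed
    qed
    then show ?thesis using A_Suc[of n] Suc comm_subgroup_subset[OF bracket_span_subgroup] by simp
  qed
qed simp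

lemma comm_pow_B:
  assumes x: "x \<in> A i" and z: "z \<in> A j" and e: "x [^] (e::nat) \<in> B i"
  shows "comm x z [^] e \<in> B (i + j)"
proof (rule comm_pow_mem[OF B_normal A_carrier[OF x] A_carrier[OF z]])
  show "comm (x [^] e) z \<in> B (i + j)" by (rule comm_B'[OF e z])
  fix m :: nat
  have "x [^] m \<in> A i" using x normal_imp_subgroup[OF A_normal] 
    by (induction m) (auto intro: subgroup.m_closed subgroup.one_closed)
  then show "comm (comm (x [^] m) z) x \<in> B (i + j)"
    using comm_A_one comm_A z A_carrier[OF x] by blast
qed

text \<open>Modulo \<open>B\<close> the commutator is additive in each argument, so a power that
  kills one factor kills the bracket, and \<open>i\<close> occurs in one of the two factors. If it
  is the right one, the commutator is inverted.\<close>

lemma bracket_pow: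
  assumes "w \<in> lyndon_words n d" "\<And>i. i \<in> set w \<Longrightarrow> y i [^] e i \<in> B (Suc 0)" "i \<in> set w"
  shows "bracket w [^] (e i :: nat) \<in> B n"
  using assms
proof (induction rule: lyndon_words_induct)
  case (split w j k)
  have l: "2 \<le> length w" using split.hyps by (auto simp: lyndon_words_def words_def)
  note s = set_lyndon_split[OF l] and b = lyndon_bracket_split[OF l]
  note pm = bracket_mem[OF split.hyps(3)] bracket_mem[OF split.hyps(4)]
  have "bracket (lyndon_prefix w) [^] e i \<in> B j \<or> bracket (min_suffix w) [^] e i \<in> B k"
    using split s by auto
  then show ?case
  proof
    assume "bracket (lyndon_prefix w) [^] e i \<in> B j"
    then show ?thesis using comm_pow_B pm b by simp
  next
    assume "bracket (min_suffix w) [^] e i \<in> B k"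
    then have "comm (bracket (min_suffix w)) (bracket (lyndon_prefix w)) [^] e i \<in> B (k + j)"
      using comm_pow_B pm by simp
    then have "inv (comm (bracket (min_suffix w)) (bracket (lyndon_prefix w)) [^] e i) \<in> B (j + k)"
      using subgroup.m_inv_closed[OF normal_imp_subgroup[OF B_normal]] by (simp add: add.commute)
    then show ?thesis
      using b pm A_carrier by (simp add: inv_comm flip: nat_pow_inv)
  qed
qed simp

end

section \<open>The lower central series relative to a subgroup with abelian quotient\<close>

locale abelian_quotient = group G for G (structure) +
  fixes R :: "'a set"
  assumes R_normal: "R \<lhd> G" and comm_R: "x \<in> carrier G \<Longrightarrow> y \<in> carrier G \<Longrightarrow> comm x y \<in> R"

context group
begin

text \<open>\<open>rel_lcs R (Suc c)\<close> is $[R,_c G]$; in particular \<open>rel_lcs (carrier G) n\<close> is $\gamma_n(G)$.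
  The convention at \<open>0\<close> makes the filtration laws hold for all indices.\<close>

fun rel_lcs :: "'a set \<Rightarrow> nat \<Rightarrow> 'a set" where
  "rel_lcs R 0 = carrier G"
| "rel_lcs R (Suc 0) = R"
| "rel_lcs R (Suc (Suc n)) = comm_subgroup (rel_lcs R (Suc n)) (carrier G)"

abbreviation "lcs \<equiv> rel_lcs (carrier G)"

lemma comm_subgroup_mono: "H \<subseteq> H' \<Longrightarrow> comm_subgroup H K \<subseteq> comm_subgroup H' K"
  unfolding comm_subgroup_def by (rule mono_generate) auto

lemma rel_lcs_normal: "R \<lhd> G \<Longrightarrow> rel_lcs R n \<lhd> G"
  by (induction R n rule: rel_lcs.induct) (auto intro: normal_comm_subgroup normal_self)

lemma foldl_comm_lcs:
  "x \<in> carrier G \<Longrightarrow> set xs \<subseteq> carrier G \<Longrightarrow> foldl comm x xs \<in> lcs (Suc (length xs))"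
  by (induction xs rule: rev_induct) (auto intro: comm_subgroup_mem)

end

context abelian_quotient
begin

lemma comm_rel_lcs: "x \<in> rel_lcs R n \<Longrightarrow> g \<in> carrier G \<Longrightarrow> comm x g \<in> rel_lcs R (Suc n)"
  by (cases n) (auto intro: comm_R comm_subgroup_mem)

text \<open>Induction on \<open>i\<close> by the three subgroups lemma: [[gamma_i, G], R_j] is
  controlled by [[G, R_j], gamma_i] and [[R_j, gamma_i], G], where R_j is
  \<open>rel_lcs R j\<close>.\<close>

lemma comm_lcs_rel_lcs: "x \<in> lcs i \<Longrightarrow> z \<in> rel_lcs R j \<Longrightarrow> comm x z \<in> rel_lcs R (i + j)"
proof (induction i arbitrary: j x z)
  case 0
  then show ?case using normal_comm_left(2)[OF rel_lcs_normal[OF R_normal]] by simp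
next
  case (Suc i)
  note nR = rel_lcs_normal[OF R_normal] and nG = rel_lcs_normal[OF normal_self]
  have swap: "comm a b \<in> rel_lcs R m \<Longrightarrow> a \<in> carrier G \<Longrightarrow> b \<in> carrier G \<Longrightarrow> comm b a \<in> rel_lcs R m" for a b m
    using comm_swap_mem[OF normal_imp_subgroup[OF nR]] by blast
  have R': "comm g z \<in> rel_lcs R (Suc j)" if "z \<in> rel_lcs R j" "g \<in> carrier G" for g z j
    using comm_rel_lcs[OF that] swap that normal_carrier[OF nR] by blast
  show ?case
  proof (cases i)
    case 0
    then show ?thesis using Suc.prems R' by simp
  next
    case (Suc m)
    then have x: "x \<in> comm_subgroup (lcs i) (carrier G)" using Suc.prems by simp
    show ?thesis
    proof (rule three_subgroups[OF nR nG normal_self nR _ _ x Suc.prems(2)])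
      fix c x assume c: "c \<in> comm_subgroup (carrier G) (rel_lcs R j)" and x: "x \<in> lcs i"
      have "c \<in> rel_lcs R (Suc j)"
        using c comm_subgroup_subset[OF normal_imp_subgroup[OF nR]] R' by blast
      then show "comm c x \<in> rel_lcs R (Suc i + j)"
        using Suc.IH[OF x, of c "Suc j"] swap normal_carrier[OF nR] normal_carrier[OF nG x] by simp
    next
      fix c g assume c: "c \<in> comm_subgroup (rel_lcs R j) (lcs i)" and g: "g \<in> carrier G"
      have "comm b a \<in> rel_lcs R (i + j)" if "a \<in> lcs i" "b \<in> rel_lcs R j" for a b
        using Suc.IH that swap normal_carrier[OF nR] normal_carrier[OF nG] by blast
      then have "c \<in> rel_lcs R (i + j)"
        using c comm_subgroup_subset[OF normal_imp_subgroup[OF nR]] by blast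
      then show "comm c g \<in> rel_lcs R (Suc i + j)" using comm_rel_lcs g by simp
    qed
  qed
qed

lemma rel_lcs_subset_lcs: "rel_lcs R n \<subseteq> lcs n"
proof (induction n rule: nat_less_induct)
  case (1 n)
  show ?case
  proof (cases n)
    case (Suc m)
    show ?thesis
    proof (cases m)
      case 0
      then show ?thesis using Suc normal_carrier[OF R_normal] by auto
    next
      case (Suc l)
      then have "rel_lcs R (Suc l) \<subseteq> lcs (Suc l)" using 1 \<open>n = Suc m\<close> by blast
      then show ?thesis using comm_subgroup_mono Suc \<open>n = Suc m\<close> by simp
    qed
  qed simp
qed

text \<open>The quotient by \<open>R\<close> being abelian gives gamma_2 inside \<open>R\<close>;
  taking commutators with the whole group raises both sides by one.\<close>

lemma lcs_Suc_subset: "lcs (Suc n) \<subseteq> rel_lcs R n"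
proof (induction n)
  case (Suc n)
  show ?case
  proof (cases n)
    case 0
    then show ?thesis
      using comm_subgroup_subset[OF normal_imp_subgroup[OF R_normal]] comm_R by simp
  next
    case (Suc m)
    then show ?thesis using comm_subgroup_mono[OF Suc.IH] by simp
  qed
qed simp

end

sublocale abelian_quotient \<subseteq> central_filtration G lcs "rel_lcs R"
proof -
  \<comment> \<open>For \<open>R\<close> the whole group \<open>rel_lcs\<close> is the lower central
    series itself, so the law for two terms of \<open>lcs\<close> is an instance of the mixed
    law.\<close>
  interpret whole: abelian_quotient G "carrier G"
    by (intro abelian_quotient.intro abelian_quotient_axioms.intro normal_self group_axioms) simp
  show "central_filtration G lcs (rel_lcs R)"
  proof (rule central_filtration.intro[OF group_axioms], rule central_filtration_axioms.intro)
    show "lcs n \<lhd> G" "rel_lcs R n \<lhd> G" for n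
      using rel_lcs_normal normal_self R_normal by auto
    show "rel_lcs R n \<subseteq> lcs n" "lcs (Suc n) \<subseteq> rel_lcs R n" for n
      by (rule rel_lcs_subset_lcs lcs_Suc_subset)+
    show "lcs (Suc 0) = carrier G" by simp
    show "comm x y \<in> lcs (i + j)" if "x \<in> lcs i" "y \<in> lcs j" for x y i j
      using whole.comm_lcs_rel_lcs that by blast
    show "comm x y \<in> rel_lcs R (i + j)" if "x \<in> lcs i" "y \<in> rel_lcs R j" for x y i j
      using comm_lcs_rel_lcs that by blast
    show "0 < n \<Longrightarrow> lcs (Suc n) = comm_subgroup (lcs n) (carrier G)" for n
      by (cases n) auto
  qed
qed

section \<open>Free groups\<close>

lemma eval_word_Nil [simp]: "eval_word G f [] = \<one>\<^bsub>G\<^esub>"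
  by (simp add: eval_word_def)

lemma eval_word_Cons:
  "eval_word G f (a # w) =
     (if snd a then f (fst a) else inv\<^bsub>G\<^esub> (f (fst a))) \<otimes>\<^bsub>G\<^esub> eval_word G f w"
  by (cases a) (simp add: eval_word_def)

context group
begin

lemma eval_word_closed:
  "fst ` set w \<subseteq> X \<Longrightarrow> f \<in> X \<rightarrow> carrier G \<Longrightarrow> eval_word G f w \<in> carrier G"
  by (induction w) (auto simp: eval_word_Cons Pi_iff)

lemma eval_word_append:
  "fst ` set u \<subseteq> X \<Longrightarrow> fst ` set v \<subseteq> X \<Longrightarrow> f \<in> X \<rightarrow> carrier G \<Longrightarrow>
    eval_word G f (u @ v) = eval_word G f u \<otimes> eval_word G f v"
proof (induction u)
  case Nil
  then show ?case using eval_word_closed[of v X f] by simp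
next
  case (Cons a u)
  then have "f (fst a) \<in> carrier G" "eval_word G f u \<in> carrier G" "eval_word G f v \<in> carrier G"
    using eval_word_closed[of u X f] eval_word_closed[of v X f] by auto
  then show ?case using Cons by (simp add: eval_word_Cons m_assoc)
qed

lemma eval_word_inv_letter:
  "eval_word G f w \<in> carrier G \<Longrightarrow> f (fst a) \<in> carrier G \<Longrightarrow>
    eval_word G f (a # inv_letter a # w) = eval_word G f w"
  by (cases a) (auto simp: eval_word_Cons inv_letter_def word_simps)

lemma eval_word_reduce:
  "fst ` set w \<subseteq> X \<Longrightarrow> f \<in> X \<rightarrow> carrier G \<Longrightarrow> eval_word G f (reduce w) = eval_word G f w"
proof (induction w)
  case (Cons a w)
  have r: "fst ` set (reduce w) \<subseteq> X" using fst_set_reduce[of w] Cons.prems by auto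
  have a: "f (fst a) \<in> carrier G" using Cons.prems by auto
  have "eval_word G f (cancel_cons a (reduce w)) = eval_word G f (a # reduce w)"
  proof (cases "\<exists>v. reduce w = inv_letter a # v")
    case True
    then obtain v where v: "reduce w = inv_letter a # v" by auto
    then have "eval_word G f v \<in> carrier G" using r Cons.prems eval_word_closed[of v X f] by auto
    then show ?thesis using v eval_word_inv_letter[of f v a] a by simp
  qed (cases "reduce w", auto)
  moreover have "reduce (a # w) = cancel_cons a (reduce w)" by (simp add: reduce_def)
  ultimately show ?case using Cons by (simp add: eval_word_Cons)
qed (simp add: reduce_def)

lemma eval_word_hom:
  assumes "f \<in> X \<rightarrow> carrier G"
  shows "eval_word G f \<in> hom (free_group X) G"
proof (rule homI)
  fix u v assume "u \<in> carrier (free_group X)" "v \<in> carrier (free_group X)"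
  then have uv: "fst ` set u \<subseteq> X" "fst ` set v \<subseteq> X" by (auto simp: free_group_def)
  then show "eval_word G f u \<in> carrier G" using assms by (intro eval_word_closed)
  have "fst ` set (u @ v) \<subseteq> X" using uv by auto
  then show "eval_word G f (u \<otimes>\<^bsub>free_group X\<^esub> v) = eval_word G f u \<otimes> eval_word G f v"
    using eval_word_reduce[of "u @ v" X f] eval_word_append[OF uv] assms
    by (simp add: free_group_def)
qed

lemma free_on_generate:
  assumes "free_on G X"
  shows "carrier G \<subseteq> generate G X"
proof
  fix g assume "g \<in> carrier G"
  then have "g \<in> eval_word G (\<lambda>x. x) ` carrier (free_group X)"
    using assms by (simp add: free_on_def iso_def bij_betw_def)
  then obtain w where w: "fst ` set w \<subseteq> X" "g = eval_word G (\<lambda>x. x) w" by (auto simp: free_group_def)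
  have "fst ` set w \<subseteq> X \<Longrightarrow> eval_word G (\<lambda>x. x) w \<in> generate G X" for w
    by (induction w) (auto simp: eval_word_Cons intro: generate.intros)
  then show "g \<in> generate G X" using w by simp
qed

lemma free_on_extend:
  assumes free: "free_on G X" and "group W" and f: "f \<in> X \<rightarrow> carrier W"
  obtains h where "h \<in> hom G W" "\<And>x. x \<in> X \<Longrightarrow> h x = f x"
proof -
  interpret W: group W by fact
  interpret FX: group "free_group X" by (rule group_free_group)
  let ?e = "eval_word G (\<lambda>x. x)" and ?i = "inv_into (carrier (free_group X)) (eval_word G (\<lambda>x. x))"
  have e: "?e \<in> iso (free_group X) G" and X: "X \<subseteq> carrier G" using free by (auto simp: free_on_def)
  have "?i \<in> iso G (free_group X)" by (rule FX.iso_set_sym[OF e])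
  then have hom: "eval_word W f \<circ> ?i \<in> hom G W"
    using W.eval_word_hom[OF f] by (auto simp: iso_def intro: Group.hom_compose)
  have "(eval_word W f \<circ> ?i) x = f x" if x: "x \<in> X" for x
  proof -
    have "[(x, True)] \<in> carrier (free_group X)" using x by (simp add: free_group_def)
    moreover have "?e [(x, True)] = x" using x X by (auto simp: eval_word_Cons)
    ultimately have "?i x = [(x, True)]"
      using e inv_into_f_f[of ?e "carrier (free_group X)" "[(x, True)]"] by (simp add: iso_def bij_betw_def)
    then show ?thesis using f x by (auto simp: eval_word_Cons Pi_iff)
  qed
  then show thesis using that hom by blast
qed

text \<open>The second cohomology of a subgroup \<open>K\<close> of a free group vanishes. By Shapiro's lemma a
  cocycle on \<open>K\<close> becomes one on the whole group with values in the functions on \<open>G\<close> that are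
  invariant under \<open>K\<close>; the corresponding extension splits because \<open>G\<close> is free.\<close>

lemma free_cocycle_splits:
  fixes \<beta> :: "'a \<Rightarrow> 'a \<Rightarrow> 'c :: ab_group_add"
  assumes free: "free_on G X" and K: "subgroup K G"
    and left: "\<And>u v w. u \<in> K \<Longrightarrow> v \<in> K \<Longrightarrow> w \<in> K \<Longrightarrow> \<beta> (u \<otimes> v) w = \<beta> u w + \<beta> v w"
    and right: "\<And>u v w. u \<in> K \<Longrightarrow> v \<in> K \<Longrightarrow> w \<in> K \<Longrightarrow> \<beta> u (v \<otimes> w) = \<beta> u v + \<beta> u w"
  obtains c where "\<And>u v. u \<in> K \<Longrightarrow> v \<in> K \<Longrightarrow> c (u \<otimes> v) = c u + c v + \<beta> u v"
proof -
  interpret K: subgroup K G by fact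
  \<comment> \<open>A transversal of the right cosets of \<open>K\<close>, normalized to be trivial
    on \<open>K\<close> itself.\<close>
  define \<sigma> where "\<sigma> q = (if q \<in> K then \<one> else SOME s. s \<in> K #> q)" for q
  \<comment> \<open>Schreier's cocycle: right multiplication by \<open>f\<close> carries the coset
    of \<open>q\<close> to that of \<open>q \<otimes> f\<close>, and \<open>h q f\<close> is the
    element of \<open>K\<close> by which the representatives differ.\<close>
  define h where "h q f = \<sigma> q \<otimes> f \<otimes> inv \<sigma> (q \<otimes> f)" for q f
  have \<sigma>: "\<sigma> q \<in> K #> q" if q: "q \<in> carrier G" for q
  proof (cases "q \<in> K")
    case True
    then show ?thesis using coset_join2[OF q K] by (simp add: \<sigma>_def)
  next
    case False
    then show ?thesis using someI[of "\<lambda>s. s \<in> K #> q", OF rcos_self[OF q K]] by (simp add: \<sigma>_def)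
  qed
  have \<sigma>c: "\<sigma> q \<in> carrier G" if "q \<in> carrier G" for q
    using \<sigma>[OF that] K.elemrcos_carrier[OF group_axioms that] by blast
  have \<sigma>K: "\<sigma> (k \<otimes> q) = \<sigma> q" if k: "k \<in> K" and q: "q \<in> carrier G" for k q
  proof -
    have "K #> (k \<otimes> q) = K #> q"
      using coset_mult_assoc[of K k q] coset_join2[of k K] K k q K.subset by auto
    moreover have "k \<otimes> q \<in> K \<longleftrightarrow> q \<in> K"
    proof
      assume "k \<otimes> q \<in> K"
      then have "inv k \<otimes> (k \<otimes> q) \<in> K" using k by blast
      then show "q \<in> K" using k q by (simp add: word_simps)
    qed (use k in blast)
    ultimately show ?thesis by (simp add: \<sigma>_def)
  qed
  have h: "h q f \<in> K" if q: "q \<in> carrier G" and f: "f \<in> carrier G" for q f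
  proof -
    from \<sigma>[OF q] obtain k where k: "k \<in> K" "\<sigma> q = k \<otimes> q" by (auto simp: r_coset_def)
    from \<sigma>[of "q \<otimes> f"] q f obtain l where l: "l \<in> K" "\<sigma> (q \<otimes> f) = l \<otimes> (q \<otimes> f)" by (auto simp: r_coset_def)
    have "h q f = k \<otimes> inv l" using k l q f by (simp add: h_def word_simps)
    then show ?thesis using k l by simp
  qed
  have h_mult: "h q (f \<otimes> g) = h q f \<otimes> h (q \<otimes> f) g"
    if "q \<in> carrier G" "f \<in> carrier G" "g \<in> carrier G" for q f g
    using that by (simp add: h_def word_simps \<sigma>c)
  have h_one: "h q \<one> = \<one>" if "q \<in> carrier G" for q
    using that by (simp add: h_def \<sigma>c)
  have hK: "h (k \<otimes> q) f = h q f" if "k \<in> K" "q \<in> carrier G" "f \<in> carrier G" for k q f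
    using that by (simp add: h_def \<sigma>K m_assoc)
  have \<beta>1: "\<beta> \<one> u = 0" if "u \<in> K" for u using left[of \<one> \<one> u] that by simp
  have \<beta>2: "\<beta> u \<one> = 0" if "u \<in> K" for u using right[of u \<one> \<one>] that by simp
  \<comment> \<open>Functions on the right cosets of \<open>K\<close>, the coinduced module; the
    value 0 off the carrier makes equality of functions extensional.\<close>
  define I where "I = {C :: 'a \<Rightarrow> 'c. (\<forall>q. q \<notin> carrier G \<longrightarrow> C q = 0) \<and>
    (\<forall>k\<in>K. \<forall>q\<in>carrier G. C (k \<otimes> q) = C q)}"
  \<comment> \<open>The extension of \<open>G\<close> by this module, on which \<open>G\<close> acts
    by right translation, with \<open>\<beta>\<close> transported along \<open>h\<close>.
    Associativity comes from \<open>h_mult\<close> and the biadditivity of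
    \<open>\<beta>\<close>.\<close>
  define tm where "tm = (\<lambda>(f, C) (g, D). (f \<otimes> g,
    \<lambda>q. if q \<in> carrier G then C q + D (q \<otimes> f) + \<beta> (h q f) (h (q \<otimes> f) g) else 0))"
  define W where "W = \<lparr>carrier = carrier G \<times> I, monoid.mult = tm, one = (\<one>, \<lambda>_. 0)\<rparr>"
  have W: "group W"
  proof (rule groupI)
    fix x y assume "x \<in> carrier W" "y \<in> carrier W"
    then show "x \<otimes>\<^bsub>W\<^esub> y \<in> carrier W"
      by (auto simp: W_def tm_def I_def hK m_assoc)
  next
    fix x y z assume "x \<in> carrier W" "y \<in> carrier W" "z \<in> carrier W"
    then obtain f C g D e E where [simp]: "x = (f, C)" "y = (g, D)" "z = (e, E)"
      and "f \<in> carrier G" "g \<in> carrier G" "e \<in> carrier G" by (auto simp: W_def)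
    then show "x \<otimes>\<^bsub>W\<^esub> y \<otimes>\<^bsub>W\<^esub> z = x \<otimes>\<^bsub>W\<^esub> (y \<otimes>\<^bsub>W\<^esub> z)"
      by (auto simp: W_def tm_def m_assoc h_mult left right h fun_eq_iff)
  next
    fix x assume "x \<in> carrier W"
    then show "\<one>\<^bsub>W\<^esub> \<otimes>\<^bsub>W\<^esub> x = x"
      by (auto simp: W_def tm_def I_def h_one \<beta>1 h fun_eq_iff)
  next
    fix x assume "x \<in> carrier W"
    then obtain f C where [simp]: "x = (f, C)" and f: "f \<in> carrier G" and C: "C \<in> I" by (auto simp: W_def)
    define D where "D q = (if q \<in> carrier G then - C (q \<otimes> inv f) - \<beta> (h q (inv f)) (h (q \<otimes> inv f) f) else 0)" for q
    have "D \<in> I" using C f by (auto simp: D_def I_def hK m_assoc)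
    then have "(inv f, D) \<in> carrier W" using f by (simp add: W_def)
    moreover have "(inv f, D) \<otimes>\<^bsub>W\<^esub> x = \<one>\<^bsub>W\<^esub>"
      using f by (auto simp: W_def tm_def D_def fun_eq_iff)
    ultimately show "\<exists>y\<in>carrier W. y \<otimes>\<^bsub>W\<^esub> x = \<one>\<^bsub>W\<^esub>" by blast
  qed (auto simp: W_def I_def)
  have "(\<lambda>x. (x, \<lambda>_. 0)) \<in> X \<rightarrow> carrier W"
    using free by (auto simp: free_on_def W_def I_def)
  from free_on_extend[OF free W this] obtain H
    where H: "H \<in> hom G W" and HX: "\<And>x. x \<in> X \<Longrightarrow> H x = (x, \<lambda>_. 0)" by blast
  interpret H: group_hom G W H by (intro group_hom.intro group_hom_axioms.intro group_axioms W H)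
  \<comment> \<open>The first component of \<open>H\<close> is multiplicative and fixes the free
    generators.\<close>
  have fstH: "fst (H g) = g" if "g \<in> carrier G" for g
  proof -
    have "subgroup {g \<in> carrier G. fst (H g) = g} G"
    proof (rule subgroupI)
      have mult: "fst (a \<otimes>\<^bsub>W\<^esub> b) = fst a \<otimes> fst b" for a b
        by (simp add: W_def tm_def split: prod.split)
      fix a assume a: "a \<in> {g \<in> carrier G. fst (H g) = g}"
      have "fst (H (inv a)) \<otimes> a = \<one>"
        using a mult[of "H (inv a)" "H a"] H.hom_mult[of "inv a" a] H.hom_one
        by (simp add: W_def)
      moreover have "fst (H (inv a)) \<in> carrier G" using H.hom_closed[of "inv a"] a by (auto simp: W_def)
      ultimately have "fst (H (inv a)) = inv a"
        using a inv_equality[of "fst (H (inv a))" a] by (metis (mono_tags, lifting) mem_Collect_eq)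
      then show "inv a \<in> {g \<in> carrier G. fst (H g) = g}" using a by simp
      fix b assume "b \<in> {g \<in> carrier G. fst (H g) = g}"
      then show "a \<otimes> b \<in> {g \<in> carrier G. fst (H g) = g}" using a mult by simp
    qed (auto intro!: exI[of _ \<one>] simp: W_def H.hom_one)
    moreover have "X \<subseteq> {g \<in> carrier G. fst (H g) = g}"
      using HX free by (auto simp: free_on_def)
    ultimately have "generate G X \<subseteq> {g \<in> carrier G. fst (H g) = g}" by (rule generate_subgroup_incl[rotated])
    then show ?thesis using that free_on_generate[OF free] by blast
  qed
  \<comment> \<open>Evaluation at the trivial coset returns from the coinduced module to
    \<open>K\<close>: there \<open>h \<one> u = u\<close> and \<open>h u v = v\<close>, and
    invariance turns the translated value \<open>D u\<close> into \<open>D \<one>\<close>.\<close>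
  define c where "c u = snd (H u) \<one>" for u
  have "c (u \<otimes> v) = c u + c v + \<beta> u v" if u: "u \<in> K" and v: "v \<in> K" for u v
  proof -
    have car: "u \<in> carrier G" "v \<in> carrier G" using u v by auto
    obtain C D where CD: "H u = (u, C)" "H v = (v, D)"
      using fstH[OF car(1)] fstH[OF car(2)] by (metis prod.collapse)
    have "D \<in> I" using H.hom_closed[OF car(2)] CD by (simp add: W_def)
    then have "D (u \<otimes> \<one>) = D \<one>" using u unfolding I_def by blast
    then have "D u = D \<one>" using car by simp
    moreover have "h \<one> u = u" "h u v = v" using u v car by (simp_all add: h_def \<sigma>_def)
    ultimately show ?thesis
      using H.hom_mult[OF car] CD car by (simp add: c_def W_def tm_def)
  qed
  then show thesis using that by blast
qed

end

section \<open>The Magnus expansion\<close>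

text \<open>A function \<open>nat list \<Rightarrow> int\<close> is read as a formal power series in noncommuting variables.\<close>

definition conv :: "(nat list \<Rightarrow> int) \<Rightarrow> (nat list \<Rightarrow> int) \<Rightarrow> nat list \<Rightarrow> int" where
  "conv p q w = (\<Sum>i\<le>length w. p (take i w) * q (drop i w))"

lemma conv_Nil [simp]: "conv p q [] = p [] * q []"
  by (simp add: conv_def)

lemma conv_Cons: "conv p q (a # w) = p [] * q (a # w) + conv (\<lambda>u. p (a # u)) q w"
  unfolding conv_def by (simp add: sum.atMost_Suc_shift del: sum.atMost_Suc)

lemma conv_add_left: "conv (\<lambda>u. p u + q u) r w = conv p r w + conv q r w"
  by (simp add: conv_def algebra_simps sum.distrib)

lemma conv_scale_left: "conv (\<lambda>u. c * p u) r w = c * conv p r w"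
  by (simp add: conv_def algebra_simps sum_distrib_left)

lemma conv_assoc: "conv (conv p q) r w = conv p (conv q r) w"
proof (induction w arbitrary: p)
  case (Cons a w)
  have "(\<lambda>u. conv p q (a # u)) = (\<lambda>u. p [] * q (a # u) + conv (\<lambda>v. p (a # v)) q u)"
    by (simp add: conv_Cons)
  then show ?case
    by (simp add: conv_Cons Cons conv_add_left conv_scale_left algebra_simps)
qed (simp add: mult.assoc)

definition series_one :: "nat list \<Rightarrow> int" where
  "series_one w = (if w = [] then 1 else 0)"

lemma conv_one_left: "conv series_one p w = p w"
proof (cases w)
  case (Cons a v)
  have "conv (\<lambda>u. series_one (a # u)) p v = 0" by (simp add: conv_def series_one_def)
  then show ?thesis using Cons by (simp add: conv_Cons series_one_def)
qed (simp add: series_one_def)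

text \<open>The recursion solves \<open>conv (series_inv p) p = series_one\<close> for the
  coefficient at \<open>w\<close> when \<open>p\<close> has constant term 1.\<close>

function series_inv :: "(nat list \<Rightarrow> int) \<Rightarrow> nat list \<Rightarrow> int" where
  "series_inv p w = (if w = [] then 1 else - (\<Sum>i<length w. series_inv p (take i w) * p (drop i w)))"
  by auto
termination by (relation "measure (\<lambda>(p, w). length w)") auto

declare series_inv.simps [simp del]

definition magnus_group :: "(nat list \<Rightarrow> int) monoid" where
  "magnus_group = \<lparr>carrier = {p. p [] = 1}, monoid.mult = conv, one = series_one\<rparr>"

lemma magnus_group_simps [simp]:
  "p \<in> carrier magnus_group \<longleftrightarrow> p [] = 1"
  "p \<otimes>\<^bsub>magnus_group\<^esub> q = conv p q"
  "\<one>\<^bsub>magnus_group\<^esub> = series_one"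
  by (simp_all add: magnus_group_def)

lemma group_magnus_group: "group magnus_group"
proof (rule groupI)
  fix p assume p: "p \<in> carrier magnus_group"
  have "conv (series_inv p) p w = series_one w" for w
  proof (cases "w = []")
    case False
    then have "conv (series_inv p) p w = (\<Sum>i<length w. series_inv p (take i w) * p (drop i w)) + series_inv p w"
      using p by (simp add: conv_def flip: lessThan_Suc_atMost)
    then show ?thesis using False by (subst (asm) (2) series_inv.simps) (simp add: series_one_def)
  qed (use p in \<open>simp add: series_one_def series_inv.simps\<close>)
  then show "\<exists>q\<in>carrier magnus_group. q \<otimes>\<^bsub>magnus_group\<^esub> p = \<one>\<^bsub>magnus_group\<^esub>"
    by (intro bexI[of _ "series_inv p"]) (auto simp: series_inv.simps)
qed (auto simp: conv_assoc conv_one_left series_one_def fun_eq_iff)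

text \<open>The empty word is exempt because elements of the Magnus group have constant term
  1.\<close>

definition vanishes_below :: "nat \<Rightarrow> (nat list \<Rightarrow> int) \<Rightarrow> bool" where
  "vanishes_below n p \<longleftrightarrow> (\<forall>w. w \<noteq> [] \<longrightarrow> length w < n \<longrightarrow> p w = 0)"

lemma vanishes_below_one: "vanishes_below (Suc 0) p"
  by (simp add: vanishes_below_def)

lemma conv_low:
  assumes "p [] = 1" "q [] = 1" and p: "vanishes_below i p" and q: "vanishes_below j q"
    and w: "w \<noteq> []" "length w < i + j"
  shows "conv p q w = p w + q w"
proof -
  have "conv p q w = (\<Sum>k\<in>{0, length w}. p (take k w) * q (drop k w))"
    unfolding conv_def
  proof (rule sum.mono_neutral_right)
    show "\<forall>k\<in>{..length w} - {0, length w}. p (take k w) * q (drop k w) = 0"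
    proof
      fix k assume k: "k \<in> {..length w} - {0, length w}"
      then have "k < i \<or> length w - k < j" using w by auto
      then show "p (take k w) * q (drop k w) = 0"
        using p q k w by (auto simp: vanishes_below_def)
    qed
  qed auto
  also have "\<dots> = p w + q w" using assms by (simp add: add.commute)
  finally show ?thesis .
qed

text \<open>A cut of \<open>w\<close> into nonempty parts contributes only if the parts have lengths
  at least \<open>i\<close> and at least \<open>j\<close>; in total degree \<open>i + j\<close> a
  single cut remains.\<close>

lemma conv_first:
  assumes "p [] = 1" "q [] = 1" and p: "vanishes_below i p" and q: "vanishes_below j q"
    and w: "length w = i + j" "0 < i" "0 < j"
  shows "conv p q w = p w + q w + p (take i w) * q (drop i w)"
proof -
  have "w \<noteq> []" using w by auto
  have "conv p q w = (\<Sum>k\<in>{0, i, length w}. p (take k w) * q (drop k w))"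
    unfolding conv_def
  proof (rule sum.mono_neutral_right)
    show "\<forall>k\<in>{..length w} - {0, i, length w}. p (take k w) * q (drop k w) = 0"
    proof
      fix k assume k: "k \<in> {..length w} - {0, i, length w}"
      then have "k < i \<or> length w - k < j" using w by auto
      then show "p (take k w) * q (drop k w) = 0"
        using p q k \<open>w \<noteq> []\<close> by (auto simp: vanishes_below_def)
    qed
  qed (use w in auto)
  also have "\<dots> = p w + q w + p (take i w) * q (drop i w)" using assms by simp
  finally show ?thesis .
qed

text \<open>The hypothesis says that \<open>r\<close> is the commutator of \<open>p\<close> and \<open>q\<close>.\<close>

lemma commutator_series:
  assumes one: "p [] = 1" "q [] = 1" "r [] = 1" and p: "vanishes_below i p" and q: "vanishes_below j q"
    and r: "conv p q = conv (conv q p) r" and ij: "0 < i" "0 < j"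
  shows "vanishes_below (i + j) r"
    and "length w = i + j \<Longrightarrow> r w = p (take i w) * q (drop i w) - q (take j w) * p (drop j w)"
proof -
  have qp: "conv q p [] = 1" using one by simp
  \<comment> \<open>For \<open>conv q p\<close> only the trivial bound 1 is used, so a mixed term
    would have degree at least \<open>n + 1\<close>.\<close>
  have low: "conv p q w = conv q p w + r w" if "vanishes_below n r" "w \<noteq> []" "length w = n" for n w
    unfolding r by (rule conv_low[where i = "Suc 0" and j = n]) (use that qp one(3) vanishes_below_one in auto)
  have "r w = 0" if "w \<noteq> []" "length w < i + j" for w
    using that
  proof (induction "length w" arbitrary: w rule: less_induct)
    case less
    have "vanishes_below (length w) r"
      unfolding vanishes_below_def using less by auto
    from low[OF this less.prems(1) refl] show ?case
      using conv_low[OF one(1,2) p q less.prems] conv_low[OF one(2,1) q p] less.prems by simp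
  qed
  then show *: "vanishes_below (i + j) r" by (auto simp: vanishes_below_def)
  assume w: "length w = i + j"
  then have "w \<noteq> []" using ij by auto
  from low[OF * this w] show "r w = p (take i w) * q (drop i w) - q (take j w) * p (drop j w)"
    using conv_first[OF one(1,2) p q w ij] conv_first[OF one(2,1) q p _ ij(2,1)] w by simp
qed

text \<open>\<open>M\<close> is an arbitrary homomorphism, not the classical one sending each free
  generator to 1 plus its own variable: the variables will stand for the cyclic summands of the
  quotient by \<open>R\<close>.\<close>

locale magnus_hom = group G for G (structure) +
  fixes M :: "'a \<Rightarrow> nat list \<Rightarrow> int"
  assumes M_hom: "M \<in> hom G magnus_group"
begin

lemma M_Nil [simp]: "x \<in> carrier G \<Longrightarrow> M x [] = 1"
  using hom_in_carrier[OF M_hom, of x] by simp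

lemma M_mult: "x \<in> carrier G \<Longrightarrow> y \<in> carrier G \<Longrightarrow> M (x \<otimes> y) = conv (M x) (M y)"
  using hom_mult[OF M_hom, of x y] by simp

lemma M_one: "M \<one> = series_one"
  using hom_one[OF M_hom group_axioms group_magnus_group] by simp

lemma M_mult_low:
  assumes "x \<in> carrier G" "y \<in> carrier G" "vanishes_below i (M x)" "vanishes_below j (M y)"
    "w \<noteq> []" "length w < i + j"
  shows "M (x \<otimes> y) w = M x w + M y w"
  using conv_low[of "M x" "M y" i j w] assms by (simp add: M_mult)

lemma M_inv_low:
  assumes x: "x \<in> carrier G" "vanishes_below n (M x)" and w: "w \<noteq> []" "length w \<le> n"
  shows "M (inv x) w = - M x w"
  using w
proof (induction "length w" arbitrary: w rule: less_induct)
  case less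
  have v: "vanishes_below (length w) (M (inv x))"
    unfolding vanishes_below_def
  proof (intro allI impI)
    fix v :: "nat list" assume "v \<noteq> []" "length v < length w"
    then show "M (inv x) v = 0" using less.hyps[of v] less.prems x(2) by (simp add: vanishes_below_def)
  qed
  have "0 < n" using less.prems by (cases n) auto
  then have "M (x \<otimes> inv x) w = M x w + M (inv x) w"
    using x less.prems by (intro M_mult_low[OF _ _ x(2) v]) auto
  then show ?case using x less.prems by (simp add: M_one series_one_def)
qed

lemma subgroup_vanishes_below: "subgroup {x \<in> carrier G. vanishes_below n (M x)} G" (is "subgroup ?H G")
proof (rule subgroupI)
  show "?H \<noteq> {}"
    by (auto intro!: exI[of _ \<one>] simp: M_one series_one_def vanishes_below_def split: if_splits)
  fix x assume x: "x \<in> ?H"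
  then show "inv x \<in> ?H"
    using M_inv_low[of x n] by (simp add: vanishes_below_def)
  fix y assume y: "y \<in> ?H"
  have "M (x \<otimes> y) w = 0" if "w \<noteq> []" "length w < n" for w
    using x y that M_mult_low[of x y n n w] by (auto simp: vanishes_below_def)
  then show "x \<otimes> y \<in> ?H"
    using x y by (simp add: vanishes_below_def)
qed auto

lemma M_comm:
  assumes x: "x \<in> carrier G" "vanishes_below i (M x)" and y: "y \<in> carrier G" "vanishes_below j (M y)"
    and ij: "0 < i" "0 < j"
  shows "vanishes_below (i + j) (M (comm x y))"
    and "length w = i + j \<Longrightarrow>
      M (comm x y) w = M x (take i w) * M y (drop i w) - M y (take j w) * M x (drop j w)"
proof -
  have "M (x \<otimes> y) = M (y \<otimes> x \<otimes> comm x y)"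
    by (rule arg_cong[OF mult_eq_comm[OF x(1) y(1)]])
  then have "conv (M x) (M y) = conv (conv (M y) (M x)) (M (comm x y))"
    using x y by (simp add: M_mult)
  from commutator_series[OF _ _ _ x(2) y(2) this ij] x y
  show "vanishes_below (i + j) (M (comm x y))"
    "length w = i + j \<Longrightarrow>
      M (comm x y) w = M x (take i w) * M y (drop i w) - M y (take j w) * M x (drop j w)"
    by simp_all
qed

lemma vanishes_below_lcs: "x \<in> lcs n \<Longrightarrow> vanishes_below n (M x)"
proof (induction n arbitrary: x)
  case 0
  then show ?case by (simp add: vanishes_below_def)
next
  case (Suc n)
  show ?case
  proof (cases n)
    case 0
    then show ?thesis by (simp add: vanishes_below_one)
  next
    case (Suc m)
    have "comm_subgroup (lcs n) (carrier G) \<subseteq> {x \<in> carrier G. vanishes_below (Suc n) (M x)}"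
    proof (rule comm_subgroup_subset[OF subgroup_vanishes_below])
      fix x g assume x: "x \<in> lcs n" and g: "g \<in> carrier G"
      have "x \<in> carrier G" using normal_carrier[OF rel_lcs_normal[OF normal_self] x] .
      then show "comm x g \<in> {x \<in> carrier G. vanishes_below (Suc n) (M x)}"
        using M_comm(1)[OF _ Suc.IH[OF x] g vanishes_below_one] g Suc by simp
    qed
    then show ?thesis using Suc.prems Suc by auto
  qed
qed

lemma lcs_carrier: "x \<in> lcs n \<Longrightarrow> x \<in> carrier G"
  by (rule normal_carrier[OF rel_lcs_normal[OF normal_self]])

lemma M_lcs_mult:
  assumes "x \<in> lcs n" "y \<in> lcs n" "w \<noteq> []" "length w < 2 * n"
  shows "M (x \<otimes> y) w = M x w + M y w"
  using assms by (intro M_mult_low[of _ _ n n]) (auto intro: vanishes_below_lcs lcs_carrier)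

lemma M_lcs_comm:
  assumes "x \<in> lcs i" "y \<in> lcs j" "0 < i" "0 < j" "length w = i + j"
  shows "M (comm x y) w = M x (take i w) * M y (drop i w) - M y (take j w) * M x (drop j w)"
  using assms by (intro M_comm(2)) (auto intro: vanishes_below_lcs lcs_carrier)

end

section \<open>Coefficients modulo the orders of the letters\<close>

lemma append_le_append:
  fixes u x :: "'b :: linorder list"
  shows "u \<le> x \<Longrightarrow> v \<le> y \<Longrightarrow> length x = length u \<Longrightarrow> u @ v \<le> x @ y"
  using append_less_append_eq_length[of u x v y] by (cases "u = x") (auto simp: order_le_less)

text \<open>The order of the tensor product of the cyclic groups attached to the letters of
  \<open>w\<close>, with 0 for infinite order.\<close>

definition modulus :: "(nat \<Rightarrow> nat) \<Rightarrow> nat list \<Rightarrow> int" where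
  "modulus m w = int (Gcd (m ` set w))"

lemma modulus_dvd: "set u \<subseteq> set w \<Longrightarrow> modulus m w dvd modulus m u"
  unfolding modulus_def by (auto intro!: Gcd_greatest intro: Gcd_dvd)

lemma modulus_cong: "set u = set w \<Longrightarrow> modulus m u = modulus m w"
  by (simp add: modulus_def)

lemma modulus_singleton [simp]: "modulus m [i] = int (m i)"
  by (simp add: modulus_def)

lemma modulus_dvd_mult_left: "modulus m (take i w) dvd x \<Longrightarrow> modulus m w dvd x * y"
  by (meson dvd_mult2 dvd_trans modulus_dvd set_take_subset)

lemma modulus_dvd_mult_right: "modulus m (drop i w) dvd y \<Longrightarrow> modulus m w dvd x * y"
  by (meson dvd_mult dvd_trans modulus_dvd set_drop_subset)

lemma modulus_dvd_mult_cong: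
  assumes "modulus m (take k w) dvd a' - a" "modulus m (drop k w) dvd b' - b"
  shows "modulus m w dvd a' * b' - a * b"
proof -
  have "a' * b' - a * b = (a' - a) * b' + a * (b' - b)" by (simp add: algebra_simps)
  then show ?thesis using assms
    by (metis dvd_add modulus_dvd_mult_left modulus_dvd_mult_right)
qed

locale magnus_mod = magnus_hom + abelian_quotient +
  fixes m :: "nat \<Rightarrow> nat"
  assumes M_R: "r \<in> R \<Longrightarrow> int (m i) dvd M r [i]"
begin

text \<open>In its lowest degree a left-normed commutator expands multilinearly in the linear
  coefficients of its entries. Changing these modulo the orders of the letters changes the
  coefficient at \<open>w\<close> only modulo \<open>modulus m w\<close>.\<close>

lemma M_foldl_comm_cong:
  assumes "x \<in> carrier G" "x' \<in> carrier G" "set xs \<subseteq> carrier G" "set xs' \<subseteq> carrier G"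
    and "\<And>i. int (m i) dvd M x' [i] - M x [i]"
    and "list_all2 (\<lambda>g g'. \<forall>i. int (m i) dvd M g' [i] - M g [i]) xs xs'"
    and "length w = Suc (length xs)"
  shows "modulus m w dvd M (foldl comm x' xs') w - M (foldl comm x xs) w"
  using assms(6,3,4,7)
proof (induction xs arbitrary: xs' w rule: rev_induct)
  case Nil
  then obtain i where "w = [i]" by (cases w; cases "tl w") auto
  then show ?case using assms(5) Nil by simp
next
  case (snoc g xs)
  then obtain g' ys where xs': "xs' = ys @ [g']" and l: "list_all2 (\<lambda>g g'. \<forall>i. int (m i) dvd M g' [i] - M g [i]) xs ys"
    and g: "\<forall>i. int (m i) dvd M g' [i] - M g [i]"
    by (auto simp: list_all2_append1 list_all2_Cons1)
  have len: "length ys = length xs" using l by (simp add: list_all2_lengthD)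
  let ?n = "Suc (length xs)"
  define p p' where pp: "p = foldl comm x xs" "p' = foldl comm x' ys"
  have p: "p \<in> lcs ?n" "p' \<in> lcs ?n"
    using foldl_comm_lcs[of x xs] foldl_comm_lcs[of x' ys] snoc.prems assms(1,2) xs' len by (auto simp: pp)
  have gg: "g \<in> lcs 1" "g' \<in> lcs 1" using snoc.prems xs' by auto
  have w: "length w = ?n + 1" using snoc.prems by simp
  have IH: "modulus m v dvd M p' v - M p v" if "length v = ?n" for v
    using snoc.IH[OF l _ _ that] snoc.prems xs' by (simp add: pp)
  have IHg: "modulus m v dvd M g' v - M g v" if "length v = 1" for v
    using that g by (cases v; cases "tl v") auto
  have e: "M (comm p g) w = M p (take ?n w) * M g (drop ?n w) - M g (take 1 w) * M p (drop 1 w)"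
    by (rule M_lcs_comm) (use p gg w in auto)
  have e': "M (comm p' g') w = M p' (take ?n w) * M g' (drop ?n w) - M g' (take 1 w) * M p' (drop 1 w)"
    by (rule M_lcs_comm) (use p gg w in auto)
  have "modulus m w dvd (M p' (take ?n w) * M g' (drop ?n w) - M p (take ?n w) * M g (drop ?n w))
      - (M g' (take 1 w) * M p' (drop 1 w) - M g (take 1 w) * M p (drop 1 w))"
    by (intro dvd_diff[OF modulus_dvd_mult_cong[where k = ?n] modulus_dvd_mult_cong[where k = 1]] IH IHg) (use w in auto)
  also have "\<dots> = M (comm p' g') w - M (comm p g) w" by (simp only: e e' algebra_simps)
  finally show ?case by (simp add: xs' pp)
qed

end

locale magnus_generators = magnus_mod +
  fixes y :: "nat \<Rightarrow> 'a" and d :: nat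
  assumes y_carrier: "y i \<in> carrier G"
    and generate_y: "carrier G \<subseteq> generate G (y ` {..<d} \<union> R)"
    and M_y: "i < d \<Longrightarrow> int (m j) dvd M (y i) [j] - (if i = j then 1 else 0)"
begin

sublocale filtration_generators G lcs "rel_lcs R" y d
  by unfold_locales (use y_carrier generate_y in auto)

text \<open>Triangularity. Expand the bracket of w = u v as a Lie commutator: modulo the moduli,
  products of words at least u and at least v, of fixed lengths, are at least u v or at least v u,
  and v u > w because w is Lyndon. Only the set of letters is tracked, since it alone determines
  \<open>modulus\<close>.\<close>

lemma M_bracket:
  assumes "w \<in> lyndon_words n d"
  shows "length z = n \<longrightarrow> \<not> (set z = set w \<and> w \<le> z) \<longrightarrow> modulus m z dvd M (bracket w) z"
    and "modulus m w dvd M (bracket w) w - 1"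
proof -
  have "(\<forall>z. length z = n \<longrightarrow> \<not> (set z = set w \<and> w \<le> z) \<longrightarrow> modulus m z dvd M (bracket w) z)
      \<and> modulus m w dvd M (bracket w) w - 1"
    using assms
  proof (induction rule: lyndon_words_induct)
    case (letter i)
    have "modulus m z dvd M (bracket [i]) z"
      if z: "length z = 1" "\<not> (set z = set [i] \<and> [i] \<le> z)" for z
    proof -
      obtain j where "z = [j]" using z(1) by (cases z; cases "tl z") auto
      then show ?thesis using M_y[OF letter, of j] z(2) by auto
    qed
    then show ?case using M_y[OF letter, of i] by auto
  next
    case (split w i j)
    define u v where uv: "u = lyndon_prefix w" "v = min_suffix w"
    have lw: "length w = i + j" "lyndon w" "2 \<le> length w"
      using split.hyps by (auto simp: lyndon_words_def words_def)
    have u: "u \<in> lyndon_words i d" and v: "v \<in> lyndon_words j d" using split.hyps uv by auto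
    have w: "w = u @ v" using min_suffix(1)[OF lw(3)] uv by simp
    have lu: "length u = i" "length v = j" "0 < i" "0 < j" using u v
      by (auto simp: lyndon_words_def words_def lyndon_def)
    have wvu: "w < v @ u" using lw(2) lu lyndon_less_rotation[of u v] w by force
    have IHu: "modulus m z dvd M (bracket u) z" if "length z = i" "\<not> (set z = set u \<and> u \<le> z)" for z
      using split.IH(1) that by (simp add: uv)
    have IHv: "modulus m z dvd M (bracket v) z" if "length z = j" "\<not> (set z = set v \<and> v \<le> z)" for z
      using split.IH(2) that by (simp add: uv)
    have e: "M (bracket w) z = M (bracket u) (take i z) * M (bracket v) (drop i z)
        - M (bracket v) (take j z) * M (bracket u) (drop j z)" if "length z = i + j" for z
      unfolding lyndon_bracket_split[OF lw(3)] uv(1)[symmetric] uv(2)[symmetric]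
      by (rule M_lcs_comm[OF bracket_mem[OF u] bracket_mem[OF v]]) (use lu that in auto)
    have first: "modulus m z dvd M (bracket u) (take i z) * M (bracket v) (drop i z)"
      if z: "length z = i + j" "\<not> (set z = set w \<and> w \<le> z)" for z
    proof (rule ccontr)
      assume n: "\<not> ?thesis"
      have "set (take i z) = set u \<and> u \<le> take i z"
        using n IHu[of "take i z"] z(1) modulus_dvd_mult_left by fastforce
      moreover have "set (drop i z) = set v \<and> v \<le> drop i z"
        using n IHv[of "drop i z"] z(1) modulus_dvd_mult_right by fastforce
      moreover have "set z = set (take i z) \<union> set (drop i z)"
        by (metis append_take_drop_id set_append)
      moreover have "u @ v \<le> take i z @ drop i z"
        using calculation lu z(1) by (intro append_le_append) simp_all
      ultimately show False using z(2) w by (metis append_take_drop_id set_append)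
    qed
    \<comment> \<open>This product also disappears at \<open>z = w\<close>: its surviving words are
      at least \<open>v @ u\<close>, a rotation of the Lyndon word \<open>w\<close> and hence
      strictly larger. Thus the leading coefficient stays 1.\<close>
    have second: "modulus m z dvd M (bracket v) (take j z) * M (bracket u) (drop j z)"
      if z: "length z = i + j" "\<not> (set z = set w \<and> w < z)" for z
    proof (rule ccontr)
      assume n: "\<not> ?thesis"
      have "set (take j z) = set v \<and> v \<le> take j z"
        using n IHv[of "take j z"] z(1) modulus_dvd_mult_left by fastforce
      moreover have "set (drop j z) = set u \<and> u \<le> drop j z"
        using n IHu[of "drop j z"] z(1) modulus_dvd_mult_right by fastforce
      moreover have "set z = set (take j z) \<union> set (drop j z)"
        by (metis append_take_drop_id set_append)
      moreover have "v @ u \<le> take j z @ drop j z"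
        using calculation lu z(1) by (intro append_le_append) simp_all
      ultimately show False using z(2) w wvu
        by (metis Un_commute append_take_drop_id order_less_le_trans set_append)
    qed
    have "modulus m z dvd M (bracket w) z" if z: "length z = i + j" "\<not> (set z = set w \<and> w \<le> z)" for z
      unfolding e[OF z(1)] by (rule dvd_diff[OF first[OF z] second]) (use z in auto)
    moreover have "modulus m w dvd M (bracket w) w - 1"
    proof -
      define P Q where PQ: "P = M (bracket u) u" "Q = M (bracket v) v"
      have "modulus m w dvd modulus m u" "modulus m w dvd modulus m v"
        using w by (auto intro: modulus_dvd)
      moreover have "modulus m u dvd P - 1" "modulus m v dvd Q - 1" using split.IH by (auto simp: PQ uv)
      ultimately have "modulus m w dvd (P - 1) * Q + (Q - 1)"
        by (intro dvd_add dvd_mult2) (auto intro: dvd_trans)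
      then have "modulus m w dvd P * Q - 1" by (simp add: algebra_simps)
      moreover have "modulus m w dvd M (bracket v) (take j w) * M (bracket u) (drop j w)"
        by (rule second) (use lw in auto)
      ultimately have "modulus m w dvd (P * Q - 1) - M (bracket v) (take j w) * M (bracket u) (drop j w)"
        by (rule dvd_diff)
      moreover have "take i w = u" "drop i w = v" using w lu by auto
      then have "M (bracket w) w = P * Q - M (bracket v) (take j w) * M (bracket u) (drop j w)"
        using e[OF lw(1)] unfolding PQ by (simp only:)
      moreover have "P * Q - x - 1 = P * Q - 1 - x" for x by simp
      ultimately show ?thesis by (simp only:)
    qed
    ultimately show ?case by blast
  qed
  then show "length z = n \<longrightarrow> \<not> (set z = set w \<and> w \<le> z) \<longrightarrow> modulus m z dvd M (bracket w) z"
    and "modulus m w dvd M (bracket w) w - 1" by auto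
qed

end

section \<open>Outer commutator words\<close>

context group
begin

definition left_normed_values :: "'a set \<Rightarrow> nat \<Rightarrow> 'a set" where
  "left_normed_values R n = {foldl comm x xs | x xs. x \<in> R \<and> set xs \<subseteq> carrier G \<and> length xs = n}"

lemma foldl_comm_closed: "x \<in> carrier G \<Longrightarrow> set xs \<subseteq> carrier G \<Longrightarrow> foldl comm x xs \<in> carrier G"
  by (induction xs arbitrary: x) auto

lemma foldl_comm_one: "set xs \<subseteq> carrier G \<Longrightarrow> foldl comm \<one> xs = \<one>"
  by (induction xs) auto

lemma conj_foldl_comm:
  "x \<in> carrier G \<Longrightarrow> set xs \<subseteq> carrier G \<Longrightarrow> g \<in> carrier G \<Longrightarrow>
    g \<otimes> foldl comm x xs \<otimes> inv g = foldl comm (g \<otimes> x \<otimes> inv g) (map (\<lambda>z. g \<otimes> z \<otimes> inv g) xs)"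
  by (induction xs arbitrary: x) (simp_all add: conj_comm)

lemma left_normed_values_subset: "R \<lhd> G \<Longrightarrow> left_normed_values R n \<subseteq> carrier G"
  using normal_carrier foldl_comm_closed unfolding left_normed_values_def by fastforce

lemma normal_generate_left_normed_values:
  assumes R: "R \<lhd> G"
  shows "generate G (left_normed_values R n) \<lhd> G"
proof (rule normal_generateI[OF left_normed_values_subset[OF R]])
  fix h g assume h: "h \<in> left_normed_values R n" and g: "g \<in> carrier G"
  then obtain x xs where x: "h = foldl comm x xs" "x \<in> R" "set xs \<subseteq> carrier G" "length xs = n"
    by (auto simp: left_normed_values_def)
  have "g \<otimes> h \<otimes> inv g = foldl comm (g \<otimes> x \<otimes> inv g) (map (\<lambda>z. g \<otimes> z \<otimes> inv g) xs)"
    using x g normal_carrier[OF R] by (simp add: conj_foldl_comm)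
  moreover have "g \<otimes> x \<otimes> inv g \<in> R" by (rule normal.inv_op_closed2[OF R g x(2)])
  moreover have "set (map (\<lambda>z. g \<otimes> z \<otimes> inv g) xs) \<subseteq> carrier G" using g x(3) by auto
  moreover have "length (map (\<lambda>z. g \<otimes> z \<otimes> inv g) xs) = n" using x by simp
  ultimately show "g \<otimes> h \<otimes> inv g \<in> left_normed_values R n"
    unfolding left_normed_values_def by blast
qed

text \<open>Conjugation acts entrywise on left-normed commutators, so they generate a normal
  subgroup. It then suffices to commute a generator with an element of the group, which lengthens it
  by one entry.\<close>

lemma rel_lcs_Suc_subset_generate:
  assumes R: "R \<lhd> G"
  shows "rel_lcs R (Suc n) \<subseteq> generate G (left_normed_values R n)"
proof (induction n)
  case 0
  have "R \<subseteq> left_normed_values R 0" by (auto simp: left_normed_values_def)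
  then show ?case by (auto intro: generate.incl)
next
  case (Suc n)
  let ?N = "generate G (left_normed_values R (Suc n))"
  note N = normal_generate_left_normed_values[OF R, of "Suc n"]
  have "comm x g \<in> ?N" if x: "x \<in> rel_lcs R (Suc n)" and g: "g \<in> carrier G" for x g
  proof (rule comm_generate_left[OF N left_normed_values_subset[OF R] g])
    show "x \<in> generate G (left_normed_values R n)" using Suc.IH x by blast
    fix a assume "a \<in> left_normed_values R n"
    then obtain z zs where z: "a = foldl comm z zs" "z \<in> R" "set zs \<subseteq> carrier G" "length zs = n"
      by (auto simp: left_normed_values_def)
    then have "comm a g = foldl comm z (zs @ [g])" by simp
    then have "comm a g \<in> left_normed_values R (Suc n)"
      unfolding left_normed_values_def using z g by (intro CollectI exI[of _ z] exI[of _ "zs @ [g]"]) auto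
    then show "comm a g \<in> ?N" by (rule generate.incl)
  qed
  then show ?case using comm_subgroup_subset[OF normal_imp_subgroup[OF N]] by simp
qed

lemma eval_word_closed_UNIV: "f \<in> UNIV \<rightarrow> carrier G \<Longrightarrow> eval_word G f w \<in> carrier G"
  by (rule eval_word_closed[of w UNIV]) auto

lemma eval_word_append_UNIV:
  "f \<in> UNIV \<rightarrow> carrier G \<Longrightarrow> eval_word G f (u @ v) = eval_word G f u \<otimes> eval_word G f v"
  by (rule eval_word_append[of u UNIV]) auto

lemma eval_inv_word:
  assumes f: "f \<in> UNIV \<rightarrow> carrier G"
  shows "eval_word G f (inv_word w) = inv (eval_word G f w)"
proof (induction w)
  case Nil
  then show ?case by (simp add: inv_word_def)
next
  case (Cons a w)
  have c: "f (fst a) \<in> carrier G" "eval_word G f w \<in> carrier G" using f eval_word_closed_UNIV[OF f] by auto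
  have "eval_word G f (inv_word (a # w)) = eval_word G f (inv_word w) \<otimes> eval_word G f [inv_letter a]"
    unfolding inv_word_def by (simp add: eval_word_append_UNIV[OF f])
  then show ?case using Cons c by (auto simp: eval_word_Cons inv_letter_def inv_mult_group)
qed

lemma eval_comm_word:
  assumes "f \<in> UNIV \<rightarrow> carrier G"
  shows "eval_word G f (comm_word u v) = comm (eval_word G f u) (eval_word G f v)"
  using eval_word_closed_UNIV[OF assms]
  by (simp add: comm_word_def eval_word_append_UNIV[OF assms] eval_inv_word[OF assms] comm_def m_assoc)

lemma eval_left_normed:
  assumes f: "f \<in> UNIV \<rightarrow> carrier G"
  shows "eval_word G f (left_normed (x # xs)) = foldl comm (f x) (map f xs)"
proof -
  have "eval_word G f (foldl (\<lambda>u z. comm_word u [(z, True)]) u xs) = foldl comm (eval_word G f u) (map f xs)" for u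
    using f by (induction xs arbitrary: u) (auto simp: eval_comm_word eval_word_Cons Pi_iff)
  then show ?thesis using f by (simp add: eval_word_Cons Pi_iff)
qed

definition outer_value :: "nat \<Rightarrow> nat \<Rightarrow> (nat \<Rightarrow> 'a) \<Rightarrow> 'a" where
  "outer_value c1 c2 f =
     comm (foldl comm (f 0) (map f [1..<c1 + 1])) (foldl comm (f (c1 + 1)) (map f [c1 + 2..<c1 + c2 + 2]))"

lemma eval_outer_comm_word:
  assumes f: "f \<in> UNIV \<rightarrow> carrier G"
  shows "eval_word G f (outer_comm_word c1 c2) = outer_value c1 c2 f"
proof -
  have "[0..<c1 + 1] = 0 # [1..<c1 + 1]" "[c1 + 1..<c1 + c2 + 2] = (c1 + 1) # [c1 + 2..<c1 + c2 + 2]"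
    by (simp_all add: upt_conv_Cons)
  then show ?thesis
    unfolding outer_comm_word_def outer_value_def eval_comm_word[OF f] by (simp only: eval_left_normed[OF f])
qed

lemma outer_value_lists:
  assumes "length xs = c1" "length ys = c2" "x \<in> carrier G" "z \<in> carrier G"
    "set xs \<subseteq> carrier G" "set ys \<subseteq> carrier G"
  obtains f where "f \<in> UNIV \<rightarrow> carrier G" "f 0 = x" "map f [1..<c1 + 1] = xs" "f (c1 + 1) = z"
    "map f [c1 + 2..<c1 + c2 + 2] = ys"
proof
  define l where "l = (x # xs) @ (z # ys)"
  define f where "f i = (if i < length l then l ! i else \<one>)" for i
  have len: "length l = c1 + c2 + 2" using assms by (simp add: l_def)
  have lc: "set l \<subseteq> carrier G" using assms by (auto simp: l_def)
  have "f i \<in> carrier G" for i using lc nth_mem[of i l] by (auto simp: f_def)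
  then show "f \<in> UNIV \<rightarrow> carrier G" by simp
  show "f 0 = x" using len by (simp add: f_def) (simp add: l_def)
  show "f (c1 + 1) = z" using len assms by (simp add: f_def) (simp add: l_def nth_append)
  show "map f [1..<c1 + 1] = xs"
    using len assms by (intro nth_equalityI) (auto simp: f_def l_def nth_append nth_Cons' simp del: upt_Suc)
  show "map f [c1 + 2..<c1 + c2 + 2] = ys"
    using len assms by (intro nth_equalityI) (auto simp: f_def l_def nth_append nth_Cons' simp del: upt_Suc)
qed

lemma conj_outer_value:
  assumes f: "f \<in> UNIV \<rightarrow> carrier G" and g: "g \<in> carrier G"
  shows "g \<otimes> outer_value c1 c2 f \<otimes> inv g = outer_value c1 c2 (\<lambda>i. g \<otimes> f i \<otimes> inv g)"
proof -
  have "f ` A \<subseteq> carrier G" for A using f by auto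
  moreover have "f i \<in> carrier G" for i using f by auto
  ultimately show ?thesis
    unfolding outer_value_def using g
    by (simp add: conj_comm conj_foldl_comm foldl_comm_closed comp_def del: upt_Suc)
qed

lemma outer_value_lcs:
  "f \<in> UNIV \<rightarrow> carrier G \<Longrightarrow> foldl comm (f i) (map f l) \<in> lcs (Suc (length l))"
  using foldl_comm_lcs[of "f i" "map f l"] by (auto simp: Pi_iff)

lemma verbal_subgroup_outer_comm:
  "verbal_subgroup {outer_comm_word c1 c2} G = comm_subgroup (lcs (Suc c1)) (lcs (Suc c2))"
proof
  let ?A = "{eval_word G f v |v f. v \<in> {outer_comm_word c1 c2} \<and> f \<in> UNIV \<rightarrow> carrier G}"
  have A: "?A = {outer_value c1 c2 f | f. f \<in> UNIV \<rightarrow> carrier G}"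
    using eval_outer_comm_word by (metis (no_types, lifting) singleton_iff)
  have Ac: "?A \<subseteq> carrier G" using eval_word_closed_UNIV by auto
  have N: "generate G ?A \<lhd> G"
  proof (rule normal_generateI[OF Ac])
    fix h g assume "h \<in> ?A" and g: "g \<in> carrier G"
    then obtain f where f: "h = outer_value c1 c2 f" "f \<in> UNIV \<rightarrow> carrier G" unfolding A by auto
    have "(\<lambda>i. g \<otimes> f i \<otimes> inv g) \<in> UNIV \<rightarrow> carrier G" using f g by auto
    then show "g \<otimes> h \<otimes> inv g \<in> ?A" unfolding A f(1) conj_outer_value[OF f(2) g] by blast
  qed
  show "verbal_subgroup {outer_comm_word c1 c2} G \<subseteq> comm_subgroup (lcs (Suc c1)) (lcs (Suc c2))"
    unfolding verbal_subgroup_def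
  proof (rule generate_subgroup_incl)
    show "subgroup (comm_subgroup (lcs (Suc c1)) (lcs (Suc c2))) G"
      by (rule normal_imp_subgroup[OF normal_comm_subgroup[OF rel_lcs_normal rel_lcs_normal]])
        (rule normal_self)+
    show "?A \<subseteq> comm_subgroup (lcs (Suc c1)) (lcs (Suc c2))"
    proof
      fix h assume "h \<in> ?A"
      then obtain f where f: "h = outer_value c1 c2 f" "f \<in> UNIV \<rightarrow> carrier G" unfolding A by auto
      show "h \<in> comm_subgroup (lcs (Suc c1)) (lcs (Suc c2))"
        unfolding f(1) outer_value_def
        using outer_value_lcs[OF f(2), of 0 "[1..<c1 + 1]"] outer_value_lcs[OF f(2), of "c1 + 1" "[c1 + 2..<c1 + c2 + 2]"]
        by (intro comm_subgroup_mem) (simp_all del: upt_Suc)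
    qed
  qed
  show "comm_subgroup (lcs (Suc c1)) (lcs (Suc c2)) \<subseteq> verbal_subgroup {outer_comm_word c1 c2} G"
    unfolding verbal_subgroup_def
  proof (rule comm_subgroup_subset[OF normal_imp_subgroup[OF N]])
    fix p q assume p: "p \<in> lcs (Suc c1)" and q: "q \<in> lcs (Suc c2)"
    show "comm p q \<in> generate G ?A"
    proof (rule comm_generate[OF N left_normed_values_subset[OF normal_self] left_normed_values_subset[OF normal_self]])
      show "p \<in> generate G (left_normed_values (carrier G) c1)" "q \<in> generate G (left_normed_values (carrier G) c2)"
        using rel_lcs_Suc_subset_generate[OF normal_self] p q by blast+
      fix s u assume "s \<in> left_normed_values (carrier G) c1" "u \<in> left_normed_values (carrier G) c2"
      then obtain x xs z zs where l: "length xs = c1" "length zs = c2" "x \<in> carrier G" "z \<in> carrier G"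
        "set xs \<subseteq> carrier G" "set zs \<subseteq> carrier G" and su: "s = foldl comm x xs" "u = foldl comm z zs"
        by (auto simp: left_normed_values_def)
      from outer_value_lists[OF l] obtain f where "f \<in> UNIV \<rightarrow> carrier G" "comm s u = outer_value c1 c2 f"
        unfolding outer_value_def su by metis
      then show "comm s u \<in> generate G ?A" unfolding A by (auto intro: generate.incl)
    qed
  qed
qed

section \<open>The star subgroup of the outer commutator word\<close>

definition outer_star_gens :: "nat \<Rightarrow> nat \<Rightarrow> 'a set \<Rightarrow> 'a set" where
  "outer_star_gens c1 c2 R = {outer_value c1 c2 (f(i := f i \<otimes> r)) \<otimes> inv (outer_value c1 c2 f)
     | f i r. f \<in> UNIV \<rightarrow> carrier G \<and> r \<in> R}"

lemma fun_upd_carrier: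
  assumes "R \<lhd> G" "f \<in> UNIV \<rightarrow> carrier G" "r \<in> R"
  shows "f(i := f i \<otimes> r) \<in> UNIV \<rightarrow> carrier G"
  using assms(2) normal_carrier[OF assms(1,3)] by (auto simp: Pi_iff)

lemma star_subgroup_outer_comm:
  assumes R: "R \<lhd> G"
  shows "star_subgroup {outer_comm_word c1 c2} G R = generate G (outer_star_gens c1 c2 R)"
proof -
  have e: "eval_word G (f(i := f i \<otimes> r)) (outer_comm_word c1 c2) \<otimes> inv (eval_word G f (outer_comm_word c1 c2))
      = outer_value c1 c2 (f(i := f i \<otimes> r)) \<otimes> inv (outer_value c1 c2 f)"
    if "f \<in> UNIV \<rightarrow> carrier G" "r \<in> R" for f i r
    by (simp only: eval_outer_comm_word[OF that(1)] eval_outer_comm_word[OF fun_upd_carrier[OF R that]])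
  have "{eval_word G (f(i := f i \<otimes> r)) v \<otimes> inv (eval_word G f v) |v f i r.
      v \<in> {outer_comm_word c1 c2} \<and> f \<in> UNIV \<rightarrow> carrier G \<and> r \<in> R} = outer_star_gens c1 c2 R" (is "?L = ?R")
  proof (intro subset_antisym subsetI)
    fix x assume "x \<in> ?L"
    then obtain f i r where f: "f \<in> UNIV \<rightarrow> carrier G" "r \<in> R"
      "x = eval_word G (f(i := f i \<otimes> r)) (outer_comm_word c1 c2) \<otimes> inv (eval_word G f (outer_comm_word c1 c2))"
      by blast
    show "x \<in> ?R" unfolding outer_star_gens_def f(3) e[OF f(1,2)] using f(1,2) by blast
  next
    fix x assume "x \<in> ?R"
    then obtain f i r where f: "f \<in> UNIV \<rightarrow> carrier G" "r \<in> R"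
      "x = outer_value c1 c2 (f(i := f i \<otimes> r)) \<otimes> inv (outer_value c1 c2 f)"
      unfolding outer_star_gens_def by blast
    show "x \<in> ?L" unfolding f(3) e[OF f(1,2), symmetric] using f(1,2) by blast
  qed
  then show ?thesis unfolding star_subgroup_def by simp
qed

lemma outer_value_closed: "f \<in> UNIV \<rightarrow> carrier G \<Longrightarrow> outer_value c1 c2 f \<in> carrier G"
  using eval_outer_comm_word eval_word_closed_UNIV by metis

lemma outer_star_gens_carrier:
  assumes R: "R \<lhd> G"
  shows "outer_star_gens c1 c2 R \<subseteq> carrier G"
proof
  fix x assume "x \<in> outer_star_gens c1 c2 R"
  then obtain f i r where f: "f \<in> UNIV \<rightarrow> carrier G" "r \<in> R"
    "x = outer_value c1 c2 (f(i := f i \<otimes> r)) \<otimes> inv (outer_value c1 c2 f)"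
    unfolding outer_star_gens_def by blast
  show "x \<in> carrier G"
    unfolding f(3) by (intro m_closed inv_closed outer_value_closed fun_upd_carrier[OF R] f)
qed

lemma normal_star_subgroup_outer_comm:
  assumes R: "R \<lhd> G"
  shows "star_subgroup {outer_comm_word c1 c2} G R \<lhd> G"
  unfolding star_subgroup_outer_comm[OF R]
proof (rule normal_generateI[OF outer_star_gens_carrier[OF R]])
  fix h g assume "h \<in> outer_star_gens c1 c2 R" and g: "g \<in> carrier G"
  then obtain f i r where f: "f \<in> UNIV \<rightarrow> carrier G" and r: "r \<in> R"
    and h: "h = outer_value c1 c2 (f(i := f i \<otimes> r)) \<otimes> inv (outer_value c1 c2 f)"
    by (auto simp: outer_star_gens_def)
  note fr = fun_upd_carrier[OF R f r, of i]
  define f' r' where f'r': "f' = (\<lambda>j. g \<otimes> f j \<otimes> inv g)" "r' = g \<otimes> r \<otimes> inv g"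
  have r': "r' \<in> R" unfolding f'r' by (rule normal.inv_op_closed2[OF R g r])
  have f': "f' \<in> UNIV \<rightarrow> carrier G" using f g by (auto simp: f'r')
  have "(\<lambda>j. g \<otimes> (f(i := f i \<otimes> r)) j \<otimes> inv g) = f'(i := f' i \<otimes> r')"
    using f g normal_carrier[OF R r] by (auto simp: f'r' fun_eq_iff word_simps Pi_iff)
  moreover have "g \<otimes> (p \<otimes> inv q) \<otimes> inv g = (g \<otimes> p \<otimes> inv g) \<otimes> inv (g \<otimes> q \<otimes> inv g)"
    if "p \<in> carrier G" "q \<in> carrier G" for p q
    using that g by (simp add: word_simps)
  from this[OF outer_value_closed[OF fr] outer_value_closed[OF f]]
  have "g \<otimes> h \<otimes> inv g = outer_value c1 c2 (\<lambda>j. g \<otimes> (f(i := f i \<otimes> r)) j \<otimes> inv g) \<otimes> inv (outer_value c1 c2 f')"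
    unfolding h conj_outer_value[OF fr g] conj_outer_value[OF f g] f'r'(1) .
  ultimately have "g \<otimes> h \<otimes> inv g = outer_value c1 c2 (f'(i := f' i \<otimes> r')) \<otimes> inv (outer_value c1 c2 f')"
    by (simp only:)
  then show "g \<otimes> h \<otimes> inv g \<in> outer_star_gens c1 c2 R"
    unfolding outer_star_gens_def using r' f' by blast
qed

lemma star_subset_verbal_outer_comm:
  assumes R: "R \<lhd> G"
  shows "star_subgroup {outer_comm_word c1 c2} G R \<subseteq> verbal_subgroup {outer_comm_word c1 c2} G"
proof -
  let ?V = "verbal_subgroup {outer_comm_word c1 c2} G"
  have V: "subgroup ?V G"
    unfolding verbal_subgroup_def using eval_word_closed_UNIV by (intro generate_is_subgroup) auto
  have val: "outer_value c1 c2 f \<in> ?V" if "f \<in> UNIV \<rightarrow> carrier G" for f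
    unfolding verbal_subgroup_def eval_outer_comm_word[OF that, symmetric]
    by (rule generate.incl) (use that in blast)
  have "outer_star_gens c1 c2 R \<subseteq> ?V"
  proof
    fix x assume "x \<in> outer_star_gens c1 c2 R"
    then obtain f i r where f: "f \<in> UNIV \<rightarrow> carrier G" "r \<in> R"
      "x = outer_value c1 c2 (f(i := f i \<otimes> r)) \<otimes> inv (outer_value c1 c2 f)"
      unfolding outer_star_gens_def by blast
    show "x \<in> ?V"
      unfolding f(3)
      by (intro subgroup.m_closed[OF V] subgroup.m_inv_closed[OF V] val fun_upd_carrier[OF R] f)
  qed
  then show ?thesis unfolding star_subgroup_outer_comm[OF R] by (rule generate_subgroup_incl[OF _ V])
qed

text \<open>Give the first variable the value 1 and multiply it by an element of \<open>R\<close>: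
  the old value of the word is trivial, so the star generator is the commutator itself.\<close>

lemma comm_rel_lcs_star:
  assumes R: "R \<lhd> G" and p: "p \<in> rel_lcs R (Suc c1)" and q: "q \<in> lcs (Suc c2)"
  shows "comm p q \<in> star_subgroup {outer_comm_word c1 c2} G R"
proof (rule comm_generate[OF normal_star_subgroup_outer_comm[OF R] left_normed_values_subset[OF R]
      left_normed_values_subset[OF normal_self]])
  show "p \<in> generate G (left_normed_values R c1)" "q \<in> generate G (left_normed_values (carrier G) c2)"
    using rel_lcs_Suc_subset_generate[OF normal_self] rel_lcs_Suc_subset_generate[OF R] p q by blast+
  fix s u assume "s \<in> left_normed_values R c1" "u \<in> left_normed_values (carrier G) c2"
  then obtain x xs z zs where l: "length xs = c1" "length zs = c2" "z \<in> carrier G"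
    "set xs \<subseteq> carrier G" "set zs \<subseteq> carrier G" and x: "x \<in> R" and su: "s = foldl comm x xs" "u = foldl comm z zs"
    by (auto simp: left_normed_values_def)
  from outer_value_lists[OF l(1,2) one_closed l(3-5)] obtain f where
    f: "f \<in> UNIV \<rightarrow> carrier G" "f 0 = \<one>" "map f [1..<c1 + 1] = xs" "f (c1 + 1) = z"
      "map f [c1 + 2..<c1 + c2 + 2] = zs" by metis
  have xc: "x \<in> carrier G" by (rule normal_carrier[OF R x])
  let ?f = "f(0 := f 0 \<otimes> x)"
  have "map ?f [1..<c1 + 1] = xs" "map ?f [c1 + 2..<c1 + c2 + 2] = zs"
    using f(3,5) by (auto simp del: upt_Suc)
  then have "outer_value c1 c2 ?f = comm s u"
    unfolding outer_value_def su using f(2,4) xc by (simp del: upt_Suc)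
  moreover have "outer_value c1 c2 f = \<one>"
    unfolding outer_value_def f(2-5) using l by (simp add: foldl_comm_one foldl_comm_closed)
  moreover have "comm s u \<in> carrier G" using su xc l by (simp add: foldl_comm_closed)
  ultimately have "comm s u = outer_value c1 c2 ?f \<otimes> inv (outer_value c1 c2 f)" by simp
  then have "comm s u \<in> outer_star_gens c1 c2 R" unfolding outer_star_gens_def using f(1) x by blast
  then show "comm s u \<in> star_subgroup {outer_comm_word c1 c2} G R"
    unfolding star_subgroup_outer_comm[OF R] by (rule generate.incl)
qed

lemma comm_lcs_star:
  assumes R: "R \<lhd> G" and p: "p \<in> lcs (Suc c1)" and q: "q \<in> rel_lcs R (Suc c2)"
  shows "comm p q \<in> star_subgroup {outer_comm_word c1 c2} G R"
proof (rule comm_generate[OF normal_star_subgroup_outer_comm[OF R] left_normed_values_subset[OF normal_self]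
      left_normed_values_subset[OF R]])
  show "p \<in> generate G (left_normed_values (carrier G) c1)" "q \<in> generate G (left_normed_values R c2)"
    using rel_lcs_Suc_subset_generate[OF normal_self] rel_lcs_Suc_subset_generate[OF R] p q by blast+
  fix s u assume "s \<in> left_normed_values (carrier G) c1" "u \<in> left_normed_values R c2"
  then obtain x xs z zs where l: "length xs = c1" "length zs = c2" "x \<in> carrier G"
    "set xs \<subseteq> carrier G" "set zs \<subseteq> carrier G" and z: "z \<in> R" and su: "s = foldl comm x xs" "u = foldl comm z zs"
    by (auto simp: left_normed_values_def)
  from outer_value_lists[OF l(1,2) l(3) one_closed l(4-5)] obtain f where
    f: "f \<in> UNIV \<rightarrow> carrier G" "f 0 = x" "map f [1..<c1 + 1] = xs" "f (c1 + 1) = \<one>"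
      "map f [c1 + 2..<c1 + c2 + 2] = zs" by metis
  have zc: "z \<in> carrier G" by (rule normal_carrier[OF R z])
  \<comment> \<open>Variable \<open>c1 + 1\<close> opens the second block, so the element of
    \<open>R\<close> is now inserted there.\<close>
  let ?f = "f(c1 + 1 := f (c1 + 1) \<otimes> z)"
  have "map ?f [1..<c1 + 1] = xs" "map ?f [c1 + 2..<c1 + c2 + 2] = zs"
    using f(3,5) by (auto simp del: upt_Suc)
  then have "outer_value c1 c2 ?f = comm s u"
    unfolding outer_value_def su using f(2,4) zc by (simp del: upt_Suc)
  moreover have "outer_value c1 c2 f = \<one>"
    unfolding outer_value_def f(2-5) using l by (simp add: foldl_comm_one foldl_comm_closed)
  moreover have "comm s u \<in> carrier G" using su zc l by (simp add: foldl_comm_closed)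
  ultimately have "comm s u = outer_value c1 c2 ?f \<otimes> inv (outer_value c1 c2 f)" by simp
  then have "comm s u \<in> outer_star_gens c1 c2 R" unfolding outer_star_gens_def using f(1) z by blast
  then show "comm s u \<in> star_subgroup {outer_comm_word c1 c2} G R"
    unfolding star_subgroup_outer_comm[OF R] by (rule generate.incl)
qed

end

section \<open>Presentations of finitely generated abelian groups\<close>

text \<open>The common cover of the Baer invariant and of the target. It consists of all functions
  on the index type; coordinates outside the finite index set fall into the kernel.\<close>

definition int_functions :: "('j \<Rightarrow> int) monoid" where
  "int_functions = \<lparr>carrier = UNIV, monoid.mult = (\<lambda>f g j. f j + g j), one = (\<lambda>_. 0)\<rparr>"

lemma int_functions_simps [simp]:
  "carrier int_functions = UNIV" "f \<otimes>\<^bsub>int_functions\<^esub> g = (\<lambda>j. f j + g j)"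
  "\<one>\<^bsub>int_functions\<^esub> = (\<lambda>_. 0)"
  by (simp_all add: int_functions_def)

lemma group_int_functions: "group int_functions"
  by (rule groupI) (auto simp: fun_eq_iff add.assoc intro!: exI[of _ "\<lambda>j. - f j" for f])

lemma iso_of_same_kernel:
  assumes "group Z" "group Q" "group T" "p \<in> hom Z Q" "q \<in> hom Z T"
    "p ` carrier Z = carrier Q" "q ` carrier Z = carrier T" "kernel Z Q p = kernel Z T q"
  shows "Q \<cong> T"
proof -
  interpret p: group_hom Z Q p by (intro group_hom.intro group_hom_axioms.intro assms)
  interpret q: group_hom Z T q by (intro group_hom.intro group_hom_axioms.intro assms)
  have "Z Mod kernel Z Q p \<cong> Q" by (rule p.FactGroup_iso[OF assms(6)])
  then have "Q \<cong> Z Mod kernel Z Q p"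
    using group.iso_sym normal.factorgroup_is_group[OF p.normal_kernel] by blast
  also have "Z Mod kernel Z Q p \<cong> T" unfolding assms(8) by (rule q.FactGroup_iso[OF assms(7)])
  finally (iso_trans) show ?thesis .
qed

text \<open>The kernel is bounded from both sides: \<open>pow\<close> puts the multiples of the
  \<open>d j\<close> into it, and the additive test functions \<open>\<Phi>\<close>, divisible by
  \<open>mo\<close> on \<open>S\<close>, exclude everything else through
  \<open>indep\<close>.\<close>

lemma (in group) quotient_presentation:
  fixes e :: "'j \<Rightarrow> 'a" and \<Phi> :: "'a \<Rightarrow> 'w \<Rightarrow> int"
  assumes V: "subgroup V G" and S: "S \<lhd> G" and SV: "S \<subseteq> V"
    and comm: "\<And>x y. x \<in> V \<Longrightarrow> y \<in> V \<Longrightarrow> comm x y \<in> S"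
    and J: "finite J" and e: "\<And>j. j \<in> J \<Longrightarrow> e j \<in> V" and gen: "V \<subseteq> generate G (e ` J \<union> S)"
    and pow: "\<And>j. j \<in> J \<Longrightarrow> e j [^] (d j :: nat) \<in> S"
    and \<Phi>_mult: "\<And>x y w. x \<in> V \<Longrightarrow> y \<in> V \<Longrightarrow> w \<in> W \<Longrightarrow> \<Phi> (x \<otimes> y) w = \<Phi> x w + \<Phi> y w"
    and \<Phi>_S: "\<And>s w. s \<in> S \<Longrightarrow> w \<in> W \<Longrightarrow> mo w dvd \<Phi> s w"
    and indep: "\<And>z. (\<And>w. w \<in> W \<Longrightarrow> mo w dvd (\<Sum>j\<in>J. z j * \<Phi> (e j) w)) \<Longrightarrow> \<forall>j\<in>J. int (d j) dvd z j"
  shows "group (G\<lparr>carrier := V\<rparr> Mod S)"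
    and "\<exists>p \<in> hom int_functions (G\<lparr>carrier := V\<rparr> Mod S). p ` UNIV = carrier (G\<lparr>carrier := V\<rparr> Mod S) \<and>
      kernel int_functions (G\<lparr>carrier := V\<rparr> Mod S) p = {z. \<forall>j\<in>J. int (d j) dvd z j}"
proof -
  let ?H = "G\<lparr>carrier := V\<rparr>" and ?Q = "G\<lparr>carrier := V\<rparr> Mod S"
  interpret V: subgroup V G by fact
  interpret H: group ?H by (rule subgroup_imp_group[OF V])
  have SH: "S \<lhd> ?H" by (rule normal_restrict_supergroup[OF V S SV])
  interpret SH: normal S ?H by fact
  interpret S: normal S G by fact
  show gQ: "group ?Q" by (rule SH.factorgroup_is_group)
  interpret Q: group ?Q by (rule gQ)
  define q where "q x = S #>\<^bsub>?H\<^esub> x" for x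
  have q_hom: "q \<in> hom ?H ?Q" using SH.r_coset_hom_Mod by (simp add: q_def[abs_def])
  interpret q: group_hom ?H ?Q q by (intro group_hom.intro group_hom_axioms.intro H.group_axioms gQ q_hom)
  have q_surj: "\<exists>x\<in>V. X = q x" if "X \<in> carrier ?Q" for X
    using that by (auto simp: FactGroup_def RCOSETS_def q_def)
  have q_one: "q x = \<one>\<^bsub>?Q\<^esub> \<longleftrightarrow> x \<in> S" if "x \<in> V" for x
  proof
    assume "q x = \<one>\<^bsub>?Q\<^esub>"
    then have "S #>\<^bsub>?H\<^esub> x = S" by (simp add: q_def)
    then show "x \<in> S" using H.coset_join1[OF _ _ SH.subgroup_axioms] that by auto
  next
    assume "x \<in> S"
    then show "q x = \<one>\<^bsub>?Q\<^esub>"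
      using H.coset_join2[OF _ SH.subgroup_axioms] that by (simp add: q_def)
  qed
  have q_mult: "q (x \<otimes> y) = q x \<otimes>\<^bsub>?Q\<^esub> q y" if "x \<in> V" "y \<in> V" for x y
    using q.hom_mult[of x y] that by simp
  have qc: "q x \<in> carrier ?Q" if "x \<in> V" for x using q.hom_closed[of x] that by simp
  have cQ: "comm_group ?Q"
  proof (rule Q.group_comm_groupI)
    fix X Y assume "X \<in> carrier ?Q" "Y \<in> carrier ?Q"
    then obtain x y where xy: "x \<in> V" "y \<in> V" "X = q x" "Y = q y" using q_surj by metis
    have "comm x y \<in> V" using comm[OF xy(1,2)] SV by auto
    moreover have "q (comm x y) = \<one>\<^bsub>?Q\<^esub>" using q_one comm[OF xy(1,2)] calculation by blast
    moreover have "q (x \<otimes> y) = q (y \<otimes> x \<otimes> comm x y)"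
      by (rule arg_cong[OF mult_eq_comm]) (use xy in auto)
    ultimately show "X \<otimes>\<^bsub>?Q\<^esub> Y = Y \<otimes>\<^bsub>?Q\<^esub> X"
      using xy qc by (simp add: q_mult del: mult_FactGroup one_FactGroup)
  qed
  interpret Q: comm_group ?Q by (rule cQ)
  define p where "p z = finprod ?Q (\<lambda>j. q (e j) [^]\<^bsub>?Q\<^esub> (z j :: int)) J" for z
  have pc: "(\<lambda>j. q (e j) [^]\<^bsub>?Q\<^esub> (z j :: int)) \<in> J \<rightarrow> carrier ?Q" for z
    using qc e by (auto intro: Q.int_pow_closed)
  have p_hom: "p \<in> hom int_functions ?Q"
  proof (rule homI)
    fix z z' :: "'j \<Rightarrow> int"
    show "p z \<in> carrier ?Q" unfolding p_def by (rule Q.finprod_closed[OF pc])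
    have "p (\<lambda>j. z j + z' j) = finprod ?Q (\<lambda>j. q (e j) [^]\<^bsub>?Q\<^esub> (z j) \<otimes>\<^bsub>?Q\<^esub> q (e j) [^]\<^bsub>?Q\<^esub> (z' j)) J"
      unfolding p_def by (rule Q.finprod_cong') (use qc e in \<open>auto simp: Q.int_pow_mult intro!: Q.m_closed Q.int_pow_closed simp del: mult_FactGroup\<close>)
    also have "\<dots> = p z \<otimes>\<^bsub>?Q\<^esub> p z'" unfolding p_def by (rule Q.finprod_multf[OF pc pc])
    finally show "p (z \<otimes>\<^bsub>int_functions\<^esub> z') = p z \<otimes>\<^bsub>?Q\<^esub> p z'" by simp
  qed
  interpret p: group_hom int_functions ?Q p
    by (intro group_hom.intro group_hom_axioms.intro group_int_functions gQ p_hom)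
  \<comment> \<open>\<open>\<Phi>\<close> is defined on elements of \<open>V\<close> and not on
    cosets, so each product in the quotient is given a representative whose \<open>\<Phi>\<close> is
    the corresponding linear combination.\<close>
  have rep: "\<exists>x\<in>V. q x = finprod ?Q (\<lambda>j. q (e j) [^]\<^bsub>?Q\<^esub> (z j :: int)) A \<and>
      (\<forall>w\<in>W. \<Phi> x w = (\<Sum>j\<in>A. z j * \<Phi> (e j) w))" if "A \<subseteq> J" for A z
    using finite_subset[OF that J] that
  proof (induction A rule: finite_induct)
    case empty
    have "\<Phi> \<one> w = 0" if "w \<in> W" for w using \<Phi>_mult[of \<one> \<one> w] that by simp
    then show ?case using q_one[of \<one>] by (intro bexI[of _ \<one>]) auto
  next
    case (insert j A)
    then obtain x where x: "x \<in> V" "q x = finprod ?Q (\<lambda>j. q (e j) [^]\<^bsub>?Q\<^esub> (z j :: int)) A"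
      "\<forall>w\<in>W. \<Phi> x w = (\<Sum>j\<in>A. z j * \<Phi> (e j) w)" by auto
    have ej: "e j \<in> V" using insert e by auto
    let ?y = "e j [^]\<^bsub>?H\<^esub> z j"
    have y: "?y \<in> V" using H.int_pow_closed[of "e j" "z j"] ej by simp
    have "q ?y = q (e j) [^]\<^bsub>?Q\<^esub> z j" using q.hom_int_pow[of "e j" "z j"] ej by simp
    then have "q (?y \<otimes> x) = finprod ?Q (\<lambda>j. q (e j) [^]\<^bsub>?Q\<^esub> (z j :: int)) (insert j A)"
      using insert pc[of z] x y q_mult by (subst Q.finprod_insert) (auto simp del: mult_FactGroup)
    moreover have "\<Phi> (?y \<otimes> x) w = (\<Sum>j\<in>insert j A. z j * \<Phi> (e j) w)" if w: "w \<in> W" for w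
    proof -
      have "group_hom ?H integer_group (\<lambda>x. \<Phi> x w)"
        by (intro group_hom.intro group_hom_axioms.intro H.group_axioms group_integer_group homI)
          (use \<Phi>_mult w in auto)
      then have "\<Phi> ?y w = z j * \<Phi> (e j) w"
        using group_hom.hom_int_pow[of ?H integer_group "\<lambda>x. \<Phi> x w" "e j" "z j"] ej by simp
      then show ?thesis using \<Phi>_mult[OF y x(1) w] x(3) w insert by simp
    qed
    ultimately show ?case using y x by (intro bexI[of _ "?y \<otimes> x"]) auto
  qed
  have "kernel int_functions ?Q p = {z. \<forall>j\<in>J. int (d j) dvd z j}"
  proof (intro subset_antisym subsetI)
    fix z assume "z \<in> kernel int_functions ?Q p"
    then have pz: "p z = \<one>\<^bsub>?Q\<^esub>" by (simp add: kernel_def)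
    obtain x where x: "x \<in> V" "q x = p z" "\<forall>w\<in>W. \<Phi> x w = (\<Sum>j\<in>J. z j * \<Phi> (e j) w)"
      using rep[of J z] by (auto simp: p_def)
    then have "x \<in> S" using q_one pz by simp
    then have "\<forall>j\<in>J. int (d j) dvd z j" using indep[of z] \<Phi>_S x(3) by metis
    then show "z \<in> {z. \<forall>j\<in>J. int (d j) dvd z j}" by simp
  next
    fix z assume z: "z \<in> {z. \<forall>j\<in>J. int (d j) dvd z j}"
    have "q (e j) [^]\<^bsub>?Q\<^esub> z j = \<one>\<^bsub>?Q\<^esub>" if j: "j \<in> J" for j
    proof -
      obtain l where l: "z j = int (d j) * l" using z j by blast
      have "e j [^]\<^bsub>?H\<^esub> d j = e j [^] d j" by (rule nat_pow_consistent[symmetric])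
      then have "q (e j) [^]\<^bsub>?Q\<^esub> d j = q (e j [^] d j)" using q.hom_nat_pow[of "e j" "d j"] e[OF j] by simp
      also have "\<dots> = \<one>\<^bsub>?Q\<^esub>" using q_one pow[OF j] SV by blast
      finally have "q (e j) [^]\<^bsub>?Q\<^esub> int (d j) = \<one>\<^bsub>?Q\<^esub>" by (simp only: int_pow_int)
      then show ?thesis
        unfolding l using Q.int_pow_pow[of "q (e j)" "int (d j)" l] qc[OF e[OF j]] by (simp only: Q.int_pow_one)
    qed
    then have "p z = \<one>\<^bsub>?Q\<^esub>" unfolding p_def by (rule Q.finprod_one_eqI)
    then show "z \<in> kernel int_functions ?Q p" by (simp add: kernel_def)
  qed
  moreover have "p ` UNIV = carrier ?Q"
  proof
    show "p ` UNIV \<subseteq> carrier ?Q" using p.hom_closed by auto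
    have sub: "subgroup (p ` UNIV) ?Q" using p.img_is_subgroup by simp
    let ?P = "{x \<in> V. q x \<in> p ` UNIV}"
    have "subgroup ?P G"
    proof (rule subgroupI)
      have "q \<one> \<in> p ` UNIV" using q_one[of \<one>] subgroup.one_closed[OF sub] by simp
      then show "?P \<noteq> {}" using V.one_closed by blast
      fix x assume x: "x \<in> ?P"
      then have "q (inv\<^bsub>?H\<^esub> x) \<in> p ` UNIV" using q.hom_inv[of x] subgroup.m_inv_closed[OF sub, of "q x"] by simp
      then show "inv x \<in> ?P" using x m_inv_consistent[OF V] by auto
      fix y assume y: "y \<in> ?P"
      then show "x \<otimes> y \<in> ?P"
        using x q_mult[of x y] subgroup.m_closed[OF sub, of "q x" "q y"] by simp
    qed auto
    moreover have "e ` J \<union> S \<subseteq> ?P"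
    proof
      fix x assume "x \<in> e ` J \<union> S"
      then show "x \<in> ?P"
      proof
        assume "x \<in> S"
        then have "x \<in> V" "q x = \<one>\<^bsub>?Q\<^esub>" using SV q_one by auto
        then show ?thesis using subgroup.one_closed[OF sub] by simp
      next
        assume "x \<in> e ` J"
        then obtain j where j: "j \<in> J" "x = e j" by auto
        have "p (\<lambda>i. if i = j then 1 else 0) = finprod ?Q (\<lambda>i. if j = i then q (e i) else \<one>\<^bsub>?Q\<^esub>) J"
          unfolding p_def by (rule Q.finprod_cong') (use qc e Q.one_closed in auto)
        also have "\<dots> = q (e j)" using Q.finprod_singleton[OF j(1) J, of "\<lambda>i. q (e i)"] qc e by auto
        finally show ?thesis using j e by auto
      qed
    qed
    ultimately have "V \<subseteq> ?P"
      using gen generate_subgroup_incl by blast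
    then show "carrier ?Q \<subseteq> p ` UNIV" using q_surj by blast
  qed
  ultimately show "\<exists>p \<in> hom int_functions ?Q. p ` UNIV = carrier ?Q \<and>
      kernel int_functions ?Q p = {z. \<forall>j\<in>J. int (d j) dvd z j}"
    using p_hom by blast
qed

section \<open>The target direct sum as a quotient of integer functions\<close>

lemma carrier_sum_group_finite:
  assumes "finite I" "\<And>i. i \<in> I \<Longrightarrow> group (G i)"
  shows "carrier (sum_group I G) = (\<Pi>\<^sub>E i\<in>I. carrier (G i))"
  using assms by (auto simp: carrier_sum_group)

lemma group_copies [simp]: "group X \<Longrightarrow> group (copies X m)"
  by (simp add: copies_def)

lemma carrier_copies: "group X \<Longrightarrow> carrier (copies X m) = (\<Pi>\<^sub>E i\<in>{..<m}. carrier X)"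
  by (simp add: copies_def carrier_sum_group_finite)

lemma mult_copies [simp]: "f \<otimes>\<^bsub>copies X m\<^esub> g = (\<lambda>i\<in>{..<m}. f i \<otimes>\<^bsub>X\<^esub> g i)"
  by (simp add: copies_def)

lemma one_copies [simp]: "\<one>\<^bsub>copies X m\<^esub> = (\<lambda>i\<in>{..<m}. \<one>\<^bsub>X\<^esub>)"
  by (simp add: copies_def)

abbreviation (input) cyclic_sum :: "nat \<Rightarrow> nat \<Rightarrow> (nat \<Rightarrow> nat) \<Rightarrow> (nat \<Rightarrow> nat) \<Rightarrow> ((nat \<Rightarrow> int) \<times> (nat \<Rightarrow> nat \<Rightarrow> int)) monoid" where
  "cyclic_sum B t n N \<equiv> copies integer_group B \<times>\<times> sum_group {1..t} (\<lambda>i. copies (integer_mod_group (n i)) (N i))"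

lemma mod_in_integer_mod_group [simp]: "z mod int n \<in> carrier (integer_mod_group n)"
  by (simp add: carrier_integer_mod_group)

text \<open>\<open>J0\<close> indexes the infinite cyclic summands and \<open>K i\<close> the copies
  of the cyclic group of order \<open>n i\<close>. The order 0 stands for infinite order, since 0
  divides only 0.\<close>

lemma cyclic_sum_presentation:
  fixes \<epsilon>0 :: "nat \<Rightarrow> 'j" and \<epsilon> :: "nat \<Rightarrow> nat \<Rightarrow> 'j"
  assumes \<epsilon>0: "bij_betw \<epsilon>0 {..<B} J0" and \<epsilon>: "\<And>i. i \<in> {1..t} \<Longrightarrow> bij_betw (\<epsilon> i) {..<N i} (K i)"
    and disj: "\<And>i. i \<in> {1..t} \<Longrightarrow> J0 \<inter> K i = {}"
      "\<And>i j. i \<in> {1..t} \<Longrightarrow> j \<in> {1..t} \<Longrightarrow> i \<noteq> j \<Longrightarrow> K i \<inter> K j = {}"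
    and J: "J = J0 \<union> (\<Union>i\<in>{1..t}. K i)"
    and d0: "\<And>j. j \<in> J0 \<Longrightarrow> d j = 0" and d: "\<And>i j. i \<in> {1..t} \<Longrightarrow> j \<in> K i \<Longrightarrow> d j = n i"
  shows "group (cyclic_sum B t n N)"
    and "\<exists>p \<in> hom int_functions (cyclic_sum B t n N). p ` UNIV = carrier (cyclic_sum B t n N) \<and>
      kernel int_functions (cyclic_sum B t n N) p = {z. \<forall>j\<in>J. int (d j) dvd z j}"
proof -
  let ?T = "cyclic_sum B t n N"
  show gT: "group ?T" by (intro DirProd_group) simp_all
  have cT: "carrier ?T = (\<Pi>\<^sub>E i\<in>{..<B}. UNIV) \<times> (\<Pi>\<^sub>E i\<in>{1..t}. \<Pi>\<^sub>E q\<in>{..<N i}. carrier (integer_mod_group (n i)))"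
    by (simp add: carrier_copies carrier_sum_group_finite)
  define p where "p z = ((\<lambda>i\<in>{..<B}. z (\<epsilon>0 i)), (\<lambda>i\<in>{1..t}. \<lambda>q\<in>{..<N i}. z (\<epsilon> i q) mod int (n i)))"
    for z :: "'j \<Rightarrow> int"
  have closed: "p z \<in> carrier ?T" for z unfolding cT by (auto simp: p_def)
  have "p \<in> hom int_functions ?T"
  proof (rule homI)
    fix z z' :: "'j \<Rightarrow> int"
    show "p z \<in> carrier ?T" by (rule closed)
    show "p (z \<otimes>\<^bsub>int_functions\<^esub> z') = p z \<otimes>\<^bsub>?T\<^esub> p z'"
      by (auto simp: p_def fun_eq_iff mod_add_eq)
  qed
  moreover have "p ` UNIV = carrier ?T"
  proof
    show "p ` UNIV \<subseteq> carrier ?T" by (rule image_subsetI) (rule closed)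
    show "carrier ?T \<subseteq> p ` UNIV"
    proof
      fix x assume "x \<in> carrier ?T"
      then obtain g h where x: "x = (g, h)" "g \<in> (\<Pi>\<^sub>E i\<in>{..<B}. UNIV)"
        "h \<in> (\<Pi>\<^sub>E i\<in>{1..t}. \<Pi>\<^sub>E q\<in>{..<N i}. carrier (integer_mod_group (n i)))"
        unfolding cT by auto
      \<comment> \<open>The blocks are disjoint, so an index determines its block, and the
        prescribed coordinates glue to a single function.\<close>
      define ind where "ind x = (THE i. i \<in> {1..t} \<and> x \<in> K i)" for x
      have ind: "ind x = i" if "i \<in> {1..t}" "x \<in> K i" for x i
        unfolding ind_def using that disj(2) by (intro the_equality) auto
      define z where "z x = (if x \<in> J0 then g (inv_into {..<B} \<epsilon>0 x)
        else h (ind x) (inv_into {..<N (ind x)} (\<epsilon> (ind x)) x))" for x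
      have z0: "z (\<epsilon>0 i) = g i" if "i < B" for i
        using that \<epsilon>0 by (auto simp: z_def bij_betw_def inv_into_f_f)
      have zi: "z (\<epsilon> i q) = h i q" if i: "i \<in> {1..t}" and q: "q < N i" for i q
      proof -
        have k: "\<epsilon> i q \<in> K i" using \<epsilon>[OF i] q by (auto simp: bij_betw_def)
        then have "\<epsilon> i q \<notin> J0" using disj(1)[OF i] by auto
        then show ?thesis using ind[OF i k] \<epsilon>[OF i] q by (auto simp: z_def bij_betw_def inv_into_f_f)
      qed
      have hm: "h i q mod int (n i) = h i q" if i: "i \<in> {1..t}" and q: "q < N i" for i q
      proof -
        have "h i q \<in> carrier (integer_mod_group (n i))" using x(3) i q by (auto simp: PiE_iff)
        then show ?thesis by (auto simp: carrier_integer_mod_group split: if_splits)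
      qed
      have "(\<lambda>i\<in>{..<B}. z (\<epsilon>0 i)) = g"
        using x(2) z0 by (auto simp: fun_eq_iff PiE_iff extensional_def)
      moreover have "(\<lambda>i\<in>{1..t}. \<lambda>q\<in>{..<N i}. z (\<epsilon> i q) mod int (n i)) = h"
      proof
        fix i
        show "(\<lambda>i\<in>{1..t}. \<lambda>q\<in>{..<N i}. z (\<epsilon> i q) mod int (n i)) i = h i"
        proof (cases "i \<in> {1..t}")
          case True
          then have "h i \<in> (\<Pi>\<^sub>E q\<in>{..<N i}. carrier (integer_mod_group (n i)))" using x(3) by (rule PiE_mem[rotated])
          then have "(\<lambda>q\<in>{..<N i}. z (\<epsilon> i q) mod int (n i)) = h i"
            using zi[OF True] hm[OF True] by (auto simp: fun_eq_iff PiE_iff extensional_def)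
          then show ?thesis using True by simp
        next
          case False
          then show ?thesis using PiE_arb[OF x(3) False] by auto
        qed
      qed
      ultimately have "p z = x" by (simp add: p_def x(1))
      then show "x \<in> p ` UNIV" by blast
    qed
  qed
  moreover have "kernel int_functions ?T p = {z. \<forall>j\<in>J. int (d j) dvd z j}"
  proof -
    have "p z = \<one>\<^bsub>?T\<^esub> \<longleftrightarrow> (\<forall>j\<in>J. int (d j) dvd z j)" for z
    proof -
      have "p z = \<one>\<^bsub>?T\<^esub> \<longleftrightarrow> (\<forall>i<B. z (\<epsilon>0 i) = 0) \<and> (\<forall>i\<in>{1..t}. \<forall>q<N i. z (\<epsilon> i q) mod int (n i) = 0)"
        by (auto simp: p_def fun_eq_iff restrict_def) 
      also have "\<dots> \<longleftrightarrow> (\<forall>j\<in>J0. z j = 0) \<and> (\<forall>i\<in>{1..t}. \<forall>j\<in>K i. int (n i) dvd z j)"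
      proof -
        have "J0 = \<epsilon>0 ` {..<B}" using \<epsilon>0 by (simp add: bij_betw_def)
        moreover have "K i = \<epsilon> i ` {..<N i}" if "i \<in> {1..t}" for i using \<epsilon>[OF that] by (simp add: bij_betw_def)
        ultimately show ?thesis by (auto simp: dvd_eq_mod_eq_0)
      qed
      also have "\<dots> \<longleftrightarrow> (\<forall>j\<in>J. int (d j) dvd z j)"
      proof -
        have "(\<forall>j\<in>J. int (d j) dvd z j) \<longleftrightarrow>
            (\<forall>j\<in>J0. int (d j) dvd z j) \<and> (\<forall>i\<in>{1..t}. \<forall>j\<in>K i. int (d j) dvd z j)"
          unfolding J by blast
        then show ?thesis using d0 d by simp
      qed
      finally show ?thesis .
    qed
    then show ?thesis by (simp add: kernel_def)
  qed
  ultimately show "\<exists>p \<in> hom int_functions ?T. p ` UNIV = carrier ?T \<and>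
      kernel int_functions ?T p = {z. \<forall>j\<in>J. int (d j) dvd z j}" by blast
qed

section \<open>The quotient by the star subgroup\<close>

text \<open>The index set of the generators of \<open>V / S\<close>. For \<open>c1 = c2\<close> the
  commutators of (u, v) and (v, u) are mutually inverse and that of (u, u) is trivial, so one
  ordering is kept.\<close>

definition lyndon_pairs :: "nat \<Rightarrow> nat \<Rightarrow> nat \<Rightarrow> (nat list \<times> nat list) set" where
  "lyndon_pairs c1 c2 d =
     {(u, v). u \<in> lyndon_words (Suc c1) d \<and> v \<in> lyndon_words (Suc c2) d \<and> (c1 = c2 \<longrightarrow> u < v)}"

lemma lyndon_pairs_subset: "lyndon_pairs c1 c2 d \<subseteq> lyndon_words (Suc c1) d \<times> lyndon_words (Suc c2) d"
  by (auto simp: lyndon_pairs_def)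

lemma finite_lyndon_pairs [simp]: "finite (lyndon_pairs c1 c2 d)"
  by (rule finite_subset[OF lyndon_pairs_subset]) simp

lemma modulus_eq_Max:
  assumes "\<And>i j. i \<le> j \<Longrightarrow> j < d \<Longrightarrow> m j dvd m i" "set w \<subseteq> {..<d}" "w \<noteq> []"
  shows "modulus m w = int (m (Max (set w)))"
proof -
  have "Max (set w) \<in> set w" using assms(3) by simp
  then have "Max (set w) < d" using assms(2) by auto
  have "Gcd (m ` set w) = m (Max (set w))"
  proof (rule dvd_antisym)
    show "Gcd (m ` set w) dvd m (Max (set w))" using assms(3) by (intro Gcd_dvd) simp
    show "m (Max (set w)) dvd Gcd (m ` set w)"
      using assms(1)[OF Max_ge[OF finite_set] \<open>Max (set w) < d\<close>] by (intro Gcd_greatest) auto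
  qed
  then show ?thesis by (simp add: modulus_def)
qed

locale outer_setting = magnus_generators +
  fixes X :: "'a set" and c1 c2 :: nat
  assumes free: "free_on G X" and c2: "1 \<le> c2" "c2 \<le> c1" and c1: "c1 \<le> 2 * c2"
    and y_pow: "i < d \<Longrightarrow> y i [^] m i \<in> R"
    and m_chain: "i \<le> j \<Longrightarrow> j < d \<Longrightarrow> m j dvd m i"
begin

abbreviation "a \<equiv> Suc c1"
abbreviation "b \<equiv> Suc c2"
abbreviation "V \<equiv> verbal_subgroup {outer_comm_word c1 c2} G"
abbreviation "S \<equiv> star_subgroup {outer_comm_word c1 c2} G R"
abbreviation "J \<equiv> lyndon_pairs c1 c2 d"

definition pair_value :: "nat list \<times> nat list \<Rightarrow> 'a" where
  "pair_value = (\<lambda>(u, v). comm (bracket u) (bracket v))"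

lemma V_eq: "V = comm_subgroup (lcs a) (lcs b)"
  by (rule verbal_subgroup_outer_comm)

lemma S_normal: "S \<lhd> G"
  by (rule normal_star_subgroup_outer_comm[OF R_normal])

lemma V_normal: "V \<lhd> G"
  unfolding V_eq by (intro normal_comm_subgroup rel_lcs_normal normal_self)

lemma S_subset_V: "S \<subseteq> V"
  by (rule star_subset_verbal_outer_comm[OF R_normal])

lemmas V_subgroup = normal_imp_subgroup[OF V_normal] and S_subgroup = normal_imp_subgroup[OF S_normal]

lemma lcs_antimono: "i \<le> j \<Longrightarrow> lcs j \<subseteq> lcs i"
proof (induction rule: dec_induct)
  case (step n)
  then show ?case using lcs_Suc_subset rel_lcs_subset_lcs by blast
qed simp

lemma V_subset_lcs: "V \<subseteq> lcs (a + b)"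
  unfolding V_eq by (rule comm_subgroup_subset[OF normal_imp_subgroup[OF A_normal] comm_A])

lemma lcs_subset_rel: "i < j \<Longrightarrow> lcs j \<subseteq> rel_lcs R i"
  using lcs_antimono[of "Suc i" j] lcs_Suc_subset by (meson Suc_leI order_trans)

lemma comm_rel_S:
  "p \<in> rel_lcs R a \<Longrightarrow> q \<in> lcs b \<Longrightarrow> comm p q \<in> S"
  "p \<in> lcs a \<Longrightarrow> q \<in> rel_lcs R b \<Longrightarrow> comm p q \<in> S"
  using comm_rel_lcs_star[OF R_normal] comm_lcs_star[OF R_normal] by blast+

text \<open>\<open>V\<close> is central modulo \<open>S\<close>, by the three subgroups lemma:
  [gamma_b, G] lies in gamma_(b+1), hence in \<open>rel_lcs R b\<close>, whose commutators with
  gamma_a lie in \<open>S\<close>; the other case exchanges the roles of \<open>a\<close> and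
  \<open>b\<close>.\<close>

lemma comm_V_S: assumes x: "x \<in> V" and g: "g \<in> carrier G" shows "comm x g \<in> S"
proof (rule three_subgroups[OF S_normal rel_lcs_normal rel_lcs_normal normal_self _ _ x[unfolded V_eq] g])
  show "carrier G \<lhd> G" "carrier G \<lhd> G" by (rule normal_self)+
  have swap: "comm q p \<in> S \<Longrightarrow> p \<in> carrier G \<Longrightarrow> q \<in> carrier G \<Longrightarrow> comm p q \<in> S" for p q
    using comm_swap_mem[OF S_subgroup] by blast
  fix c p assume c: "c \<in> comm_subgroup (lcs b) (carrier G)" and p: "p \<in> lcs a"
  have "c \<in> lcs (Suc b)" using c by simp
  then have "c \<in> rel_lcs R b" using lcs_Suc_subset by blast
  then show "comm c p \<in> S" using swap[OF comm_rel_S(2)[OF p]] B_carrier A_carrier[OF p] by blast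
next
  fix c q assume c: "c \<in> comm_subgroup (carrier G) (lcs a)" and q: "q \<in> lcs b"
  have "comm g p \<in> rel_lcs R a" if "g \<in> carrier G" "p \<in> lcs a" for g p
    using comm_A_one[OF that(2,1)] comm_swap_mem[OF normal_imp_subgroup[OF B_normal]] A_carrier that by blast
  then have "c \<in> rel_lcs R a"
    using comm_subgroup_subset[OF normal_imp_subgroup[OF B_normal]] c by blast
  then show "comm c q \<in> S" using comm_rel_S(1) q by blast
qed

lemma comm_in_V: "p \<in> lcs a \<Longrightarrow> q \<in> lcs b \<Longrightarrow> comm p q \<in> V"
  unfolding V_eq by (rule comm_subgroup_mem)

lemma JD: "(u, v) \<in> J \<Longrightarrow> u \<in> lyndon_words a d \<and> v \<in> lyndon_words b d \<and> (c1 = c2 \<longrightarrow> u < v)"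
  by (auto simp: lyndon_pairs_def)

lemma pair_value_V: "j \<in> J \<Longrightarrow> pair_value j \<in> V"
  by (cases j) (auto simp: pair_value_def dest!: JD intro: comm_in_V bracket_mem)

lemma V_generated: "V \<subseteq> generate G (pair_value ` J \<union> S)"
proof -
  let ?K = "generate G (pair_value ` J \<union> S)"
  have gens: "pair_value ` J \<union> S \<subseteq> V" using pair_value_V S_subset_V by auto
  then have gc: "pair_value ` J \<union> S \<subseteq> carrier G" using normal_carrier[OF V_normal] by blast
  have K: "subgroup ?K G" by (rule generate_is_subgroup[OF gc])
  have KV: "?K \<subseteq> V" by (rule generate_subgroup_incl[OF gens V_subgroup])
  have SK: "S \<subseteq> ?K" by (auto intro: generate.incl)
  \<comment> \<open>Every subgroup between \<open>S\<close> and \<open>V\<close> is normal, as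
    \<open>V\<close> is central modulo \<open>S\<close>.\<close>
  have Kn: "?K \<lhd> G"
  proof (rule normal_invI[OF K])
    fix g x assume g: "g \<in> carrier G" and x: "x \<in> ?K"
    have "comm x (inv g) \<in> ?K" using comm_V_S[of x "inv g"] KV x g SK by auto
    moreover have "x \<in> carrier G" using x subgroup.subset[OF K] by auto
    ultimately show "g \<otimes> x \<otimes> inv g \<in> ?K"
      using g x conj_eq_comm[of x g] subgroup.m_closed[OF K x] by simp
  qed
  show ?thesis
    unfolding V_eq
  proof (rule comm_subgroup_subset[OF K])
    fix p q assume p: "p \<in> lcs a" and q: "q \<in> lcs b"
    show "comm p q \<in> ?K"
    proof (rule comm_generate[OF Kn])
      show "p \<in> generate G (bracket ` {w \<in> lyndon_words a d. True} \<union> rel_lcs R a)"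
        using A_subset_bracket_span[of a] p unfolding bracket_span_def by auto
      show "q \<in> generate G (bracket ` {w \<in> lyndon_words b d. True} \<union> rel_lcs R b)"
        using A_subset_bracket_span[of b] q unfolding bracket_span_def by auto
      show "bracket ` {w \<in> lyndon_words a d. True} \<union> rel_lcs R a \<subseteq> carrier G"
        "bracket ` {w \<in> lyndon_words b d. True} \<union> rel_lcs R b \<subseteq> carrier G"
        using bracket_carrier B_carrier by blast+
      fix s t assume s: "s \<in> bracket ` {w \<in> lyndon_words a d. True} \<union> rel_lcs R a"
        and t: "t \<in> bracket ` {w \<in> lyndon_words b d. True} \<union> rel_lcs R b"
      have sl: "s \<in> lcs a" using s bracket_mem rel_lcs_subset_lcs by blast
      have tl: "t \<in> lcs b" using t bracket_mem rel_lcs_subset_lcs by blast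
      show "comm s t \<in> ?K"
      proof (cases "s \<in> rel_lcs R a \<or> t \<in> rel_lcs R b")
        case True
        then show ?thesis using comm_rel_S sl tl SK by blast
      next
        case False
        then obtain u v where u: "u \<in> lyndon_words a d" "s = bracket u"
          and v: "v \<in> lyndon_words b d" "t = bracket v" using s t by auto
        have inK: "comm (bracket p) (bracket q) \<in> ?K" if "(p, q) \<in> J" for p q
        proof -
          have "pair_value (p, q) \<in> ?K" using that by (intro generate.incl) blast
          then show ?thesis by (simp add: pair_value_def)
        qed
        have "(u, v) \<in> J \<or> c1 = c2 \<and> v < u \<or> u = v"
          using u v unfolding lyndon_pairs_def by (cases u v rule: linorder_cases) auto
        then consider "(u, v) \<in> J" | "c1 = c2" "v < u" | "u = v" by blast
        then show ?thesis
        proof cases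
          case 1
          then show ?thesis using inK u v by simp
        next
          case 2
          then have "(v, u) \<in> J" using u v by (auto simp: lyndon_pairs_def)
          then have "comm t s \<in> ?K" using inK u v by simp
          then show ?thesis by (rule comm_swap_mem[OF K A_carrier[OF tl] A_carrier[OF sl]])
        next
          case 3
          then show ?thesis using u v A_carrier[OF sl] subgroup.one_closed[OF K] by simp
        qed
      qed
    qed
  qed
qed

definition pair_order :: "nat list \<times> nat list \<Rightarrow> nat" where
  "pair_order = (\<lambda>(u, v). m (Max (set (u @ v))))"

lemma pair_modulus:
  assumes "(u, v) \<in> J"
  shows "modulus m (u @ v) = int (pair_order (u, v))"
  unfolding pair_order_def prod.case
  by (rule modulus_eq_Max[of d]) (use JD[OF assms] m_chain in \<open>auto simp: lyndon_words_def words_def lyndon_def\<close>)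

lemma pow_lcs: "x \<in> lcs i \<Longrightarrow> x [^] (k :: nat) \<in> lcs i"
  by (induction k)
    (auto intro: subgroup.m_closed[OF normal_imp_subgroup[OF A_normal]] subgroup.one_closed[OF normal_imp_subgroup[OF A_normal]])

lemma pair_value_pow:
  assumes j: "j \<in> J"
  shows "pair_value j [^] pair_order j \<in> S"
proof -
  obtain u v where [simp]: "j = (u, v)" by (cases j)
  note uv = JD[OF j[simplified]]
  have ne: "u \<noteq> []" "v \<noteq> []" using uv by (auto simp: lyndon_words_def lyndon_def)
  define i where "i = Max (set (u @ v))"
  \<comment> \<open>The largest letter may lie in either component; that component is the one raised
    to the power.\<close>
  have i: "i \<in> set u \<or> i \<in> set v" using Max_in[of "set (u @ v)"] ne by (auto simp: i_def)
  have yR: "y i [^] m i \<in> rel_lcs R (Suc 0)" if "i \<in> set u \<or> i \<in> set v" for i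
    using y_pow[of i] that uv by (auto simp: lyndon_words_def words_def)
  have bu: "bracket u \<in> lcs a" and bv: "bracket v \<in> lcs b" using uv bracket_mem by auto
  note car = A_carrier[OF bu] A_carrier[OF bv]
  have "comm (bracket u) (bracket v) [^] m i \<in> S"
    using i
  proof
    assume iu: "i \<in> set u"
    have "bracket u [^] m i \<in> rel_lcs R a"
      using bracket_pow[of u a m i] uv yR iu by blast
    then have "comm (bracket u [^] m i) (bracket v) \<in> S" using comm_rel_S(1) bv by blast
    moreover have "comm (comm (bracket u [^] k) (bracket v)) (bracket u) \<in> S" for k :: nat
      by (rule comm_V_S[OF comm_in_V[OF pow_lcs[OF bu] bv] car(1)])
    ultimately show ?thesis by (intro comm_pow_mem[OF S_normal car(1,2)])
  next
    assume iv: "i \<in> set v"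
    have "bracket v [^] m i \<in> rel_lcs R b"
      using bracket_pow[of v b m i] uv yR iv by blast
    then have "comm (bracket u) (bracket v [^] m i) \<in> S" using comm_rel_S(2) bu by blast
    then have "comm (bracket v [^] m i) (bracket u) \<in> S"
      using comm_swap_mem[OF S_subgroup] car by simp
    moreover have "comm (comm (bracket v [^] k) (bracket u)) (bracket v) \<in> S" for k :: nat
    proof (rule comm_V_S[OF _ car(2)])
      have "comm (bracket u) (bracket v [^] k) \<in> V" by (rule comm_in_V[OF bu pow_lcs[OF bv]])
      then show "comm (bracket v [^] k) (bracket u) \<in> V"
        using comm_swap_mem[OF V_subgroup] car by simp
    qed
    ultimately have "comm (bracket v) (bracket u) [^] m i \<in> S" by (intro comm_pow_mem[OF S_normal car(2,1)])
    then have "inv (comm (bracket v) (bracket u) [^] m i) \<in> S" by (rule subgroup.m_inv_closed[OF S_subgroup])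
    then show ?thesis using car by (simp add: inv_comm flip: nat_pow_inv)
  qed
  then show ?thesis by (simp add: pair_value_def pair_order_def i_def)
qed

text \<open>The map \<open>c\<close> of the splitting lemma for the cocycle $u_a v_b$ on $\gamma_b$ replaces the
  degree \<open>a + b\<close> part of the Magnus expansion: for \<open>b < a\<close> it sees \<open>u \<otimes> v\<close> instead of the
  Lie bracket of \<open>u\<close> and \<open>v\<close>, so that no basis of the free Lie ring in degree \<open>a + b\<close> is needed.\<close>

lemma outer_form:
  obtains \<Phi> :: "'a \<Rightarrow> nat list \<Rightarrow> int" where
    "\<And>x z w. x \<in> V \<Longrightarrow> z \<in> V \<Longrightarrow> length w = a + b \<Longrightarrow> \<Phi> (x \<otimes> z) w = \<Phi> x w + \<Phi> z w"
    "\<And>u v w. u \<in> lcs a \<Longrightarrow> v \<in> lcs b \<Longrightarrow> length w = a + b \<Longrightarrow>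
      \<Phi> (comm u v) w = M u (take a w) * M v (drop a w) - M v (take a w) * M u (drop a w)"
proof -
  have "\<exists>c. \<forall>u\<in>lcs b. \<forall>v\<in>lcs b. c (u \<otimes> v) = c u + c v + M u (take a w) * M v (drop a w)"
    if w: "length w = a + b" for w
  proof -
    have len: "length (take a w) = a" "length (drop a w) = b" "take a w \<noteq> []" "drop a w \<noteq> []"
      using w by (auto simp: take_eq_Nil2)
    \<comment> \<open>By \<open>c1 \<le> 2 * c2\<close> both \<open>a\<close> and \<open>b\<close>
      are at most \<open>2 * b - 1\<close>, below the first degree in which a product of two
      elements of gamma_b has a mixed term.\<close>
    have low: "M (u \<otimes> v) (take a w) = M u (take a w) + M v (take a w)"
      "M (u \<otimes> v) (drop a w) = M u (drop a w) + M v (drop a w)"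
      if "u \<in> lcs b" "v \<in> lcs b" for u v
      by (rule M_lcs_mult[OF that]; use len c1 in simp)+
    have K: "subgroup (lcs b) G" by (rule normal_imp_subgroup[OF A_normal])
    obtain c where "\<And>u v. u \<in> lcs b \<Longrightarrow> v \<in> lcs b \<Longrightarrow>
        c (u \<otimes> v) = c u + c v + M u (take a w) * M v (drop a w)"
      by (rule free_cocycle_splits[OF free K, of "\<lambda>u v. M u (take a w) * M v (drop a w)"])
        (simp add: low distrib_right, simp add: low distrib_left, blast)
    then show ?thesis by blast
  qed
  then obtain c where c: "\<And>w u v. length w = a + b \<Longrightarrow> u \<in> lcs b \<Longrightarrow> v \<in> lcs b \<Longrightarrow>
      c w (u \<otimes> v) = c w u + c w v + M u (take a w) * M v (drop a w)"
    by metis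
  have Vb: "x \<in> lcs b" if "x \<in> V" for x using V_subset_lcs lcs_antimono[of b "a + b"] that by auto
  \<comment> \<open>Elements of \<open>V\<close> have no terms in degrees \<open>a\<close> and
    \<open>b\<close>, so the correction term of the cochain disappears on \<open>V\<close>.\<close>
  have M0: "M x (take a w) = 0" "M x (drop a w) = 0" if "x \<in> lcs (a + b)" "length w = a + b" for x w
  proof -
    have "w \<noteq> []" using that(2) by auto
    then show "M x (take a w) = 0" "M x (drop a w) = 0"
      using vanishes_below_lcs[OF that(1)] that(2) c2 by (auto simp: vanishes_below_def)
  qed
  show thesis
  proof (rule that[of "\<lambda>x w. c w x"])
    fix x z w assume "x \<in> V" "z \<in> V" and w: "length (w :: nat list) = a + b"
    then show "c w (x \<otimes> z) = c w x + c w z"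
      using c[OF w Vb Vb] M0[OF subsetD[OF V_subset_lcs] w] by simp
  next
    fix u v w assume u: "u \<in> lcs a" and v: "v \<in> lcs b" and w: "length (w :: nat list) = a + b"
    have ub: "u \<in> lcs b" using u lcs_antimono[of b a] c2 by auto
    have uv: "comm u v \<in> V" by (rule comm_in_V[OF u v])
    have vu: "v \<otimes> u \<in> lcs b" by (rule subgroup.m_closed[OF normal_imp_subgroup[OF A_normal] v ub])
    \<comment> \<open>Expanding both sides by the cochain identity, the values at \<open>u\<close>
      and \<open>v\<close> cancel, the correction against \<open>comm u v\<close> is 0, and the two
      products remain.\<close>
    have "c w (u \<otimes> v) = c w (v \<otimes> u \<otimes> comm u v)"
      by (rule arg_cong[OF mult_eq_comm[OF A_carrier[OF u] A_carrier[OF v]]])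
    then show "c w (comm u v) = M u (take a w) * M v (drop a w) - M v (take a w) * M u (drop a w)"
      using c[OF w ub v] c[OF w vu Vb[OF uv]] c[OF w v ub] M0[OF subsetD[OF V_subset_lcs uv] w] by simp
  qed
qed

text \<open>A generator of \<open>S\<close> compares two values of the word whose entries differ by
  an element of \<open>R\<close> in one variable. Their linear coefficients are congruent modulo the
  orders of the letters, and the congruence passes to the form.\<close>

lemma outer_form_S:
  assumes add: "\<And>x z w. x \<in> V \<Longrightarrow> z \<in> V \<Longrightarrow> length w = a + b \<Longrightarrow> \<Phi> (x \<otimes> z) w = \<Phi> x w + \<Phi> z w"
    and form: "\<And>u v w. u \<in> lcs a \<Longrightarrow> v \<in> lcs b \<Longrightarrow> length w = a + b \<Longrightarrow>
      \<Phi> (comm u v) w = M u (take a w) * M v (drop a w) - M v (take a w) * M u (drop a w)"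
    and s: "s \<in> S" and w: "length w = a + b"
  shows "modulus m w dvd (\<Phi> s w :: int)"
proof -
  have \<Phi>1: "\<Phi> \<one> w = 0" using add[OF _ _ w, of \<one> \<one>] subgroup.one_closed[OF V_subgroup] by simp
  have \<Phi>inv: "\<Phi> (inv x) w = - \<Phi> x w" if x: "x \<in> V" for x
    using add[OF x subgroup.m_inv_closed[OF V_subgroup x] w] \<Phi>1 normal_carrier[OF V_normal x] by simp
  let ?H = "{x \<in> V. modulus m w dvd \<Phi> x w}"
  have "subgroup ?H G"
  proof (rule subgroupI)
    show "?H \<subseteq> carrier G" using normal_carrier[OF V_normal] by auto
    show "?H \<noteq> {}"
      using \<Phi>1 subgroup.one_closed[OF V_subgroup] by (auto intro!: exI[of _ \<one>])
    fix x assume x: "x \<in> ?H"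
    then show "inv x \<in> ?H"
      using \<Phi>inv subgroup.m_inv_closed[OF V_subgroup] by auto
    fix z assume "z \<in> ?H"
    then show "x \<otimes> z \<in> ?H"
      using x add[OF _ _ w] subgroup.m_closed[OF V_subgroup] by auto
  qed
  moreover have "outer_star_gens c1 c2 R \<subseteq> ?H"
  proof
    fix x assume "x \<in> outer_star_gens c1 c2 R"
    then obtain f i r where f: "f \<in> UNIV \<rightarrow> carrier G" and r: "r \<in> R"
      and x: "x = outer_value c1 c2 (f(i := f i \<otimes> r)) \<otimes> inv (outer_value c1 c2 f)"
      unfolding outer_star_gens_def by blast
    define f' where "f' = f(i := f i \<otimes> r)"
    have f': "f' \<in> UNIV \<rightarrow> carrier G" unfolding f'_def by (rule fun_upd_carrier[OF R_normal f r])
    have fc: "f j \<in> carrier G" "f' j \<in> carrier G" for j using f f' by auto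
    have cong1: "int (m k) dvd M (f' j) [k] - M (f j) [k]" for j k
    proof (cases "j = i")
      case True
      have "M (f i \<otimes> r) [k] = M (f i) [k] + M r [k]"
        using M_lcs_mult[of "f i" 1 r "[k]"] fc normal_carrier[OF R_normal r] by simp
      then show ?thesis using True M_R[OF r, of k] by (simp add: f'_def)
    qed (simp add: f'_def)
    let ?l1 = "[1..<c1 + 1]" and ?l2 = "[c1 + 2..<c1 + c2 + 2]"
    define p q p' q' where pq: "p = foldl comm (f 0) (map f ?l1)" "q = foldl comm (f (c1 + 1)) (map f ?l2)"
      "p' = foldl comm (f' 0) (map f' ?l1)" "q' = foldl comm (f' (c1 + 1)) (map f' ?l2)"
    have l: "length ?l1 = c1" "length ?l2 = c2" by (simp_all del: upt_Suc)
    have mem: "p \<in> lcs a" "p' \<in> lcs a" "q \<in> lcs b" "q' \<in> lcs b"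
      unfolding pq using outer_value_lcs[OF f, of _ ?l1] outer_value_lcs[OF f', of _ ?l1]
        outer_value_lcs[OF f, of _ ?l2] outer_value_lcs[OF f', of _ ?l2] l by metis+
    have sub: "set (map f l) \<subseteq> carrier G" "set (map f' l) \<subseteq> carrier G" for l using fc by auto
    have all2: "list_all2 (\<lambda>g g'. \<forall>k. int (m k) dvd M g' [k] - M g [k]) (map f l) (map f' l)" for l
      using cong1 by (auto simp: list_all2_conv_all_nth)
    have pcong: "modulus m z dvd M p' z - M p z" if "length z = a" for z
      unfolding pq by (rule M_foldl_comm_cong[OF fc(1) fc(2) sub cong1 all2]) (use that in \<open>simp del: upt_Suc\<close>)
    have qcong: "modulus m z dvd M q' z - M q z" if "length z = b" for z
      unfolding pq by (rule M_foldl_comm_cong[OF fc(1) fc(2) sub cong1 all2]) (use that in \<open>simp del: upt_Suc\<close>)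
    have len: "length (take a w) = a" "length (drop a w) = b" using w by auto
    have 1: "modulus m w dvd M p' (take a w) * M q' (drop a w) - M p (take a w) * M q (drop a w)"
      by (intro modulus_dvd_mult_cong[where k = a] pcong qcong len)
    \<comment> \<open>For \<open>b < a\<close> no congruence is available for the degree
      \<open>a\<close> part of \<open>q\<close>, which is not its lowest part; but it is multiplied
      by the degree \<open>b\<close> part of \<open>p\<close>, which is 0.\<close>
    have 2: "modulus m w dvd M q' (take a w) * M p' (drop a w) - M q (take a w) * M p (drop a w)"
    proof (cases "c1 = c2")
      case True
      then show ?thesis by (intro modulus_dvd_mult_cong[where k = a] pcong qcong) (use len in auto)
    next
      case False
      then have "length (drop a w) < a" "drop a w \<noteq> []" using len c2 by auto
      then have "M p (drop a w) = 0" "M p' (drop a w) = 0"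
        using vanishes_below_lcs[OF mem(1)] vanishes_below_lcs[OF mem(2)] unfolding vanishes_below_def by blast+
      then show ?thesis by simp
    qed
    have x': "x = comm p' q' \<otimes> inv (comm p q)" unfolding x pq outer_value_def f'_def ..
    have vals: "comm p' q' \<in> V" "comm p q \<in> V" using comm_in_V mem by auto
    have "\<Phi> x w = (M p' (take a w) * M q' (drop a w) - M p (take a w) * M q (drop a w))
        - (M q' (take a w) * M p' (drop a w) - M q (take a w) * M p (drop a w))"
      unfolding x' add[OF vals(1) subgroup.m_inv_closed[OF V_subgroup vals(2)] w] \<Phi>inv[OF vals(2)]
        form[OF mem(2,4) w] form[OF mem(1,3) w] by simp
    then have "modulus m w dvd \<Phi> x w" using dvd_diff[OF 1 2] by simp
    moreover have "x \<in> V" unfolding x'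
      by (intro subgroup.m_closed[OF V_subgroup] subgroup.m_inv_closed[OF V_subgroup] vals)
    ultimately show "x \<in> ?H" by simp
  qed
  ultimately have "S \<subseteq> ?H"
    unfolding star_subgroup_outer_comm[OF R_normal] by (intro generate_subgroup_incl)
  then show ?thesis using s by auto
qed

text \<open>The form of \<open>(u, v)\<close> has leading word \<open>u @ v\<close> with coefficient 1, and pairs are determined by
  their leading words, since all first components have length \<open>a\<close>.\<close>

lemma pair_independence:
  assumes form: "\<And>u v w. u \<in> lcs a \<Longrightarrow> v \<in> lcs b \<Longrightarrow> length w = a + b \<Longrightarrow>
      \<Phi> (comm u v) w = M u (take a w) * M v (drop a w) - M v (take a w) * M u (drop a w)"
    and dvd: "\<And>w. length w = a + b \<Longrightarrow> modulus m w dvd (\<Sum>j\<in>J. z j * \<Phi> (pair_value j) w)"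
  shows "\<forall>j\<in>J. int (pair_order j) dvd z j"
proof (rule ccontr)
  assume neg: "\<not> (\<forall>j\<in>J. int (pair_order j) dvd z j)"
  define bad where "bad = {j \<in> J. \<not> int (pair_order j) dvd z j}"
  have "finite bad" "bad \<noteq> {}" using neg by (auto simp: bad_def)
  \<comment> \<open>Take a bad pair with least leading word and test divisibility at that
    word.\<close>
  then obtain j where j: "j \<in> bad" "\<And>k. k \<in> bad \<Longrightarrow> fst j @ snd j \<le> fst k @ snd k"
    using ex_min_if_finite[of "(\<lambda>k. fst k @ snd k) ` bad"] by (metis (no_types, lifting) finite_imageI image_iff image_is_empty linorder_not_less)
  obtain u v where [simp]: "j = (u, v)" by (cases j)
  have uvJ: "(u, v) \<in> J" using j(1) by (simp add: bad_def)
  note uv = JD[OF uvJ]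
  have lu: "length u = a" "length v = b" using uv by (auto simp: lyndon_words_def words_def)
  let ?w = "u @ v"
  have tw: "take a ?w = u" "drop a ?w = v" "length ?w = a + b" using lu by auto
  have val: "\<Phi> (pair_value (p, q)) ?w = M (bracket p) u * M (bracket q) v - M (bracket q) u * M (bracket p) v"
    if "(p, q) \<in> J" for p q
    using form[OF bracket_mem[of p a] bracket_mem[of q b] tw(3)] JD[OF that] unfolding tw(1,2)
    by (simp add: pair_value_def)
  \<comment> \<open>The subtracted product. For \<open>b < a\<close> it vanishes for reasons of
    degree; for \<open>a = b\<close> a surviving term needs \<open>q \<le> u\<close>, and
    \<open>p < q\<close> then gives \<open>p < u\<close>.\<close>
  have cases2: "modulus m ?w dvd M (bracket q) u * M (bracket p) v \<or>
      (set (p @ q) = set ?w \<and> p < u)" if pq: "(p, q) \<in> J" for p q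
  proof (cases "c1 = c2")
    case False
    have "length v < a" "v \<noteq> []" using lu False c2 by auto
    then have "M (bracket p) v = 0"
      using vanishes_below_lcs[OF bracket_mem[of p a]] JD[OF pq] unfolding vanishes_below_def by blast
    then show ?thesis by simp
  next
    case True
    have p: "p \<in> lyndon_words a d" "q \<in> lyndon_words b d" "p < q" using JD[OF pq] True by auto
    show ?thesis
    proof (cases "(set u = set q \<and> q \<le> u) \<and> (set v = set p \<and> p \<le> v)")
      case True
      then show ?thesis using p(3) by auto
    next
      case n: False
      then have "modulus m u dvd M (bracket q) u \<or> modulus m v dvd M (bracket p) v"
        using M_bracket(1)[OF p(1), of v] M_bracket(1)[OF p(2), of u] lu True by auto
      then show ?thesis
        using modulus_dvd_mult_left[of m a ?w] modulus_dvd_mult_right[of m a ?w] tw by metis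
    qed
  qed
  \<comment> \<open>A different pair that survives at \<open>u @ v\<close> has the same letters and
    a smaller leading word. It is not bad, so its \<open>z k\<close> is already divisible by the
    same modulus.\<close>
  have other: "modulus m ?w dvd z k * \<Phi> (pair_value k) ?w" if k: "k \<in> J" "k \<noteq> (u, v)" for k
  proof (rule ccontr)
    assume n: "\<not> ?thesis"
    obtain p q where [simp]: "k = (p, q)" by (cases k)
    note pq = JD[OF k(1)[simplified]]
    have lp: "length p = a" "length q = b" using pq by (auto simp: lyndon_words_def words_def)
    have smaller: "p @ q < ?w \<and> set (p @ q) = set ?w"
    proof (cases "modulus m ?w dvd M (bracket q) u * M (bracket p) v")
      case False
      then have "set (p @ q) = set ?w" "p < u" using cases2 k(1) by auto
      then show ?thesis using append_less_append_eq_length[of p u q v] lp lu by auto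
    next
      case True
      then have nn: "\<not> modulus m ?w dvd M (bracket p) u * M (bracket q) v"
        using n val k(1) by (auto intro: dvd_mult)
      have "set u = set p \<and> p \<le> u"
        using nn M_bracket(1)[of p a u] pq lu modulus_dvd_mult_left[of m a ?w] tw by metis
      moreover have "set v = set q \<and> q \<le> v"
        using nn M_bracket(1)[of q b v] pq lu modulus_dvd_mult_right[of m a ?w] tw by metis
      moreover from calculation have "p @ q \<le> ?w" by (intro append_le_append) (use lp lu in auto)
      moreover have "p @ q \<noteq> ?w" using k(2) lp lu by auto
      ultimately show ?thesis by auto
    qed
    then have "k \<notin> bad" using j(2)[of k] by auto
    then have "modulus m (p @ q) dvd z k" using pair_modulus[of p q] k(1) by (simp add: bad_def)
    moreover have "modulus m (p @ q) = modulus m ?w" using smaller by (intro modulus_cong) simp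
    ultimately show False using n by simp
  qed
  have "modulus m ?w dvd (\<Sum>k\<in>J - {(u, v)}. z k * \<Phi> (pair_value k) ?w)"
    by (rule dvd_sum) (use other in auto)
  then have zj: "modulus m ?w dvd z (u, v) * \<Phi> (pair_value (u, v)) ?w"
    using dvd[OF tw(3)] sum.remove[OF finite_lyndon_pairs uvJ, of "\<lambda>k. z k * \<Phi> (pair_value k) ?w"]
    by (simp add: dvd_add_left_iff)
  have "modulus m ?w dvd \<Phi> (pair_value (u, v)) ?w - 1"
  proof -
    have "\<not> (set (u @ v) = set ?w \<and> u < u)" by simp
    then have 2: "modulus m ?w dvd M (bracket v) u * M (bracket u) v" using cases2[OF uvJ] by blast
    define P Q where PQ: "P = M (bracket u) u" "Q = M (bracket v) v"
    have "modulus m ?w dvd modulus m u" "modulus m ?w dvd modulus m v" by (auto intro: modulus_dvd)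
    moreover have "modulus m u dvd P - 1" "modulus m v dvd Q - 1" using M_bracket(2) uv by (auto simp: PQ)
    ultimately have "modulus m ?w dvd (P - 1) * Q + (Q - 1)"
      by (intro dvd_add dvd_mult2) (auto intro: dvd_trans)
    then have "modulus m ?w dvd P * Q - 1" by (simp add: algebra_simps)
    from dvd_diff[OF this 2] have "modulus m ?w dvd (P * Q - 1) - M (bracket v) u * M (bracket u) v" .
    moreover have "(P * Q - 1) - M (bracket v) u * M (bracket u) v = \<Phi> (pair_value (u, v)) ?w - 1"
      unfolding val[OF uvJ] PQ by simp
    ultimately show ?thesis by (simp only:)
  qed
  then have "modulus m ?w dvd z (u, v) * (\<Phi> (pair_value (u, v)) ?w - 1)" by (rule dvd_mult)
  from dvd_diff[OF zj this] have "modulus m ?w dvd z (u, v)" by (simp add: algebra_simps)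
  then show False using j(1) pair_modulus[OF uvJ] by (simp add: bad_def)
qed

theorem quotient_pairs:
  shows "group (G\<lparr>carrier := V\<rparr> Mod S)"
    and "\<exists>p \<in> hom int_functions (G\<lparr>carrier := V\<rparr> Mod S). p ` UNIV = carrier (G\<lparr>carrier := V\<rparr> Mod S) \<and>
      kernel int_functions (G\<lparr>carrier := V\<rparr> Mod S) p = {z. \<forall>j\<in>J. int (pair_order j) dvd z j}"
proof -
  obtain \<Phi> :: "'a \<Rightarrow> nat list \<Rightarrow> int" where
    add: "\<And>x z w. x \<in> V \<Longrightarrow> z \<in> V \<Longrightarrow> length w = a + b \<Longrightarrow> \<Phi> (x \<otimes> z) w = \<Phi> x w + \<Phi> z w" and
    form: "\<And>u v w. u \<in> lcs a \<Longrightarrow> v \<in> lcs b \<Longrightarrow> length w = a + b \<Longrightarrow>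
      \<Phi> (comm u v) w = M u (take a w) * M v (drop a w) - M v (take a w) * M u (drop a w)"
    using outer_form by blast
  have VS: "comm x z \<in> S" if "x \<in> V" "z \<in> V" for x z
    by (rule comm_V_S[OF that(1) normal_carrier[OF V_normal that(2)]])
  note * = quotient_presentation[OF V_subgroup S_normal S_subset_V VS finite_lyndon_pairs pair_value_V
      V_generated pair_value_pow, where \<Phi> = \<Phi> and W = "{w. length w = a + b}" and mo = "modulus m"]
  show "group (G\<lparr>carrier := V\<rparr> Mod S)"
    by (rule *(1)) (use add outer_form_S[OF add form] pair_independence[of \<Phi>, OF form] in auto)
  show "\<exists>p \<in> hom int_functions (G\<lparr>carrier := V\<rparr> Mod S). p ` UNIV = carrier (G\<lparr>carrier := V\<rparr> Mod S) \<and>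
      kernel int_functions (G\<lparr>carrier := V\<rparr> Mod S) p = {z. \<forall>j\<in>J. int (pair_order j) dvd z j}"
    by (rule *(2)) (use add outer_form_S[OF add form] pair_independence[of \<Phi>, OF form] in auto)
qed

end

section \<open>Coordinates of a free presentation\<close>

lemma card_increasing_pairs:
  fixes L :: "'a :: linorder set"
  assumes "finite L"
  shows "2 * card {(u, v). u \<in> L \<and> v \<in> L \<and> u < v} + card L = card L * card L"
proof -
  let ?A = "{(u, v). u \<in> L \<and> v \<in> L \<and> u < v}" and ?B = "{(u, v). u \<in> L \<and> v \<in> L \<and> v < u}"
  have fin: "finite ?A" "finite ?B" by (rule finite_subset[of _ "L \<times> L"]; use assms in auto)+
  have "bij_betw (\<lambda>(u, v). (v, u)) ?A ?B" by (rule bij_betw_byWitness[of _ "\<lambda>(u, v). (v, u)"]) auto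
  then have B: "card ?B = card ?A" by (simp add: bij_betw_same_card)
  have "L \<times> L = (?A \<union> ?B) \<union> (\<lambda>u. (u, u)) ` L" by auto
  then have "card L * card L = card ((?A \<union> ?B) \<union> (\<lambda>u. (u, u)) ` L)"
    by (metis card_cartesian_product)
  also have "\<dots> = card (?A \<union> ?B) + card ((\<lambda>u. (u, u)) ` L)"
    by (rule card_Un_disjoint) (use assms fin in auto)
  also have "card (?A \<union> ?B) = card ?A + card ?B" by (rule card_Un_disjoint[OF fin]) auto
  also have "card ((\<lambda>u. (u, u)) ` L) = card L" by (rule card_image) (auto simp: inj_on_def)
  finally show ?thesis using B by simp
qed

text \<open>The formula N(N-1)/2, rearranged to avoid subtraction and division of naturals.\<close>

lemma basic_comm_count_2: "2 * \<chi> 2 N + N = N * N"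
proof -
  have "{m :: nat. m dvd 2} = {1, 2}" using two_is_prime_nat by (auto simp: prime_nat_iff)
  then have "(\<Sum>m | m dvd (2 :: nat). moebius m * int N ^ (2 div m)) = int N ^ 2 - int N"
    by (simp add: moebius_def prime_prime_factors squarefree_prime)
  then have c: "\<chi> 2 N = nat ((int N ^ 2 - int N) div 2)" by (simp add: basic_comm_count_def)
  have ge: "int N \<le> int N ^ 2" by (cases N) (auto simp: power2_eq_square algebra_simps)
  have ev: "even (int N ^ 2 - int N)" by simp
  have "2 * int (\<chi> 2 N) = int N ^ 2 - int N" using c ge ev by simp
  then have "int (2 * \<chi> 2 N + N) = int (N * N)" by (simp add: power2_eq_square)
  then show ?thesis by linarith
qed

lemma card_lyndon_pairs:
  assumes "c2 \<le> c1"
  shows "card (lyndon_pairs c1 c2 d) =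
    (if c1 > c2 then \<chi> (c1 + 1) d * \<chi> (c2 + 1) d else \<chi> 2 (\<chi> (c1 + 1) d))"
proof (cases "c1 = c2")
  case False
  then have "lyndon_pairs c1 c2 d = lyndon_words (Suc c1) d \<times> lyndon_words (Suc c2) d"
    by (auto simp: lyndon_pairs_def)
  then show ?thesis using False assms by (simp add: card_cartesian_product card_lyndon_words)
next
  case True
  let ?L = "lyndon_words (Suc c1) d"
  have "lyndon_pairs c1 c2 d = {(u, v). u \<in> ?L \<and> v \<in> ?L \<and> u < v}"
    using True by (auto simp: lyndon_pairs_def)
  then show ?thesis
    using True card_increasing_pairs[of ?L] basic_comm_count_2[of "card ?L"] by (simp add: card_lyndon_words)
qed

lemma lyndon_words_mono: "d \<le> d' \<Longrightarrow> lyndon_words n d \<subseteq> lyndon_words n d'"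
  by (auto simp: lyndon_words_def words_def)

lemma lyndon_pairs_mono: "d \<le> d' \<Longrightarrow> lyndon_pairs c1 c2 d \<subseteq> lyndon_pairs c1 c2 d'"
  using lyndon_words_mono[of d d'] by (fastforce simp: lyndon_pairs_def)

text \<open>All pairs that appear when letter \<open>d\<close> is added therefore share the order
  \<open>m d\<close>.\<close>

lemma Max_lyndon_pair:
  assumes "(u, v) \<in> lyndon_pairs c1 c2 (Suc d)" "(u, v) \<notin> lyndon_pairs c1 c2 d"
  shows "Max (set (u @ v)) = d"
proof (rule Max_eqI)
  show "x \<le> d" if "x \<in> set (u @ v)" for x
    using assms(1) that by (auto simp: lyndon_pairs_def lyndon_words_def words_def)
  show "d \<in> set (u @ v)"
  proof (rule ccontr)
    assume "d \<notin> set (u @ v)"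
    then have "set u \<subseteq> {..<d}" "set v \<subseteq> {..<d}"
      using assms(1) by (auto simp: lyndon_pairs_def lyndon_words_def words_def less_Suc_eq)
    then show False using assms by (auto simp: lyndon_pairs_def lyndon_words_def words_def)
  qed
qed simp

lemma ex_enumeration: "finite A \<Longrightarrow> \<exists>f. bij_betw f {..<card A} A"
  using ex_bij_betw_nat_finite[of A] by (simp add: atLeast0LessThan)

text \<open>\<open>\<rho> j f\<close> is the j-th coordinate of the image of \<open>f\<close> in the
  quotient by \<open>R\<close>, as a residue modulo \<open>m j\<close>. Beyond \<open>d\<close> the
  modulus is 1, so statements can range over all \<open>j\<close>.\<close>

locale coordinates = group G for G (structure) +
  fixes \<rho> :: "nat \<Rightarrow> 'a \<Rightarrow> int" and m :: "nat \<Rightarrow> nat" and d :: nat and y :: "nat \<Rightarrow> 'a" and R :: "'a set"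
  assumes \<rho>_hom: "\<rho> j \<in> hom G (integer_mod_group (m j))"
    and R_eq: "R = {f \<in> carrier G. \<forall>j. \<rho> j f = 0}"
    and R_normal: "R \<lhd> G"
    and y_carrier: "y i \<in> carrier G"
    and \<rho>_y: "i < d \<Longrightarrow> \<rho> j (y i) = (if i = j then 1 else 0) mod int (m j)"
    and m_ge: "d \<le> j \<Longrightarrow> m j = 1"
begin

lemma group_hom_\<rho>: "group_hom G (integer_mod_group (m j)) (\<rho> j)"
  by (intro group_hom.intro group_hom_axioms.intro group_axioms group_integer_mod_group \<rho>_hom)

lemma \<rho>_mult: "x \<in> carrier G \<Longrightarrow> z \<in> carrier G \<Longrightarrow> \<rho> j (x \<otimes> z) = (\<rho> j x + \<rho> j z) mod int (m j)"
  using hom_mult[OF \<rho>_hom, of x z j] by simp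

lemma \<rho>_mod: "x \<in> carrier G \<Longrightarrow> \<rho> j x mod int (m j) = \<rho> j x"
  using hom_in_carrier[OF \<rho>_hom, of x j] by (auto simp: carrier_integer_mod_group split: if_splits)

lemma \<rho>_inv: "x \<in> carrier G \<Longrightarrow> \<rho> j (inv x) = (- \<rho> j x) mod int (m j)"
  using group_hom.hom_inv[OF group_hom_\<rho>, of x j] hom_in_carrier[OF \<rho>_hom, of x j] by simp

lemma \<rho>_int_pow: "x \<in> carrier G \<Longrightarrow> \<rho> j (x [^] (z :: int)) = (z * \<rho> j x) mod int (m j)"
  using group_hom.hom_int_pow[OF group_hom_\<rho>, of x j z] by (simp add: int_pow_integer_mod_group)

lemma comm_R: "x \<in> carrier G \<Longrightarrow> z \<in> carrier G \<Longrightarrow> comm x z \<in> R"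
proof -
  assume x: "x \<in> carrier G" and z: "z \<in> carrier G"
  have "\<rho> j (comm x z) = 0" for j
  proof -
    have "\<rho> j (comm x z) = (- \<rho> j x + - \<rho> j z + \<rho> j x + \<rho> j z) mod int (m j)"
      using x z by (simp add: comm_def \<rho>_mult \<rho>_inv mod_simps)
    then show ?thesis by simp
  qed
  then show ?thesis using x z by (simp add: R_eq)
qed

lemma y_pow: "i < d \<Longrightarrow> y i [^] m i \<in> R"
proof -
  assume i: "i < d"
  have "\<rho> j (y i [^] m i) = 0" for j
    using \<rho>_int_pow[OF y_carrier, of j i "int (m i)"] \<rho>_y[OF i, of j] by (auto simp: int_pow_int mod_simps)
  then show ?thesis using y_carrier by (simp add: R_eq)
qed

lemma generate_y: "carrier G \<subseteq> generate G (y ` {..<d} \<union> R)"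
proof
  fix f assume f: "f \<in> carrier G"
  let ?H = "generate G (y ` {..<d} \<union> R)"
  have sub: "y ` {..<d} \<union> R \<subseteq> carrier G" using y_carrier by (auto simp: R_eq)
  have H: "subgroup ?H G" by (rule generate_is_subgroup[OF sub])
  \<comment> \<open>Match the coordinates of \<open>f\<close> one at a time, multiplying by
    \<open>y n\<close> to the power \<open>\<rho> n f\<close>.\<close>
  have "n \<le> d \<Longrightarrow> \<exists>h\<in>?H. \<forall>j. \<rho> j h = (if j < n then \<rho> j f else 0) mod int (m j)" for n
  proof (induction n)
    case 0
    have "\<rho> j \<one> = 0" for j using group_hom.hom_one[OF group_hom_\<rho>, of j] by simp
    then show ?case using subgroup.one_closed[OF H] by (intro bexI[of _ \<one>]) auto
  next
    case (Suc n)
    then obtain h where h: "h \<in> ?H" "\<And>j. \<rho> j h = (if j < n then \<rho> j f else 0) mod int (m j)" by auto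
    have n: "n < d" using Suc.prems by simp
    let ?g = "y n [^] \<rho> n f"
    have "y n \<in> ?H" using n by (auto intro: generate.incl)
    then have g: "?g \<in> ?H" by (rule subgroup_int_pow_closed[OF H])
    have c: "h \<in> carrier G" using h(1) subgroup.subset[OF H] by auto
    have "\<rho> j (h \<otimes> ?g) = (if j < Suc n then \<rho> j f else 0) mod int (m j)" for j
      using c y_carrier h(2)[of j] \<rho>_y[OF n, of j]
      by (auto simp: \<rho>_mult \<rho>_int_pow mod_simps less_Suc_eq)
    then show ?case using subgroup.m_closed[OF H h(1) g] by blast
  qed
  from this[of d] obtain h where h: "h \<in> ?H" "\<And>j. \<rho> j h = (if j < d then \<rho> j f else 0) mod int (m j)" by auto
  have c: "h \<in> carrier G" using h(1) subgroup.subset[OF H] by auto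
  have "\<rho> j (f \<otimes> inv h) = 0" for j
  proof (cases "j < d")
    case True
    then show ?thesis using f c h(2)[of j] by (simp add: \<rho>_mult \<rho>_inv \<rho>_mod mod_simps)
  next
    case False
    then have "m j = 1" using m_ge by simp
    then show ?thesis using f c by (simp add: \<rho>_mult)
  qed
  then have "f \<otimes> inv h \<in> ?H" using f c by (intro generate.incl) (simp add: R_eq)
  then have "f \<otimes> inv h \<otimes> h \<in> ?H" using subgroup.m_closed[OF H] h(1) by blast
  then show "f \<in> ?H" using f c by (simp add: m_assoc)
qed

text \<open>Free generators may go to any series with constant term 1, so their linear coefficients
  are chosen to be the coordinates. Linear coefficients and coordinates are both additive modulo
  \<open>m j\<close>, so the congruence spreads from \<open>X\<close> to the whole group.\<close>

lemma ex_magnus_generators: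
  assumes free: "free_on G X"
  shows "\<exists>M. magnus_generators G M R m y d"
proof -
  define \<mu> where "\<mu> x w = (case w of [] \<Rightarrow> 1 | [j] \<Rightarrow> \<rho> j x | _ \<Rightarrow> 0)" for x and w :: "nat list"
  have "\<mu> \<in> X \<rightarrow> carrier magnus_group" by (auto simp: \<mu>_def)
  from free_on_extend[OF free group_magnus_group this] obtain M
    where M: "M \<in> hom G magnus_group" and MX: "\<And>x. x \<in> X \<Longrightarrow> M x = \<mu> x" by blast
  interpret magnus_hom G M by unfold_locales (rule M)
  have M1: "M (x \<otimes> z) [j] = M x [j] + M z [j]" if "x \<in> carrier G" "z \<in> carrier G" for x z j
    using M_mult_low[OF that vanishes_below_one vanishes_below_one, of "[j]"] by simp
  have Minv: "M (inv x) [j] = - M x [j]" if "x \<in> carrier G" for x j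
    using M_inv_low[OF that vanishes_below_one, of "[j]"] by simp
  let ?H = "{f \<in> carrier G. \<forall>j. (M f [j] - \<rho> j f) mod int (m j) = 0}"
  have "subgroup ?H G"
  proof (rule subgroupI)
    have "\<rho> j \<one> = 0" for j using group_hom.hom_one[OF group_hom_\<rho>, of j] by simp
    then have "\<one> \<in> ?H" by (simp add: M_one series_one_def)
    then show "?H \<noteq> {}" by blast
    fix x assume x: "x \<in> ?H"
    have "(M (inv x) [j] - \<rho> j (inv x)) mod int (m j) = (- (M x [j] - \<rho> j x)) mod int (m j)" for j
      using x by (simp add: Minv \<rho>_inv mod_simps)
    then show "inv x \<in> ?H" using x by (simp flip: dvd_eq_mod_eq_0 add: dvd_diff_commute)
    fix z assume z: "z \<in> ?H"
    have "(M (x \<otimes> z) [j] - \<rho> j (x \<otimes> z)) mod int (m j)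
        = ((M x [j] - \<rho> j x) + (M z [j] - \<rho> j z)) mod int (m j)" for j
      using x z by (simp add: M1 \<rho>_mult mod_simps algebra_simps)
    then show "x \<otimes> z \<in> ?H" using x z dvd_add by (simp flip: dvd_eq_mod_eq_0)
  qed auto
  moreover have "X \<subseteq> ?H" using MX free by (auto simp: free_on_def \<mu>_def)
  ultimately have "generate G X \<subseteq> ?H" by (intro generate_subgroup_incl)
  then have M\<rho>: "int (m j) dvd M f [j] - \<rho> j f" if "f \<in> carrier G" for f j
    using free_on_generate[OF free] that by auto
  have "magnus_generators G M R m y d"
  proof (intro magnus_generators.intro magnus_mod.intro magnus_mod_axioms.intro magnus_generators_axioms.intro)
    show "magnus_hom G M" by (rule magnus_hom_axioms)
    show "abelian_quotient G R"
      by (intro abelian_quotient.intro abelian_quotient_axioms.intro group_axioms R_normal comm_R)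
    show "int (m i) dvd M r [i]" if "r \<in> R" for r i
      using M\<rho>[of r i] that by (simp add: R_eq)
    show "y i \<in> carrier G" for i by (rule y_carrier)
    show "carrier G \<subseteq> generate G (y ` {..<d} \<union> R)" by (rule generate_y)
    fix i j assume "i < d"
    then have "int (m j) dvd \<rho> j (y i) - (if i = j then 1 else 0)"
      using \<rho>_y[of i j] by (simp add: mod_eq_dvd_iff[symmetric])
    from dvd_add[OF M\<rho>[OF y_carrier, of j i] this]
    show "int (m j) dvd M (y i) [j] - (if i = j then 1 else 0)" by simp
  qed
  then show ?thesis by blast
qed

end

lemma ex_coordinates:
  fixes F :: "('f, 'm) monoid_scheme" and G :: "('g, 'k) monoid_scheme"
  assumes "group F" and R: "R \<lhd> F" and "F Mod R \<cong> G"
    and "G \<cong> copies integer_group k \<times>\<times> sum_group {1..t} (\<lambda>i. integer_mod_group (n i))"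
  obtains \<rho> y where "coordinates F \<rho> (\<lambda>j. if j < k then 0 else if j < k + t then n (j - k + 1) else 1) (k + t) y R"
proof -
  interpret F: group F by fact
  interpret R: normal R F by fact
  let ?D = "copies integer_group k \<times>\<times> sum_group {1..t} (\<lambda>i. integer_mod_group (n i))"
  let ?m = "\<lambda>j. if j < k then 0 else if j < k + t then n (j - k + 1) else 1"
  have D: "group ?D" by (intro DirProd_group) simp_all
  have cD: "carrier ?D = (\<Pi>\<^sub>E i\<in>{..<k}. UNIV) \<times> (\<Pi>\<^sub>E i\<in>{1..t}. carrier (integer_mod_group (n i)))"
    by (simp add: carrier_copies carrier_sum_group_finite)
  from iso_trans[OF assms(3,4)] obtain \<psi> where \<psi>: "\<psi> \<in> iso (F Mod R) ?D" by (auto simp: is_iso_def)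
  have gQ: "group (F Mod R)" by (rule R.factorgroup_is_group)
  define \<theta> where "\<theta> = \<psi> \<circ> (\<lambda>f. R #>\<^bsub>F\<^esub> f)"
  have \<theta>: "\<theta> \<in> hom F ?D"
    unfolding \<theta>_def using R.r_coset_hom_Mod \<psi> by (auto simp: iso_def intro: Group.hom_compose)
  interpret \<theta>: group_hom F ?D \<theta> by (intro group_hom.intro group_hom_axioms.intro F.group_axioms D \<theta>)
  have surj: "\<exists>f\<in>carrier F. \<theta> f = x" if "x \<in> carrier ?D" for x
  proof -
    have "x \<in> \<psi> ` carrier (F Mod R)" using that \<psi> by (simp add: iso_def bij_betw_def)
    then show ?thesis by (auto simp: \<theta>_def FactGroup_def RCOSETS_def)
  qed
  have ker: "\<theta> f = \<one>\<^bsub>?D\<^esub> \<longleftrightarrow> f \<in> R" if f: "f \<in> carrier F" for f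
  proof -
    interpret \<psi>: group_hom "F Mod R" ?D \<psi>
      by (intro group_hom.intro group_hom_axioms.intro gQ D) (use \<psi> in \<open>simp add: iso_def\<close>)
    have c: "R #>\<^bsub>F\<^esub> f \<in> carrier (F Mod R)" using f by (auto simp: FactGroup_def RCOSETS_def)
    have inj: "inj_on \<psi> (carrier (F Mod R))" using \<psi> by (simp add: iso_def bij_betw_def)
    have "\<theta> f = \<one>\<^bsub>?D\<^esub> \<longleftrightarrow> \<psi> (R #>\<^bsub>F\<^esub> f) = \<psi> \<one>\<^bsub>F Mod R\<^esub>"
      unfolding \<psi>.hom_one by (simp add: \<theta>_def)
    also have "\<dots> \<longleftrightarrow> R #>\<^bsub>F\<^esub> f = \<one>\<^bsub>F Mod R\<^esub>"
      by (rule inj_on_eq_iff[OF inj c monoid.one_closed[OF group.is_monoid[OF gQ]]])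
    also have "\<dots> \<longleftrightarrow> f \<in> R"
      using F.coset_join1[OF _ f R.subgroup_axioms] F.coset_join2[OF f R.subgroup_axioms] by auto
    finally show ?thesis .
  qed
  \<comment> \<open>The finite summands are numbered from 1 and their letters from \<open>k\<close>,
    whence the index \<open>j - k + 1\<close>.\<close>
  define \<rho> where "\<rho> j f = (if j < k then fst (\<theta> f) j else if j < k + t then snd (\<theta> f) (j - k + 1) else 0)" for j f
  \<comment> \<open>The reduction modulo \<open>n q\<close> matters when \<open>n q = 1\<close>,
    where the only residue is 0. For \<open>i \<ge> k + t\<close> the element \<open>e i\<close> is
    neutral, so \<open>y i\<close> can be chosen for every \<open>i\<close>.\<close>
  define e where "e i = ((\<lambda>p\<in>{..<k}. if p = i then 1 else 0 :: int),
      (\<lambda>q\<in>{1..t}. (if k + q = i + 1 then 1 else 0 :: int) mod int (n q)))" for i :: nat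
  have e: "e i \<in> carrier ?D" for i unfolding cD by (auto simp: e_def)
  define y where "y i = (SOME f. f \<in> carrier F \<and> \<theta> f = e i)" for i
  have y: "y i \<in> carrier F" "\<theta> (y i) = e i" for i
    using someI_ex[of "\<lambda>f. f \<in> carrier F \<and> \<theta> f = e i"] surj[OF e] unfolding y_def by blast+
  have mem: "\<theta> f \<in> carrier ?D" if "f \<in> carrier F" for f using \<theta>.hom_closed[OF that] .
  have "coordinates F \<rho> ?m (k + t) y R"
  proof (intro coordinates.intro coordinates_axioms.intro F.group_axioms R y)
    show "\<rho> j \<in> hom F (integer_mod_group (?m j))" for j
    proof (rule homI)
      fix f assume "f \<in> carrier F"
      then have "\<theta> f \<in> carrier ?D" by (rule mem)
      then show "\<rho> j f \<in> carrier (integer_mod_group (?m j))"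
        unfolding cD by (auto simp: \<rho>_def mem_Times_iff PiE_iff carrier_integer_mod_group[of 0])
      fix g assume g: "g \<in> carrier F"
      have "\<theta> (f \<otimes>\<^bsub>F\<^esub> g) = \<theta> f \<otimes>\<^bsub>?D\<^esub> \<theta> g" using \<theta>.hom_mult[OF \<open>f \<in> carrier F\<close> g] .
      then show "\<rho> j (f \<otimes>\<^bsub>F\<^esub> g) = \<rho> j f \<otimes>\<^bsub>integer_mod_group (?m j)\<^esub> \<rho> j g"
        by (auto simp: \<rho>_def mult_DirProd')
    qed
    show "R = {f \<in> carrier F. \<forall>j. \<rho> j f = 0}"
    proof (intro equalityI subsetI)
      fix f assume f: "f \<in> R"
      have fc: "f \<in> carrier F" by (rule R.mem_carrier[OF f])
      have "\<theta> f = \<one>\<^bsub>?D\<^esub>" using ker[OF fc] f by (simp only:)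
      then show "f \<in> {f \<in> carrier F. \<forall>j. \<rho> j f = 0}" using fc by (auto simp: \<rho>_def)
    next
      fix f assume f: "f \<in> {f \<in> carrier F. \<forall>j. \<rho> j f = 0}"
      obtain g h where gh: "\<theta> f = (g, h)" by (cases "\<theta> f")
      have ghD: "g \<in> (\<Pi>\<^sub>E i\<in>{..<k}. UNIV)" "h \<in> (\<Pi>\<^sub>E i\<in>{1..t}. carrier (integer_mod_group (n i)))"
        using mem[of f] f gh unfolding cD by auto
      have "g j = 0" if "j < k" for j using f that gh by (auto simp: \<rho>_def dest: spec[of _ j])
      moreover have "h q = 0" if "q \<in> {1..t}" for q
      proof -
        have "\<rho> (k + q - 1) f = 0" using f by blast
        then show ?thesis using that gh by (auto simp: \<rho>_def split: if_splits)
      qed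
      ultimately have "g = (\<lambda>i\<in>{..<k}. 0)" "h = (\<lambda>i\<in>{1..t}. 0)"
        using ghD by (auto simp: fun_eq_iff PiE_iff extensional_def)
      then have "\<theta> f = \<one>\<^bsub>?D\<^esub>" using gh by simp
      then show "f \<in> R" using iffD1[OF ker[of f]] f by simp
    qed
    show "\<rho> j (y i) = (if i = j then 1 else 0) mod int (?m j)" if "i < k + t" for i j
      using that unfolding \<rho>_def y(2) by (auto simp: e_def)
    show "k + t \<le> j \<Longrightarrow> ?m j = 1" for j by simp
  qed
  then show thesis using that by blast
qed

theorem theorem2p6:
  fixes c1 c2 k t :: nat
    and n b :: "nat \<Rightarrow> nat"
    and G :: "('g, 'k) monoid_scheme"
    and F :: "('f, 'm) monoid_scheme"
    and R :: "'f set"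
  assumes "1 \<le> c1" and "1 \<le> c2" and "c2 \<le> c1" and "c1 \<le> 2 * c2"
    and "\<And>i. 1 \<le> i \<Longrightarrow> i \<le> t \<Longrightarrow> 0 < n i"
    and "\<And>i. 1 \<le> i \<Longrightarrow> i + 1 \<le> t \<Longrightarrow> n (i + 1) dvd n i"
    and "group G"
    and "G \<cong> copies integer_group k \<times>\<times> sum_group {1..t} (\<lambda>i. integer_mod_group (n i))"
    and "free_presentation F R G"
    and "\<And>i. b i = (if c1 > c2 then \<chi> (c1 + 1) i * \<chi> (c2 + 1) i else \<chi> 2 (\<chi> (c1 + 1) i))"
  shows "baer_invariant {outer_comm_word c1 c2} F R \<cong>
           copies integer_group (b k) \<times>\<times>
           sum_group {1..t} (\<lambda>i. copies (integer_mod_group (n i)) (b (k + i) - b (k + i - 1)))"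
proof -
  from \<open>free_presentation F R G\<close> obtain X where X: "free_on F X" and R: "R \<lhd> F" and FR: "F Mod R \<cong> G"
    by (auto simp: free_presentation_def is_free_group_def)
  have F: "group F" using X by (simp add: free_on_def)
  define m where "m j = (if j < k then 0 else if j < k + t then n (j - k + 1) else 1)" for j
  from ex_coordinates[OF F R FR assms(8)] obtain \<rho> y where "coordinates F \<rho> m (k + t) y R"
    unfolding m_def[abs_def] by blast
  then interpret co: coordinates F \<rho> m "k + t" y R .
  from co.ex_magnus_generators[OF X] obtain M where "magnus_generators F M R m y (k + t)" by blast
  then interpret mg: magnus_generators F M R m y "k + t" .
  have n_chain: "n j dvd n i" if "1 \<le> i" "i \<le> j" "j \<le> t" for i j
    using that(2,1,3)
  proof (induction rule: dec_induct)
    case (step l)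
    then show ?case using assms(6)[of l] dvd_trans[of "n (Suc l)" "n l" "n i"] by simp
  qed simp
  \<comment> \<open>Letters below \<open>k\<close> have order 0, which every number divides.\<close>
  have m_chain: "m j dvd m i" if "i \<le> j" "j < k + t" for i j
    using that n_chain[of "i - k + 1" "j - k + 1"] by (auto simp: m_def)
  interpret os: outer_setting F M R m y "k + t" X c1 c2
    by unfold_locales (use X assms(2-4) co.y_pow m_chain in auto)
  let ?V = "verbal_subgroup {outer_comm_word c1 c2} F" and ?S = "star_subgroup {outer_comm_word c1 c2} F R"
  let ?J = "lyndon_pairs c1 c2"
  let ?N = "\<lambda>i. b (k + i) - b (k + i - 1)" and ?K = "\<lambda>i. ?J (k + i) - ?J (k + i - 1)"
  have bJ: "card (?J i) = b i" for i using card_lyndon_pairs[OF assms(3)] assms(10) by simp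
  obtain \<epsilon>0 where \<epsilon>0: "bij_betw \<epsilon>0 {..<b k} (?J k)" using ex_enumeration[of "?J k"] bJ by auto
  have "\<exists>f. bij_betw f {..<?N i} (?K i)" for i
  proof -
    have "card (?K i) = ?N i"
      using card_Diff_subset[OF finite_lyndon_pairs lyndon_pairs_mono[of "k + i - 1" "k + i"]] bJ by simp
    then show ?thesis using ex_enumeration[of "?K i"] by auto
  qed
  then obtain \<epsilon> where \<epsilon>: "\<And>i. bij_betw (\<epsilon> i) {..<?N i} (?K i)" by metis
  have J: "?J (k + t) = ?J k \<union> (\<Union>i\<in>{1..t}. ?K i)"
  proof (induction t)
    case (Suc l)
    have "?J (k + l) \<subseteq> ?J (k + Suc l)" by (rule lyndon_pairs_mono) simp
    moreover have "{1..Suc l} = insert (Suc l) {1..l}" by auto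
    ultimately show ?case using Suc by auto
  qed simp
  have disj0: "?J k \<inter> ?K i = {}" if "i \<in> {1..t}" for i
  proof -
    have "?J k \<subseteq> ?J (k + i - 1)" by (rule lyndon_pairs_mono) (use that in auto)
    then show ?thesis by blast
  qed
  have disj: "?K i \<inter> ?K j = {}" if "i \<in> {1..t}" "j \<in> {1..t}" "i \<noteq> j" for i j
  proof -
    have "?J (k + i) \<subseteq> ?J (k + j - 1) \<or> ?J (k + j) \<subseteq> ?J (k + i - 1)"
    proof (cases "i < j")
      case True
      then show ?thesis using lyndon_pairs_mono[of "k + i" "k + j - 1"] by simp
    next
      case False
      then show ?thesis using that lyndon_pairs_mono[of "k + j" "k + i - 1"] by simp
    qed
    then show ?thesis by blast
  qed
  have ord0: "os.pair_order j = 0" if "j \<in> ?J k" for j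
  proof -
    obtain u v where uv: "j = (u, v)" by (cases j)
    have "u \<noteq> []" "set (u @ v) \<subseteq> {..<k}"
      using that by (auto simp: uv lyndon_pairs_def lyndon_words_def words_def)
    then have "Max (set (u @ v)) < k" using Max_in[of "set (u @ v)"] by auto
    then show ?thesis by (simp add: uv os.pair_order_def m_def)
  qed
  have ord: "os.pair_order j = n i" if "i \<in> {1..t}" "j \<in> ?K i" for i j
  proof -
    obtain u v where uv: "j = (u, v)" by (cases j)
    have "Max (set (u @ v)) = k + i - 1"
      using Max_lyndon_pair[of u v c1 c2 "k + i - 1"] that by (simp add: uv)
    moreover have "\<not> k + i - 1 < k" "k + i - 1 < k + t" "k + i - 1 - k + 1 = i" using that(1) by auto
    then have "m (k + i - 1) = n i" by (simp only: m_def if_True if_False)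
    ultimately show ?thesis by (simp add: uv os.pair_order_def)
  qed
  have pres: "group (cyclic_sum (b k) t n ?N)"
    "\<exists>p \<in> hom int_functions (cyclic_sum (b k) t n ?N). p ` UNIV = carrier (cyclic_sum (b k) t n ?N) \<and>
      kernel int_functions (cyclic_sum (b k) t n ?N) p = {z. \<forall>j\<in>?J (k + t). int (os.pair_order j) dvd z j}"
    by (rule cyclic_sum_presentation[OF \<epsilon>0 \<epsilon> disj0 disj J ord0 ord]; assumption)+
  have "F\<lparr>carrier := ?V\<rparr> Mod ?S \<cong> cyclic_sum (b k) t n ?N"
  proof -
    obtain p where p: "p \<in> hom int_functions (F\<lparr>carrier := ?V\<rparr> Mod ?S)"
      "p ` UNIV = carrier (F\<lparr>carrier := ?V\<rparr> Mod ?S)"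
      "kernel int_functions (F\<lparr>carrier := ?V\<rparr> Mod ?S) p = {z. \<forall>j\<in>?J (k + t). int (os.pair_order j) dvd z j}"
      using os.quotient_pairs(2) by blast
    obtain q where q: "q \<in> hom int_functions (cyclic_sum (b k) t n ?N)"
      "q ` UNIV = carrier (cyclic_sum (b k) t n ?N)"
      "kernel int_functions (cyclic_sum (b k) t n ?N) q = {z. \<forall>j\<in>?J (k + t). int (os.pair_order j) dvd z j}"
      using pres(2) by blast
    show ?thesis
      by (rule iso_of_same_kernel[OF group_int_functions os.quotient_pairs(1) pres(1) p(1) q(1)])
        (simp_all only: p(2,3) q(2,3) int_functions_simps)
  qed
  \<comment> \<open>\<open>V\<close> lies in gamma_(a+b), which is contained in \<open>R\<close>
    because the quotient is abelian.\<close>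
  moreover have "?V \<subseteq> R"
    using order_trans[OF os.V_subset_lcs os.lcs_subset_rel[of "Suc 0" "Suc c1 + Suc c2"]] by simp
  then have "R \<inter> ?V = ?V" by blast
  ultimately show ?thesis unfolding baer_invariant_def by simp
qed

end
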